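(* The Feedback Arc Set problem (FAS) is (polynomial-time many-one) reducible to the Acyclic Hamiltonian Partition problem (AHP).
   Context: All graphs are finite directed graphs. A feedback arc set of a digraph $G=\langle V,E\rangle$ is a subset $E'\subseteq E$ containing at least one arc of every directed cycle of $G$. FAS: Instance: a directed graph $G=\langle V,E\rangle$ and a positive integer $K\le|V|$. Question: is there a feedback arc set of $G$ of size at most $K$? For a digraph $G=\langle V,E\rangle$ and $V_1\subseteq V$, $G[V_1]$ is the induced subgraph. A partition $\pi=\{V_1,\dots,V_k\}$ of $V$ is an $\mathcal{H}^k$-partition if each $G[V_i]$ has a directed Hamiltonian path. The quotient digraph $G/\pi$ has vertex set $\pi$ and an arc $\langle V_i,V_j\rangle$ ($i\ne j$) whenever some arc of $E$ goes from $V_i$ to $V_j$. An $\mathcal{H}^{(\ast)}$-partition is an $\mathcal{H}^k$-partition (for some $k$) whose quotient digraph $G/\pi$ is acyclic. AHP: Instance: a DAG $G=\langle V,E\rangle$ and a positive integer $K\le|V|$. Question: is there an $\mathcal{H}^{(\ast)}$-partition of $G$ of size at most $K$? *)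

theory Defs
  imports Main "HOL-Library.Product_Lexorder"
begin

definition digraph :: "'a set \<Rightarrow> ('a \<times> 'a) set \<Rightarrow> bool" where
  "digraph V E \<longleftrightarrow> finite V \<and> E \<subseteq> V \<times> V"

definition is_dicycle :: "('a \<times> 'a) set \<Rightarrow> 'a list \<Rightarrow> bool" where
  "is_dicycle E cs \<longleftrightarrow> cs \<noteq> [] \<and> distinct cs \<and>
     (\<forall>i < length cs. (cs ! i, cs ! ((i + 1) mod length cs)) \<in> E)"

definition cycle_arcs :: "'a list \<Rightarrow> ('a \<times> 'a) set" where
  "cycle_arcs cs = {(cs ! i, cs ! ((i + 1) mod length cs)) | i. i < length cs}"

definition feedback_arc_set :: "('a \<times> 'a) set \<Rightarrow> ('a \<times> 'a) set \<Rightarrow> bool" where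
  "feedback_arc_set E E' \<longleftrightarrow> E' \<subseteq> E \<and> (\<forall>cs. is_dicycle E cs \<longrightarrow> cycle_arcs cs \<inter> E' \<noteq> {})"

definition is_dag :: "'a set \<Rightarrow> ('a \<times> 'a) set \<Rightarrow> bool" where
  "is_dag V E \<longleftrightarrow> digraph V E \<and> \<not> (\<exists>cs. is_dicycle E cs)"

definition has_ham_path :: "('a \<times> 'a) set \<Rightarrow> 'a set \<Rightarrow> bool" where
  "has_ham_path E A \<longleftrightarrow> (\<exists>ps. distinct ps \<and> set ps = A \<and>
     (\<forall>i. i + 1 < length ps \<longrightarrow> (ps ! i, ps ! (i + 1)) \<in> E))"

definition is_partition :: "'a set \<Rightarrow> 'a set set \<Rightarrow> bool" where
  "is_partition V \<pi> \<longleftrightarrow> (\<forall>A\<in>\<pi>. A \<noteq> {}) \<and> \<Union>\<pi> = V \<and>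
     (\<forall>A\<in>\<pi>. \<forall>B\<in>\<pi>. A \<noteq> B \<longrightarrow> A \<inter> B = {})"

definition quotient_arcs :: "('a \<times> 'a) set \<Rightarrow> 'a set set \<Rightarrow> ('a set \<times> 'a set) set" where
  "quotient_arcs E \<pi> = {(A, B). A \<in> \<pi> \<and> B \<in> \<pi> \<and> A \<noteq> B \<and> (\<exists>u\<in>A. \<exists>v\<in>B. (u, v) \<in> E)}"

definition H_partition :: "'a set \<Rightarrow> ('a \<times> 'a) set \<Rightarrow> 'a set set \<Rightarrow> bool" where
  "H_partition V E \<pi> \<longleftrightarrow> is_partition V \<pi> \<and> (\<forall>A\<in>\<pi>. has_ham_path E A)"

definition H_star_partition :: "'a set \<Rightarrow> ('a \<times> 'a) set \<Rightarrow> 'a set set \<Rightarrow> bool" where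
  "H_star_partition V E \<pi> \<longleftrightarrow> H_partition V E \<pi> \<and>
     \<not> (\<exists>cs. is_dicycle (quotient_arcs E \<pi>) cs)"

definition FAS_yes :: "nat set \<Rightarrow> (nat \<times> nat) set \<Rightarrow> nat \<Rightarrow> bool" where
  "FAS_yes V E K \<longleftrightarrow> digraph V E \<and> 0 < K \<and> K \<le> card V \<and>
     (\<exists>E'. feedback_arc_set E E' \<and> card E' \<le> K)"

definition AHP_yes :: "nat set \<Rightarrow> (nat \<times> nat) set \<Rightarrow> nat \<Rightarrow> bool" where
  "AHP_yes V E K \<longleftrightarrow> is_dag V E \<and> 0 < K \<and> K \<le> card V \<and>
     (\<exists>\<pi>. H_star_partition V E \<pi> \<and> card \<pi> \<le> K)"

text \<open>Binary numerals, little endian, digit 1 = bit 0, digit 2 = bit 1; 0 is the empty word.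
  The most significant digit is always 2, so the encoding is injective.\<close>
fun bin :: "nat \<Rightarrow> nat list" where
  "bin n = (if n = 0 then [] else (if even n then 1 else 2) # bin (n div 2))"

definition enc :: "nat set \<Rightarrow> (nat \<times> nat) set \<Rightarrow> nat \<Rightarrow> nat list" where
  "enc V E K =
     concat (map (\<lambda>v. bin v @ [3]) (sorted_list_of_set V)) @ [4] @
     concat (map (\<lambda>(a, b). bin a @ [3] @ bin b @ [3]) (sorted_list_of_set E)) @ [4] @
     bin K"

definition FAS_lang :: "nat list set" where
  "FAS_lang = {enc V E K | V E K. FAS_yes V E K}"

definition AHP_lang :: "nat list set" where
  "AHP_lang = {enc V E K | V E K. AHP_yes V E K}"

text \<open>States 0..n_states-1, start state 0, halting state 1; tape symbols 0..n_syms-1,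
  blank 0. Transitions give new state, written symbol and head move in {-1,0,1}.\<close>
datatype tm = TM (n_states: nat) (n_syms: nat) (delta: "nat \<Rightarrow> nat \<Rightarrow> nat \<times> nat \<times> int")

definition wf_tm :: "tm \<Rightarrow> bool" where
  "wf_tm M \<longleftrightarrow> 2 \<le> n_states M \<and> 5 \<le> n_syms M \<and>
     (\<forall>q < n_states M. \<forall>s < n_syms M. case delta M q s of (q', s', d) \<Rightarrow>
        q' < n_states M \<and> s' < n_syms M \<and> d \<in> {-1, 0, 1})"

type_synonym config = "nat \<times> (int \<Rightarrow> nat) \<times> int"

definition tm_step :: "tm \<Rightarrow> config \<Rightarrow> config" where
  "tm_step M c = (case c of (q, t, p) \<Rightarrow>
     if q = 1 then (q, t, p)
     else (case delta M q (t p) of (q', s', d) \<Rightarrow> (q', t(p := s'), p + d)))"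

definition tm_init :: "nat list \<Rightarrow> config" where
  "tm_init w = (0, (\<lambda>i. if 0 \<le> i \<and> nat i < length w then w ! nat i else 0), 0)"

definition tm_output :: "config \<Rightarrow> nat list" where
  "tm_output c = (case c of (q, t, p) \<Rightarrow>
     map (\<lambda>k. t (p + int k)) [0..<(LEAST k::nat. t (p + int k) = 0)])"

definition poly_reducible :: "nat list set \<Rightarrow> nat list set \<Rightarrow> bool" where
  "poly_reducible A B \<longleftrightarrow> (\<exists>M f (c::nat). wf_tm M \<and>
     (\<forall>w \<in> lists {1, 2, 3, 4}.
        (\<exists>k \<le> c * length w ^ c + c.
           fst ((tm_step M ^^ k) (tm_init w)) = 1 \<and> tm_output ((tm_step M ^^ k) (tm_init w)) = f w) \<and>
        (w \<in> A \<longleftrightarrow> f w \<in> B)))"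

end

theory Submission
  imports Defs
begin

text \<open>
  Let \<open>G\<close> have \<open>n\<close> vertices and \<open>m\<close> arcs, and let \<open>k > 2 n\<close>. The new digraph has a vertex \<open>N v\<close> for
  every vertex \<open>v\<close>, vertices \<open>A e i\<close> and \<open>B e i\<close> for every arc \<open>e\<close> and \<open>i < k\<close>, and for every arc
  \<open>e = (u, v)\<close> the arcs from \<open>A e i\<close> to \<open>B e i\<close>, from \<open>N u\<close> to \<open>B e i\<close> and from \<open>A e i\<close> to \<open>N v\<close>.
  It is acyclic, but contracting a pair \<open>{A e i, B e i}\<close> restores \<open>e\<close> as a path from \<open>N u\<close> to \<open>N v\<close>.
  Hence contracting all pairs of the arcs outside a feedback arc set of size \<open>f\<close> gives an acyclic
  quotient with \<open>n + k (m + f)\<close> parts. Conversely, the arcs without a contracted pair always form a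
  feedback arc set. A part that is neither a singleton nor a pair has at most three vertices and
  contains some \<open>N v\<close>; these parts save at most \<open>2 n < k\<close>, so a partition with at most
  \<open>n + k (m + K)\<close> parts leaves at most \<open>K\<close> arcs without a pair. As \<open>k\<close> we take twice the length of
  the input.

  The new vertices are numbered such that the reduction writes the new lists in the order of the
  given ones. The output therefore is a sorted list of vertices and arcs with endpoints among the
  vertices only if the input is, and the machine need not check this.

  The Turing machine arises from a structured program over finitely many stacks. Its control states
  are the continuations of the program and the stacks are tracks of the tape, so that a step of the
  program costs one sweep over the tape.
\<close>

section \<open>A stack language and its compilation to a Turing machine\<close>

text \<open>\<open>poly_reducible\<close> quantifies over all words over the four symbols, so the
  machine must halt in time with a right answer on malformed words too. It checks only what its
  output could not reveal: that the word parses into canonical numerals and that \<open>K\<close> is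
  positive and at most \<open>n\<close>. Failures give the empty word, which encodes nothing, as
  every encoding contains the symbol 4.

  On a parsed word of length \<open>L\<close>, every numeral has length at most \<open>L\<close>,
  and \<open>L\<close> is at least \<open>n + 2\<close>. So \<open>k = 2 L\<close> serves as padding
  width and exceeds \<open>2 n\<close>. Padding puts all parts of the new names at fixed digit
  positions, which makes their order a comparison of blocks. The copy number is in thermometer code:
  advancing it is one pop and one push, and its value \<open>2 ^ i - 1\<close> still grows with
  \<open>i\<close>.

  If \<open>K\<close> exceeds the number \<open>m\<close> of arcs, \<open>n + k (m + K)\<close>
  exceeds the \<open>n + 2 k m\<close> vertices of the new graph, which AHP forbids; hence the new
  bound uses \<open>min K m\<close>. Moreover \<open>K\<close> is binary and may be exponential in
  \<open>L\<close>, so it is never counted out but decremented at most \<open>n\<close>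
  times.\<close>

datatype com = Skip | Push nat nat | Pop nat | Seq com com
  | Cond nat "nat set" com com | Loop nat "nat set" com

type_synonym store = "nat \<Rightarrow> nat list"

text \<open>The value 0 is the blank. Stack entries are kept between 1 and 4, so 0 signals an empty
  stack.\<close>

definition peek :: "nat list \<Rightarrow> nat" where
  "peek xs = (case xs of [] \<Rightarrow> 0 | x # _ \<Rightarrow> x)"

lemma peek_simps [simp]: "peek [] = 0" "peek (x # xs) = x"
  by (auto simp: peek_def)

text \<open>\<open>Skip\<close> and \<open>Seq\<close> concern no stack; assigning them stack 0 lets
  every command be executed by the same kind of sweep.\<close>

fun idx :: "com \<Rightarrow> nat" where
  "idx (Push i x) = i"
| "idx (Pop i) = i"
| "idx (Cond i S a b) = i"
| "idx (Loop i S a) = i"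
| "idx _ = 0"

fun nxt :: "com \<Rightarrow> com list \<Rightarrow> nat \<Rightarrow> com list" where
  "nxt (Seq a b) k x = a # b # k"
| "nxt (Cond i S a b) k x = (if x \<in> S then a else b) # k"
| "nxt (Loop i S a) k x = (if x \<in> S then a # Loop i S a # k else k)"
| "nxt _ k x = k"

fun upd :: "com \<Rightarrow> store \<Rightarrow> store" where
  "upd (Push i x) mem = mem(i := x # mem i)"
| "upd (Pop i) mem = mem(i := tl (mem i))"
| "upd _ mem = mem"

fun sstep :: "com list \<times> store \<Rightarrow> com list \<times> store" where
  "sstep ([], mem) = ([], mem)"
| "sstep (c # k, mem) = (nxt c k (peek (mem (idx c))), upd c mem)"

fun well_formed :: "nat \<Rightarrow> com \<Rightarrow> bool" where
  "well_formed R Skip \<longleftrightarrow> 0 < R"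
| "well_formed R (Push i x) \<longleftrightarrow> i < R \<and> 0 < x \<and> x < 5"
| "well_formed R (Pop i) \<longleftrightarrow> i < R"
| "well_formed R (Seq a b) \<longleftrightarrow> 0 < R \<and> well_formed R a \<and> well_formed R b"
| "well_formed R (Cond i S a b) \<longleftrightarrow> i < R \<and> well_formed R a \<and> well_formed R b"
| "well_formed R (Loop i S a) \<longleftrightarrow> i < R \<and> well_formed R a"

text \<open>The continuations that can occur while a command runs; they become the control states of
  the Turing machine.\<close>
fun conts :: "com \<Rightarrow> com list \<Rightarrow> com list set" where
  "conts (Seq a b) k = insert (Seq a b # k) (conts a (b # k) \<union> conts b k)"
| "conts (Cond i S a b) k = insert (Cond i S a b # k) (conts a k \<union> conts b k)"
| "conts (Loop i S a) k = insert (Loop i S a # k) (conts a (Loop i S a # k))"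
| "conts c k = {c # k}"

lemma finite_conts: "finite (conts c k)"
  by (induction c arbitrary: k) auto

lemma self_in_conts: "c # k \<in> conts c k"
  by (cases c) auto

text \<open>This closure makes the finite set \<open>conts\<close> a set of control states: a loop
  puts itself back below its body, so the continuations do not grow from round to round.\<close>

lemma nxt_in_conts: "c' # k' \<in> conts c k \<Longrightarrow> nxt c' k' x \<in> insert k (conts c k)"
proof (induction c arbitrary: k)
  case (Seq a b)
  from Seq.prems consider "c' = Seq a b" "k' = k" | "c' # k' \<in> conts a (b # k)" | "c' # k' \<in> conts b k"
    by auto
  then show ?case
    using Seq.IH self_in_conts[of a "b # k"] self_in_conts[of b k] by cases fastforce+
next
  case (Cond i S a b)
  from Cond.prems consider "c' = Cond i S a b" "k' = k" | "c' # k' \<in> conts a k" | "c' # k' \<in> conts b k"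
    by auto
  then show ?case
    using Cond.IH self_in_conts[of a k] self_in_conts[of b k] by cases auto
next
  case (Loop i S a)
  from Loop.prems consider "c' = Loop i S a" "k' = k" | "c' # k' \<in> conts a (Loop i S a # k)"
    by auto
  then show ?case
    using Loop.IH[of "Loop i S a # k"] self_in_conts[of a "Loop i S a # k"] by cases fastforce+
qed auto

text \<open>The symbol written into the first free cell of the stack. The default 0 leaves that cell
  blank, so one transition covers all commands.\<close>

fun pushed :: "com \<Rightarrow> nat" where
  "pushed (Push i x) = x"
| "pushed _ = 0"

definition is_pop :: "com \<Rightarrow> bool" where
  "is_pop c \<longleftrightarrow> (\<exists>i. c = Pop i)"

lemma conts_well_formed:
  "c' # k' \<in> conts c k \<Longrightarrow> well_formed R c \<Longrightarrow> well_formed R c'"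
  by (induction c arbitrary: k) auto

lemma well_formed_idx: "well_formed R c \<Longrightarrow> idx c < R \<and> pushed c < 5"
  by (cases c) auto

subsection \<open>Machines over arbitrary finite state and symbol sets\<close>

fun astep :: "('q \<Rightarrow> 's \<Rightarrow> 'q \<times> 's \<times> int) \<Rightarrow> 'q \<times> (int \<Rightarrow> 's) \<times> int \<Rightarrow> 'q \<times> (int \<Rightarrow> 's) \<times> int" where
  "astep \<delta> (q, t, p) = (case \<delta> q (t p) of (q', s', d) \<Rightarrow> (q', t(p := s'), p + d))"

text \<open>Some numbers are prescribed by the machine model: 0 and 1 for the start and the halting
  state, 0 to 4 for blank and input symbols. The remaining elements are numbered
  arbitrarily.\<close>

lemma enumerate_extending:
  assumes "finite S" "inj_on b {..<m}" "b ` {..<m} \<subseteq> S"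
  obtains e :: "'a \<Rightarrow> nat" where "bij_betw e S {..<card S}" "\<And>i. i < m \<Longrightarrow> e (b i) = i"
proof -
  let ?B = "b ` {..<m}"
  have cB: "card ?B = m" using assms(2) by (simp add: card_image)
  have cS: "card S = m + card (S - ?B)"
    using assms cB by (metis card_Diff_subset card_mono finite_imageI finite_lessThan le_add_diff_inverse)
  obtain g where g: "bij_betw g (S - ?B) {0..<card (S - ?B)}"
    using assms(1) ex_bij_betw_finite_nat by blast
  let ?e = "\<lambda>x. if x \<in> ?B then the_inv_into {..<m} b x else m + g x"
  have eb: "?e (b i) = i" if "i < m" for i
    using that assms(2) by (simp add: the_inv_into_f_f)
  have 1: "bij_betw ?e ?B {..<m}"
    using assms(2) eb by (force simp: bij_betw_def inj_on_def)
  have "bij_betw (\<lambda>x. m + g x) (S - ?B) {m..<card S}"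
    using bij_betw_trans[OF g, of "\<lambda>x. m + x" "{m..<card S}"] cS
    by (simp add: bij_betw_def comp_def add.commute)
  then have 2: "bij_betw ?e (S - ?B) {m..<card S}"
    by (rule bij_betw_cong[THEN iffD1, rotated]) auto
  have "bij_betw ?e (?B \<union> (S - ?B)) ({..<m} \<union> {m..<card S})"
    by (rule bij_betw_combine[OF 1 2]) auto
  moreover have "?B \<union> (S - ?B) = S" "{..<m} \<union> {m..<card S} = {..<card S}"
    using assms(3) cS by auto
  ultimately have "bij_betw ?e S {..<card S}" by simp
  then show ?thesis using eb that by blast
qed

text \<open>\<open>tm_step\<close> freezes every configuration in state 1 whatever the transition
  function says; the assumption on \<open>q1\<close> makes \<open>astep\<close> do the same.\<close>

lemma tm_of_finite_machine:
  fixes \<delta> :: "'q \<Rightarrow> 's \<Rightarrow> 'q \<times> 's \<times> int" and b :: "nat \<Rightarrow> 's"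
  assumes fin: "finite Q" "finite S"
    and q: "q0 \<in> Q" "q1 \<in> Q" "q0 \<noteq> q1"
    and b: "inj_on b {..<5}" "b ` {..<5} \<subseteq> S"
    and cl: "\<And>q s q' s' d. q \<in> Q \<Longrightarrow> s \<in> S \<Longrightarrow> \<delta> q s = (q', s', d) \<Longrightarrow>
               q' \<in> Q \<and> s' \<in> S \<and> d \<in> {-1, 0, 1}"
    and halt: "\<And>s. \<delta> q1 s = (q1, s, 0)"
  shows "\<exists>M eQ eS. wf_tm M \<and> eQ q0 = 0 \<and> eQ q1 = 1 \<and> (\<forall>i<5. eS (b i) = i) \<and>
    (\<forall>q t p q' t' p' n. q \<in> Q \<longrightarrow> range t \<subseteq> S \<longrightarrow> (astep \<delta> ^^ n) (q, t, p) = (q', t', p') \<longrightarrow>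
       (tm_step M ^^ n) (eQ q, eS \<circ> t, p) = (eQ q', eS \<circ> t', p'))"
proof -
  let ?bq = "\<lambda>i::nat. if i = 0 then q0 else q1"
  have "inj_on ?bq {..<2}" "?bq ` {..<2} \<subseteq> Q"
    using q by (auto simp: inj_on_def)
  then obtain eQ where eQ: "bij_betw eQ Q {..<card Q}" "\<And>i. i < 2 \<Longrightarrow> eQ (?bq i) = i"
    using enumerate_extending[OF fin(1), of ?bq 2] by metis
  obtain eS where eS: "bij_betw eS S {..<card S}" "\<And>i. i < 5 \<Longrightarrow> eS (b i) = i"
    using enumerate_extending[OF fin(2) b] by metis
  have e01: "eQ q0 = 0" "eQ q1 = 1" using eQ(2)[of 0] eQ(2)[of 1] by auto
  let ?dq = "the_inv_into Q eQ" and ?ds = "the_inv_into S eS"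
  define M where "M = TM (card Q) (card S)
    (\<lambda>q s. case \<delta> (?dq q) (?ds s) of (q', s', d) \<Rightarrow> (eQ q', eS s', d))"
  have iQ: "inj_on eQ Q" and iS: "inj_on eS S" using eQ eS by (auto simp: bij_betw_def)
  have mQ: "eQ x < card Q" if "x \<in> Q" for x using eQ(1) that by (auto simp: bij_betw_def)
  have mS: "eS x < card S" if "x \<in> S" for x using eS(1) that by (auto simp: bij_betw_def)
  have dQ: "?dq x \<in> Q" if "x < card Q" for x
    using eQ(1) that by (metis bij_betwE bij_betw_the_inv_into lessThan_iff)
  have dS: "?ds x \<in> S" if "x < card S" for x
    using eS(1) that by (metis bij_betwE bij_betw_the_inv_into lessThan_iff)
  have "2 \<le> card Q" using card_mono[OF fin(1), of "{q0, q1}"] q by simp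
  moreover have "5 \<le> card S"
    using card_mono[OF fin(2) b(2)] card_image[OF b(1)] by simp
  moreover have "case delta M q s of (q', s', d) \<Rightarrow>
        q' < n_states M \<and> s' < n_syms M \<and> d \<in> {-1, 0, 1}"
    if "q < card Q" "s < card S" for q s
    using cl[OF dQ[OF that(1)] dS[OF that(2)]] mQ mS unfolding M_def
    by (auto split: prod.split)
  ultimately have "wf_tm M" by (simp add: wf_tm_def M_def)
  have step: "tm_step M (eQ q, eS \<circ> t, p) = (eQ q', eS \<circ> t', p') \<and> q' \<in> Q \<and> range t' \<subseteq> S"
    if "q \<in> Q" "range t \<subseteq> S" "astep \<delta> (q, t, p) = (q', t', p')" for q t p q' t' p'
  proof -
    obtain q'' s'' d where d: "\<delta> q (t p) = (q'', s'', d)" by (metis prod_cases3)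
    have tp: "t p \<in> S" using that by auto
    have r: "q' = q''" "t' = t(p := s'')" "p' = p + d" using that(3) d by auto
    have "eQ q = 1 \<longleftrightarrow> q = q1" using iQ e01(2) q(2) that(1) by (metis inj_on_eq_iff)
    moreover have "(eS \<circ> t)(p := eS s'') = eS \<circ> t(p := s'')" by auto
    ultimately have "tm_step M (eQ q, eS \<circ> t, p) = (eQ q', eS \<circ> t', p')"
      using d r halt[of "t p"] that(1) tp iQ iS
      by (auto simp: tm_step_def M_def the_inv_into_f_f)
    then show ?thesis using cl[OF that(1) tp d] r that(2) by auto
  qed
  have steps: "(tm_step M ^^ n) (eQ q, eS \<circ> t, p) = (eQ q', eS \<circ> t', p') \<and> q' \<in> Q \<and> range t' \<subseteq> S"
    if "q \<in> Q" "range t \<subseteq> S" "(astep \<delta> ^^ n) (q, t, p) = (q', t', p')" for q t p q' t' p' n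
    using that(3)
  proof (induction n arbitrary: q' t' p')
    case 0
    then show ?case using that by simp
  next
    case (Suc n)
    obtain q2 t2 p2 where 2: "(astep \<delta> ^^ n) (q, t, p) = (q2, t2, p2)" by (metis prod_cases3)
    then have "astep \<delta> (q2, t2, p2) = (q', t', p')" using Suc.prems by simp
    then show ?case using Suc.IH[OF 2] step[of q2 t2 p2] by (simp del: astep.simps add: comp_def)
  qed
  show ?thesis using \<open>wf_tm M\<close> e01 eS(2) steps by metis
qed

subsection \<open>Simulating the stacks on one tape\<close>

text \<open>The tape is divided into tracks, one per stack, with the bottoms of the stacks in cell 0
  and the end marker \<^term>\<open>None\<close> in cell -1. One step of the stack program is one sweep of
  the head, from the marker to the top of the stack concerned and back.\<close>

type_synonym cell = "(nat \<Rightarrow> nat) option"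

datatype phase = Scan | Top | Ret
datatype ctrl = Start | Mark | Halt | Run "com list" phase

text \<open>\<open>Scan\<close> runs right to the first free cell of track \<open>idx c\<close> and
  writes \<open>pushed c\<close>; \<open>Top\<close> inspects the cell to its left, whose entry
  decides the branch and is erased by a pop; \<open>Ret\<close> runs back to the marker. On an empty
  stack \<open>Top\<close> meets the marker and reads 0. When nothing is left to do, the head steps
  from the marker onto cell 0, where the output begins.\<close>

fun sweep :: "com \<Rightarrow> ctrl \<Rightarrow> cell \<Rightarrow> ctrl \<times> cell \<times> int" where
  "sweep c0 Start s = (Mark, s, -1)"
| "sweep c0 Mark s = (Run [c0] Scan, None, 0)"
| "sweep c0 Halt s = (Halt, s, 0)"
| "sweep c0 (Run [] Scan) s = (Halt, s, 1)"
| "sweep c0 (Run [] Top) s = (Halt, s, 1)"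
| "sweep c0 (Run (c # k) Scan) None = (Run (c # k) Scan, None, 1)"
| "sweep c0 (Run (c # k) Scan) (Some g) = (if g (idx c) \<noteq> 0 then (Run (c # k) Scan, Some g, 1)
     else (Run (c # k) Top, Some (g(idx c := pushed c)), -1))"
| "sweep c0 (Run (c # k) Top) None = (Run (nxt c k 0) Ret, None, 0)"
| "sweep c0 (Run (c # k) Top) (Some g) = (Run (nxt c k (g (idx c))) Ret,
     Some (if is_pop c then g(idx c := 0) else g), 0)"
| "sweep c0 (Run cs Ret) None = (Run cs Scan, None, 0)"
| "sweep c0 (Run cs Ret) (Some g) = (Run cs Ret, Some g, -1)"

definition tape :: "store \<Rightarrow> int \<Rightarrow> cell" where
  "tape mem p = (if p = -1 then None
     else Some (\<lambda>i. if 0 \<le> p \<and> nat p < length (mem i) then rev (mem i) ! nat p else 0))"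

text \<open>A scan takes the first 0 on a track for the end of the stack, so entries must be
  nonzero; the bounds on entries and stack numbers keep the set of cell contents finite.\<close>

definition valid_store :: "nat \<Rightarrow> store \<Rightarrow> bool" where
  "valid_store R mem \<longleftrightarrow> (\<forall>i. (\<forall>x\<in>set (mem i). 0 < x \<and> x < 5) \<and> (R \<le> i \<longrightarrow> mem i = []))"

lemma valid_store_upd: "valid_store R mem \<Longrightarrow> well_formed R c \<Longrightarrow> valid_store R (upd c mem)"
proof -
  have tl: "set (tl xs) \<subseteq> set xs" for xs :: "nat list" by (cases xs) auto
  show "valid_store R mem \<Longrightarrow> well_formed R c \<Longrightarrow> valid_store R (upd c mem)"
    by (cases c) (auto simp: valid_store_def dest: subsetD[OF tl])
qed

lemma valid_store_nth:
  "valid_store R mem \<Longrightarrow> j < length (mem i) \<Longrightarrow> 0 < rev (mem i) ! j \<and> rev (mem i) ! j < 5"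
  unfolding valid_store_def by (metis length_rev nth_mem set_rev)

lemma funpow_chain: "(f ^^ m) x = y \<Longrightarrow> (f ^^ n) y = z \<Longrightarrow> (f ^^ (n + m)) x = z"
  by (simp add: funpow_add)

lemma sweep_scan:
  assumes "valid_store R mem" "m \<le> length (mem (idx c)) + 1"
  shows "(astep (sweep c0) ^^ m) (Run (c # k) Scan, tape mem, -1) = (Run (c # k) Scan, tape mem, int m - 1)"
  using assms(2)
proof (induction m)
  case (Suc m)
  show ?case
  proof (cases m)
    case (Suc j)
    then have "rev (mem (idx c)) ! j \<noteq> 0"
      using valid_store_nth[OF assms(1), of j "idx c"] Suc.prems by simp
    then show ?thesis using Suc.IH Suc.prems Suc by (simp add: tape_def fun_eq_iff)
  qed (use Suc in \<open>simp add: tape_def fun_eq_iff\<close>)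
qed simp

lemma sweep_ret:
  assumes "m \<le> h"
  shows "(astep (sweep c0) ^^ m) (Run cs Ret, tape mem, int h - 1) = (Run cs Ret, tape mem, int h - 1 - int m)"
  using assms by (induction m) (auto simp: tape_def fun_eq_iff)

lemma sweep_turn:
  assumes "valid_store R mem" "h = length (mem (idx c))"
  shows "(astep (sweep c0) ^^ 2) (Run (c # k) Scan, tape mem, int h)
    = (Run (nxt c k (peek (mem (idx c)))) Ret, tape (upd c mem), int h - 1)"
proof -
  \<comment> \<open>The tape after the first of the two moves: a push has placed its symbol, any
    other command has rewritten the blank.\<close>
  define t where "t = (tape mem)(int h := Some ((the (tape mem (int h)))(idx c := pushed c)))"
  have "astep (sweep c0) (Run (c # k) Scan, tape mem, int h) = (Run (c # k) Top, t, int h - 1)"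
    using assms by (simp add: tape_def t_def)
  moreover have "astep (sweep c0) (Run (c # k) Top, t, int h - 1)
    = (Run (nxt c k (peek (mem (idx c)))) Ret, tape (upd c mem), int h - 1)"
  proof (cases "mem (idx c)")
    case Nil
    then have "t = tape (upd c mem)"
      using assms(2) by (cases c) (auto simp: t_def tape_def fun_eq_iff)
    then show ?thesis using Nil assms(2) by (simp add: tape_def fun_eq_iff)
  next
    case (Cons x xs)
    then have h: "h = Suc (length xs)" using assms(2) by simp
    define g where "g = (\<lambda>i. if length xs < length (mem i) then rev (mem i) ! length xs else 0)"
    have g: "tape mem (int h - 1) = Some g" by (auto simp: tape_def h g_def)
    have m: "t (int h - 1) = Some g" by (simp add: t_def g)
    have x: "g (idx c) = x" using Cons by (simp add: g_def nth_append)
    have "t(int h - 1 := Some (if is_pop c then g(idx c := 0) else g)) = tape (upd c mem)"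
      using Cons h
      by (cases c) (auto simp: t_def g_def tape_def fun_eq_iff is_pop_def nth_append)
    then show ?thesis using Cons m x by simp
  qed
  ultimately show ?thesis by (simp add: numeral_2_eq_2)
qed

text \<open>The cost is \<open>h + 1\<close> moves to the free cell, 2 around the top,
  \<open>h\<close> back to the marker and 1 to switch to the next scan.\<close>

lemma sweep_step:
  assumes "valid_store R mem" "h = length (mem (idx c))" "sstep (c # k, mem) = (cs', mem')"
  shows "(astep (sweep c0) ^^ (2 * h + 4)) (Run (c # k) Scan, tape mem, -1) = (Run cs' Scan, tape mem', -1)"
proof -
  have 1: "(astep (sweep c0) ^^ (h + 1)) (Run (c # k) Scan, tape mem, -1) = (Run (c # k) Scan, tape mem, int h)"
    using sweep_scan[OF assms(1), of "h + 1" c c0 k] assms(2) by simp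
  have 2: "(astep (sweep c0) ^^ h) (Run cs' Ret, tape mem', int h - 1) = (Run cs' Ret, tape mem', -1)"
    using sweep_ret[of h h c0 cs' mem'] by simp
  have 3: "(astep (sweep c0) ^^ 1) (Run cs' Ret, tape mem', -1) = (Run cs' Scan, tape mem', -1)"
    by (simp add: tape_def fun_eq_iff)
  have 4: "(astep (sweep c0) ^^ 2) (Run (c # k) Scan, tape mem, int h) = (Run cs' Ret, tape mem', int h - 1)"
    using sweep_turn[OF assms(1,2), of c0 k] assms(3) by simp
  have "1 + (h + (2 + (h + 1))) = 2 * h + 4" by simp
  then show ?thesis
    using funpow_chain[OF funpow_chain[OF funpow_chain[OF 1 4] 2] 3] by metis
qed

text \<open>A step raises a stack by at most one, so within \<open>t\<close> steps all heights stay
  below \<open>L + t\<close> and each sweep costs at most \<open>2 * (L + t) + 4\<close>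
  moves.\<close>

lemma sweep_steps:
  assumes "valid_store R mem" "\<And>i. length (mem i) \<le> L" "well_formed R c0"
    "cs \<in> insert [] (conts c0 [])" "(sstep ^^ t) (cs, mem) = (cs', mem')"
  shows "cs' \<in> insert [] (conts c0 []) \<and> valid_store R mem' \<and> (\<forall>i. length (mem' i) \<le> L + t) \<and>
    (\<exists>n \<le> t * (2 * (L + t) + 4).
      (astep (sweep c0) ^^ n) (Run cs Scan, tape mem, -1) = (Run cs' Scan, tape mem', -1))"
  using assms(5)
proof (induction t arbitrary: cs' mem')
  case 0
  then show ?case using assms by auto
next
  case (Suc t)
  obtain cs2 mem2 where 2: "(sstep ^^ t) (cs, mem) = (cs2, mem2)" by (metis surj_pair)
  then have s: "sstep (cs2, mem2) = (cs', mem')" using Suc.prems by simp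
  note IH = Suc.IH[OF 2]
  then obtain n where n: "n \<le> t * (2 * (L + t) + 4)"
    "(astep (sweep c0) ^^ n) (Run cs Scan, tape mem, -1) = (Run cs2 Scan, tape mem2, -1)" by blast
  show ?case
  proof (cases cs2)
    case Nil
    moreover have "n \<le> Suc t * (2 * (L + Suc t) + 4)" using n(1) by (simp add: algebra_simps)
    ultimately show ?thesis using IH s n by (auto intro: le_SucI)
  next
    case (Cons c k)
    then have ck: "c # k \<in> conts c0 []" using IH by auto
    then have wf: "well_formed R c" using conts_well_formed assms(3) by blast
    have r: "cs' = nxt c k (peek (mem2 (idx c)))" "mem' = upd c mem2" using s Cons by auto
    have "length (mem' i) \<le> Suc (length (mem2 i))" for i
      unfolding r by (cases c) auto
    then have "length (mem' i) \<le> L + Suc t" for i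
      using IH by (metis add_Suc_right le_trans Suc_le_mono)
    moreover have "(astep (sweep c0) ^^ ((2 * length (mem2 (idx c)) + 4) + n)) (Run cs Scan, tape mem, -1)
        = (Run cs' Scan, tape mem', -1)"
      using funpow_chain[OF n(2)] sweep_step[of R mem2 _ c k] IH s Cons by blast
    moreover have "(2 * length (mem2 (idx c)) + 4) + n \<le> Suc t * (2 * (L + Suc t) + 4)"
    proof -
      have "length (mem2 (idx c)) \<le> L + t" using IH by blast
      then have "2 * length (mem2 (idx c)) + 4 \<le> 2 * (L + Suc t) + 4" by simp
      moreover have "t * (2 * (L + t) + 4) \<le> t * (2 * (L + Suc t) + 4)" by simp
      ultimately show ?thesis using n(1) unfolding mult_Suc by (meson add_mono le_trans)
    qed
    ultimately show ?thesis
      using nxt_in_conts[OF ck] valid_store_upd[OF _ wf] IH r by blast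
  qed
qed

text \<open>The step count is chosen before the rest \<open>k\<close> of the program, so a run is
  independent of what follows it and runs can be composed.\<close>

definition runs :: "com \<Rightarrow> store \<Rightarrow> nat \<Rightarrow> store \<Rightarrow> bool" where
  "runs c mem b mem' \<longleftrightarrow> (\<exists>t\<le>b. \<forall>k. (sstep ^^ t) (c # k, mem) = (k, mem'))"

text \<open>With its bottom in cell 0, a stack holding \<open>rev w\<close> reads as
  \<open>w\<close> from left to right; the plain input tape thus is already the initial store,
  except for the marker, and likewise for the output. Of the 3 extra moves two set the marker and
  one returns the head to cell 0.\<close>

theorem stack_program_to_tm:
  assumes wf: "well_formed R c0"
    and runs: "\<And>w. w \<in> lists {1, 2, 3, 4} \<Longrightarrow>
      runs c0 (\<lambda>i. if i = 0 then rev w else []) (b (length w)) (\<lambda>i. if i = 0 then rev (f w) else [])"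
  shows "\<exists>M. wf_tm M \<and> (\<forall>w \<in> lists {1, 2, 3, 4}.
    \<exists>k \<le> b (length w) * (2 * (length w + b (length w)) + 4) + 3.
      fst ((tm_step M ^^ k) (tm_init w)) = 1 \<and> tm_output ((tm_step M ^^ k) (tm_init w)) = f w)"
proof -
  define Q where "Q = {Start, Mark, Halt} \<union> (\<lambda>(cs, ph). Run cs ph) ` (insert [] (conts c0 []) \<times> {Scan, Top, Ret})"
  define G :: "(nat \<Rightarrow> nat) set" where
    "G = {g. \<forall>i. (i \<in> {..<R} \<longrightarrow> g i \<in> {..<5}) \<and> (i \<notin> {..<R} \<longrightarrow> g i = 0)}"
  define S :: "cell set" where "S = insert None (Some ` G)"
  \<comment> \<open>A plain symbol is identified with the cell that carries it on track 0 and blanks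
    on all others.\<close>
  let ?b = "\<lambda>s. Some (\<lambda>i. if i = 0 then s else 0) :: cell"
  have R0: "0 < R" using wf by (cases c0) auto
  have finQ: "finite Q" unfolding Q_def by (intro finite_UnI finite_imageI finite_cartesian_product) (auto simp: finite_conts)
  have finS: "finite S" unfolding S_def G_def
    by (intro finite.insertI finite_imageI finite_set_of_finite_funs) auto
  have Q01: "Start \<in> Q" "Halt \<in> Q" "Start \<noteq> Halt" by (auto simp: Q_def)
  have inj: "inj_on ?b {..<5}" by (auto simp: inj_on_def fun_eq_iff split: if_splits)
  have bS: "?b ` {..<5} \<subseteq> S" using R0 by (auto simp: S_def G_def)
  have cl: "q' \<in> Q \<and> s' \<in> S \<and> d \<in> {-1, 0, 1}"
    if "q \<in> Q" "s \<in> S" "sweep c0 q s = (q', s', d)" for q s q' s' d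
  proof -
    have c: "Run cs ph \<in> Q \<longleftrightarrow> cs \<in> insert [] (conts c0 [])" for cs ph
      by (cases ph) (auto simp: Q_def)
    have g: "Some (g(idx c := pushed c)) \<in> S" "Some (g(idx c := 0)) \<in> S"
      if "c # k \<in> conts c0 []" "Some g \<in> S" for c k g
      using that well_formed_idx[OF conts_well_formed[OF that(1) wf]] by (auto simp: S_def G_def)
    have N: "None \<in> S" "Halt \<in> Q" "Mark \<in> Q" by (auto simp: S_def Q_def)
    show ?thesis
      using that
      by (cases "(c0, q, s)" rule: sweep.cases)
        (auto simp: c N self_in_conts g split: if_splits dest: nxt_in_conts)
  qed
  have hlt: "sweep c0 Halt s = (Halt, s, 0)" for s by simp
  have "\<exists>M eQ eS. wf_tm M \<and> eQ Start = 0 \<and> eQ Halt = 1 \<and> (\<forall>i<5. eS (?b i) = i) \<and>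
    (\<forall>q t p q' t' p' n. q \<in> Q \<longrightarrow> range t \<subseteq> S \<longrightarrow> (astep (sweep c0) ^^ n) (q, t, p) = (q', t', p') \<longrightarrow>
       (tm_step M ^^ n) (eQ q, eS \<circ> t, p) = (eQ q', eS \<circ> t', p'))"
    by (rule tm_of_finite_machine[OF finQ finS Q01 inj bS]) (erule (2) cl, rule hlt)
  then obtain M eQ eS where M: "wf_tm M" "eQ Start = 0" "eQ Halt = 1" "\<And>i. i < 5 \<Longrightarrow> eS (?b i) = i"
    and sim: "\<forall>q t p q' t' p' n. q \<in> Q \<longrightarrow> range t \<subseteq> S \<longrightarrow>
       (astep (sweep c0) ^^ n) (q, t, p) = (q', t', p') \<longrightarrow>
       (tm_step M ^^ n) (eQ q, eS \<circ> t, p) = (eQ q', eS \<circ> t', p')" by blast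
  have "\<exists>k \<le> b (length w) * (2 * (length w + b (length w)) + 4) + 3.
      fst ((tm_step M ^^ k) (tm_init w)) = 1 \<and> tm_output ((tm_step M ^^ k) (tm_init w)) = f w"
    if w: "w \<in> lists {1, 2, 3, 4}" for w
  proof -
    define mem :: store where "mem = (\<lambda>i. if i = 0 then rev w else [])"
    define mem' :: store where "mem' = (\<lambda>i. if i = 0 then rev (f w) else [])"
    let ?sym = "\<lambda>p. if 0 \<le> p \<and> nat p < length w then w ! nat p else 0"
    let ?B = "b (length w)" and ?L = "length w"
    have sym: "?sym p < 5" for p
    proof -
      have "w ! i \<in> {1, 2, 3, 4}" if "i < length w" for i
        using w that by (meson in_listsD nth_mem)
      then show ?thesis by (fastforce split: if_splits)
    qed
    have init: "tm_init w = (eQ Start, eS \<circ> (\<lambda>p. ?b (?sym p)), 0)"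
      using M(2) M(4)[OF sym] by (auto simp: tm_init_def fun_eq_iff)
    have "range (\<lambda>p. ?b (?sym p)) \<subseteq> S" using sym bS by blast
    note sim = sim[rule_format, OF Q01(1) this]
    have v: "valid_store R mem" using w R0 by (auto simp: valid_store_def mem_def in_lists_conv_set)
    have len: "length (mem i) \<le> ?L" for i by (simp add: mem_def)
    obtain t where t: "t \<le> ?B" "(sstep ^^ t) ([c0], mem) = ([], mem')"
      using runs[OF w] unfolding runs_def mem_def mem'_def by blast
    from sweep_steps[OF v len wf _ t(2)] self_in_conts[of c0 "[]"]
    obtain n where v': "valid_store R mem'" and n: "n \<le> t * (2 * (?L + t) + 4)"
      "(astep (sweep c0) ^^ n) (Run [c0] Scan, tape mem, -1) = (Run [] Scan, tape mem', -1)" by blast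
    have mark: "(\<lambda>p. ?b (?sym p))(-1 := None) = tape mem"
      by (auto simp: tape_def mem_def fun_eq_iff)
    have 1: "(astep (sweep c0) ^^ 2) (Start, (\<lambda>p. ?b (?sym p)), 0) = (Run [c0] Scan, tape mem, -1)"
    proof -
      have "(astep (sweep c0) ^^ 2) (Start, t, 0) = (Run [c0] Scan, t(-1 := None), -1)" for t
        by (simp add: numeral_2_eq_2)
      then show ?thesis unfolding mark[symmetric] .
    qed
    have 3: "(astep (sweep c0) ^^ 1) (Run [] Scan, tape mem', -1) = (Halt, tape mem', 0)" by simp
    have fin: "(tm_step M ^^ (1 + (n + 2))) (tm_init w) = (1, eS \<circ> tape mem', 0)"
      unfolding init
      using sim[OF funpow_chain[OF funpow_chain[OF 1 n(2)] 3]] M(3) by simp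
    have cell: "(eS \<circ> tape mem') (0 + int k) = (if k < length (f w) then f w ! k else 0)" for k
    proof -
      have "tape mem' (int k) = ?b (if k < length (f w) then f w ! k else 0)"
        by (auto simp: tape_def mem'_def fun_eq_iff)
      moreover have "(if k < length (f w) then f w ! k else 0) < 5"
        using valid_store_nth[OF v', of k 0] by (simp add: mem'_def)
      ultimately show ?thesis using M(4) by simp
    qed
    have nz: "f w ! k \<noteq> 0" if "k < length (f w)" for k
      using valid_store_nth[OF v', of k 0] that by (simp add: mem'_def)
    have "(LEAST k::nat. (if k < length (f w) then f w ! k else 0) = 0) = length (f w)"
      using nz by (intro Least_equality) (auto simp: not_less split: if_splits dest: nz)
    then have "tm_output (1, eS \<circ> tape mem', 0) = f w"
      unfolding tm_output_def prod.case cell by (intro nth_equalityI) auto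
    moreover have "1 + (n + 2) \<le> ?B * (2 * (?L + ?B) + 4) + 3"
    proof -
      have "t * (2 * (?L + t) + 4) \<le> ?B * (2 * (?L + ?B) + 4)" using t(1) by (intro mult_mono) auto
      then show ?thesis using n(1) by linarith
    qed
    ultimately show ?thesis using fin by (metis fst_conv)
  qed
  then show ?thesis using M(1) by blast
qed

section \<open>Stack programs\<close>

lemma runs_weaken: "runs c mem b mem' \<Longrightarrow> b \<le> b' \<Longrightarrow> mem' = \<tau> \<Longrightarrow> runs c mem b' \<tau>"
  by (auto simp: runs_def intro: order.trans)

lemma runs_Skip: "runs Skip mem 1 mem"
  unfolding runs_def by (rule exI[of _ 1]) simp

lemma runs_Push: "runs (Push i x) mem 1 (mem(i := x # mem i))"
  unfolding runs_def by (rule exI[of _ 1]) simp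

lemma runs_Pop: "runs (Pop i) mem 1 (mem(i := tl (mem i)))"
  unfolding runs_def by (rule exI[of _ 1]) simp

lemma runs_Seq:
  assumes "runs a mem m mem1" "runs b mem1 n mem2"
  shows "runs (Seq a b) mem (m + n + 1) mem2"
proof -
  obtain s t where s: "s \<le> m" "\<And>k. (sstep ^^ s) (a # k, mem) = (k, mem1)"
    and t: "t \<le> n" "\<And>k. (sstep ^^ t) (b # k, mem1) = (k, mem2)" using assms unfolding runs_def by blast
  have "(sstep ^^ (t + (s + 1))) (Seq a b # k, mem) = (k, mem2)" for k
    by (rule funpow_chain[OF funpow_chain[OF _ s(2)] t(2)]) simp
  moreover have "t + (s + 1) \<le> m + n + 1" using s t by simp
  ultimately show ?thesis unfolding runs_def by blast
qed

lemma runs_Cond: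
  assumes "runs (if peek (mem i) \<in> S then a else b) mem n mem'"
  shows "runs (Cond i S a b) mem (n + 1) mem'"
proof -
  let ?c = "if peek (mem i) \<in> S then a else b"
  obtain t where t: "t \<le> n" "\<And>k. (sstep ^^ t) (?c # k, mem) = (k, mem')"
    using assms unfolding runs_def by blast
  have "(sstep ^^ (t + 1)) (Cond i S a b # k, mem) = (k, mem')" for k
    by (rule funpow_chain[OF _ t(2)]) simp
  then show ?thesis unfolding runs_def using t(1) by (metis add_le_mono1)
qed

lemma runs_Loop_exit: "peek (mem i) \<notin> S \<Longrightarrow> runs (Loop i S a) mem 1 mem"
  unfolding runs_def by (rule exI[of _ 1]) simp

lemma runs_Loop_step:
  assumes "peek (mem i) \<in> S" "runs a mem m mem1" "runs (Loop i S a) mem1 n mem2"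
  shows "runs (Loop i S a) mem (m + n + 1) mem2"
proof -
  obtain s t where s: "s \<le> m" "\<And>k. (sstep ^^ s) (a # k, mem) = (k, mem1)"
    and t: "t \<le> n" "\<And>k. (sstep ^^ t) (Loop i S a # k, mem1) = (k, mem2)"
    using assms unfolding runs_def by blast
  have "(sstep ^^ (t + (s + 1))) (Loop i S a # k, mem) = (k, mem2)" for k
    by (rule funpow_chain[OF funpow_chain[OF _ s(2)] t(2)]) (simp add: assms(1))
  moreover have "t + (s + 1) \<le> m + n + 1" using s t by simp
  ultimately show ?thesis unfolding runs_def by blast
qed

text \<open>The invariant is given as the sequence of stores \<open>s 0\<close>, ...,
  \<open>s n\<close> before and after the rounds, so later proofs only name the store after
  \<open>j\<close> rounds.\<close>

lemma runs_Loop: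
  assumes "\<And>j. j < n \<Longrightarrow> peek (s j i) \<in> S" "\<And>j. j < n \<Longrightarrow> runs a (s j) b (s (Suc j))"
    and "peek (s n i) \<notin> S"
  shows "runs (Loop i S a) (s 0) (n * (b + 1) + 1) (s n)"
proof -
  have "runs (Loop i S a) (s (n - j)) (j * (b + 1) + 1) (s n)" if "j \<le> n" for j
    using that
  proof (induction j)
    case 0
    then show ?case using runs_Loop_exit[of "s n" i S a] assms(3) by simp
  next
    case (Suc j)
    have "Suc (n - Suc j) = n - j" using Suc.prems by simp
    moreover have "runs (Loop i S a) (s (n - j)) (j * (b + 1) + 1) (s n)" using Suc by simp
    ultimately have "runs (Loop i S a) (s (n - Suc j)) (b + (j * (b + 1) + 1) + 1) (s n)"
      using Suc.prems assms(1,2)[of "n - Suc j"] by (intro runs_Loop_step) auto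
    then show ?case by (rule runs_weaken) auto
  qed
  from this[of n] show ?thesis by simp
qed

text \<open>Controls stores of which little else is known, such as those after a failed parse: valid
  entries and bounded heights suffice for clearing them.\<close>

lemma runs_valid_store:
  assumes "valid_store R mem" "\<And>i. length (mem i) \<le> L" "well_formed R c" "runs c mem b mem'"
  shows "valid_store R mem' \<and> (\<forall>i. length (mem' i) \<le> L + b)"
proof -
  obtain t where "t \<le> b" "(sstep ^^ t) ([c], mem) = ([], mem')"
    using assms(4) unfolding runs_def by blast
  then show ?thesis
    using sweep_steps[OF assms(1-3), of "[c]" t "[]" mem'] self_in_conts[of c "[]"]
    by (meson add_left_mono insertCI le_trans)
qed

subsection \<open>Moving symbols between stacks\<close>

primrec pushes :: "(nat \<times> nat) list \<Rightarrow> com" where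
  "pushes [] = Skip"
| "pushes (p # ps) = Seq (Push (fst p) (snd p)) (pushes ps)"

definition shift_sym :: "nat \<Rightarrow> (nat \<times> (nat \<Rightarrow> nat)) list \<Rightarrow> nat \<Rightarrow> com" where
  "shift_sym X outs x = Seq (Pop X) (pushes (map (\<lambda>(Y, f). (Y, f x)) outs))"

text \<open>The control has no variables, so copying the top symbol is a case distinction over the
  four symbols. Each target in \<open>outs\<close> comes with its own recoding of the
  symbol.\<close>

definition shift :: "nat \<Rightarrow> (nat \<times> (nat \<Rightarrow> nat)) list \<Rightarrow> com" where
  "shift X outs = Cond X {1} (shift_sym X outs 1) (Cond X {2} (shift_sym X outs 2)
     (Cond X {3} (shift_sym X outs 3) (shift_sym X outs 4)))"

definition move :: "nat \<Rightarrow> nat set \<Rightarrow> (nat \<times> (nat \<Rightarrow> nat)) list \<Rightarrow> com" where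
  "move X S outs = Loop X S (shift X outs)"

definition moved :: "nat \<Rightarrow> (nat \<times> (nat \<Rightarrow> nat)) list \<Rightarrow> nat list \<Rightarrow> nat list \<Rightarrow> store \<Rightarrow> store" where
  "moved X outs xs ys mem = (\<lambda>i. if i = X then ys else case map_of outs i of
     Some f \<Rightarrow> rev (map f xs) @ mem i | None \<Rightarrow> mem i)"

lemmas moved_simps = moved_def fun_eq_iff map_replicate_const

lemma runs_pushes:
  "distinct (map fst ps) \<Longrightarrow> runs (pushes ps) mem (2 * length ps + 1)
     (\<lambda>i. case map_of ps i of Some x \<Rightarrow> x # mem i | None \<Rightarrow> mem i)"
proof (induction ps arbitrary: mem)
  case (Cons p ps)
  let ?s = "mem(fst p := snd p # mem (fst p))"
  have n: "map_of ps (fst p) = None" using Cons.prems by (simp add: map_of_eq_None_iff)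
  show ?case unfolding pushes.simps
    by (rule runs_weaken[OF runs_Seq[OF runs_Push Cons.IH]])
      (use Cons.prems n in \<open>auto simp: fun_eq_iff split: option.split\<close>)
qed (simp add: runs_weaken[OF runs_Skip])

lemma runs_shift_sym:
  assumes "mem X = x # xs" "distinct (map fst outs)" "X \<notin> fst ` set outs"
  shows "runs (shift_sym X outs x) mem (2 * length outs + 3) (moved X outs [x] xs mem)"
proof -
  have 1: "map_of (map (\<lambda>(Y, f). (Y, f x)) outs) i = map_option (\<lambda>f. f x) (map_of outs i)" for i
    by (simp add: map_of_map comp_def)
  have 2: "map_of outs X = None" using assms(3) by (simp add: map_of_eq_None_iff)
  have 3: "fst \<circ> (\<lambda>(Y, f). (Y, f x)) = fst" by auto
  show ?thesis unfolding shift_sym_def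
    by (rule runs_weaken[OF runs_Seq[OF runs_Pop runs_pushes]])
      (use assms 2 in \<open>auto simp: 3 1 moved_def fun_eq_iff split: option.split\<close>)
qed

lemma runs_shift:
  assumes "mem X = x # xs" "x \<in> {1, 2, 3, 4}" "distinct (map fst outs)" "X \<notin> fst ` set outs"
  shows "runs (shift X outs) mem (2 * length outs + 6) (moved X outs [x] xs mem)"
proof -
  note r = runs_shift_sym[of mem X x xs, OF assms(1,3,4)]
  consider "x = 1" | "x = 2" | "x = 3" | "x = 4" using assms(2) by blast
  then show ?thesis
  proof cases
    case 1
    show ?thesis unfolding shift_def
      by (rule runs_weaken[OF runs_Cond[of mem X "{1}" _ _ "2 * length outs + 3"]])
        (use assms 1 r in auto)
  next
    case 2
    show ?thesis unfolding shift_def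
      by (rule runs_weaken[OF runs_Cond[of mem X "{1}" _ _ "2 * length outs + 4"]])
        (use assms 2 r in \<open>auto intro!: runs_weaken[OF runs_Cond[of mem X "{2}" _ _ "2 * length outs + 3"]]\<close>)
  next
    case 3
    show ?thesis unfolding shift_def
      by (rule runs_weaken[OF runs_Cond[of mem X "{1}" _ _ "2 * length outs + 5"]])
        (use assms 3 r in \<open>auto intro!: runs_weaken[OF runs_Cond[of mem X "{2}" _ _ "2 * length outs + 4"]]
          runs_weaken[OF runs_Cond[of mem X "{3}" _ _ "2 * length outs + 3"]]\<close>)
  next
    case 4
    show ?thesis unfolding shift_def
      by (rule runs_weaken[OF runs_Cond[of mem X "{1}" _ _ "2 * length outs + 5"]])
        (use assms 4 r in \<open>auto intro!: runs_weaken[OF runs_Cond[of mem X "{2}" _ _ "2 * length outs + 4"]]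
          runs_weaken[OF runs_Cond[of mem X "{3}" _ _ "2 * length outs + 3"]]\<close>)
  qed
qed

lemma runs_move:
  assumes "mem X = xs @ ys" "set xs \<subseteq> S \<inter> {1, 2, 3, 4}" "peek ys \<notin> S"
    "distinct (map fst outs)" "X \<notin> fst ` set outs"
  shows "runs (move X S outs) mem (length xs * (2 * length outs + 7) + 1) (moved X outs xs ys mem)"
  using assms(1,2)
proof (induction xs arbitrary: mem)
  case Nil
  then have "moved X outs [] ys mem = mem" by (auto simp: moved_def fun_eq_iff split: option.split)
  then show ?case using runs_Loop_exit[of mem X S] assms(3) Nil by (simp add: move_def)
next
  case (Cons x xs)
  have n: "map_of outs X = None" using assms(5) by (simp add: map_of_eq_None_iff)
  let ?s = "moved X outs [x] (xs @ ys) mem"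
  have "?s X = xs @ ys" by (simp add: moved_def)
  with Cons have IH: "runs (Loop X S (shift X outs)) ?s (length xs * (2 * length outs + 7) + 1) (moved X outs xs ys ?s)"
    unfolding move_def by simp
  have "runs (shift X outs) mem (2 * length outs + 6) ?s"
    using Cons.prems assms(4,5) by (intro runs_shift) auto
  from runs_Loop_step[OF _ this IH] show ?case unfolding move_def
    by (rule runs_weaken) (use Cons.prems n in \<open>auto simp: moved_def fun_eq_iff split: option.split\<close>)
qed

lemma runs_Seq_Pop: "runs b (mem(i := tl (mem i))) n mem2 \<Longrightarrow> runs (Seq (Pop i) b) mem (n + 2) mem2"
  by (rule runs_weaken[OF runs_Seq[OF runs_Pop]]) auto

lemma runs_Seq_Push: "runs b (mem(i := x # mem i)) n mem2 \<Longrightarrow> runs (Seq (Push i x) b) mem (n + 2) mem2"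
  by (rule runs_weaken[OF runs_Seq[OF runs_Push]]) auto

lemma runs_moveI:
  assumes "mem X = xs @ ys" "set xs \<subseteq> S \<inter> {1, 2, 3, 4}" "peek ys \<notin> S"
    "distinct (map fst outs)" "X \<notin> fst ` set outs"
    "moved X outs xs ys mem = \<tau>" "length xs * (2 * length outs + 7) + 1 \<le> B"
  shows "runs (move X S outs) mem B \<tau>"
  using runs_weaken[OF runs_move[of mem X xs ys S outs, OF assms(1-5)] assms(7,6)] .

lemma runs_shiftI:
  assumes "mem X = x # xs" "x \<in> {1, 2, 3, 4}" "distinct (map fst outs)" "X \<notin> fst ` set outs"
    "moved X outs [x] xs mem = \<tau>" "2 * length outs + 6 \<le> B"
  shows "runs (shift X outs) mem B \<tau>"
  using runs_weaken[OF runs_shift[of mem X x xs outs, OF assms(1-4)] assms(6,5)] .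

lemma runs_LoopI:
  assumes "\<And>j. j < n \<Longrightarrow> peek (s j i) \<in> S" "\<And>j. j < n \<Longrightarrow> runs a (s j) b (s (Suc j))"
    and "peek (s n i) \<notin> S" "s 0 = mem" "s n = \<tau>" "n * (b + 1) + 1 \<le> B"
  shows "runs (Loop i S a) mem B \<tau>"
  using runs_weaken[OF runs_Loop[OF assms(1-3)] assms(6,5)] assms(4) by simp

text \<open>Stack 0 holds input and output, stack 1 a copy of the input. Stacks 2 and 3 hold the
  thermometer code of the copy number \<open>i < k\<close> as \<open>i\<close> digits 2 and \<open>k - i\<close> digits 1, 4 is scratch
  space, 5 and 6 hold the current (padded) vertex or arc, 7 is the failure flag, 8 and 9 hold the
  bound in binary and unary, 10 and 11 count vertices and arcs, 12 and 13 hold the new bound in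
  unary and binary, 14 holds the vertex list and 15 to 18 hold copies of the arc list.\<close>

definition pad :: "nat \<Rightarrow> nat list \<Rightarrow> nat list" where
  "pad k w = w @ replicate (k - length w) 1"

text \<open>Stack 3 counts \<open>k\<close> rounds. Each round takes one digit of the word or, once
  the separator 3 is on top of \<open>S\<close>, supplies the digit 1, which is a leading zero.
  Afterwards the counter is restored and the separator dropped.\<close>

definition load :: "nat \<Rightarrow> nat \<Rightarrow> com" where
  "load S X = Seq (Loop 3 {1} (Seq (Pop 3) (Seq (Push 2 2)
     (Cond S {1, 2} (shift S [(X, id)]) (Push X 1)))))
     (Seq (move 2 {2} [(3, \<lambda>_. 1)]) (Pop S))"

lemma length_pad: "length w \<le> k \<Longrightarrow> length (pad k w) = k"
  by (simp add: pad_def)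

lemma set_pad: "set w \<subseteq> {1, 2} \<Longrightarrow> set (pad k w) \<subseteq> {1, 2}"
  by (auto simp: pad_def)

lemma replicate_diff: "j < k \<Longrightarrow> replicate (k - j) x = x # replicate (k - Suc j) x"
  by (metis Suc_diff_Suc replicate_Suc)

lemma runs_load:
  assumes S: "S \<in> {14, 15, 16, 17, 18}" and X: "X \<in> {5, 6}"
    and mem: "mem S = w @ 3 # r" "mem 3 = replicate k 1" "mem 2 = []" "mem X = []"
    and w: "set w \<subseteq> {1, 2}" "length w \<le> k"
  shows "runs (load S X) mem (30 * k + 30) (mem(S := r, X := rev (pad k w)))"
proof -
  define s where "s j = mem(3 := replicate (k - j) 1, 2 := replicate j 2, S := drop j w @ 3 # r,
      X := rev (take j (pad k w)))" for j
  have d: "S \<noteq> 3" "S \<noteq> 2" "X \<noteq> 3" "X \<noteq> 2" "S \<noteq> X" "X \<noteq> S" using S X by auto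
  have body: "runs (Seq (Pop 3) (Seq (Push 2 2) (Cond S {1, 2} (shift S [(X, id)]) (Push X 1))))
      (s j) 13 (s (Suc j))" if j: "j < k" for j
  proof -
    let ?t = "(s j)(3 := replicate (k - Suc j) 1, 2 := replicate (Suc j) 2)"
    have "runs (Cond S {1, 2} (shift S [(X, id)]) (Push X 1)) ?t 9 (s (Suc j))"
    proof (cases "j < length w")
      case True
      have m: "w ! j \<in> {1, 2}" using w True by (meson nth_mem subsetD)
      have "pad k w ! j = w ! j" using True by (simp add: pad_def nth_append)
      then have "take (Suc j) (pad k w) = take j (pad k w) @ [w ! j]"
        using j length_pad[OF w(2)] by (simp add: take_Suc_conv_app_nth)
      moreover have "?t S = w ! j # drop (Suc j) w @ 3 # r"
        using True d by (simp add: s_def Cons_nth_drop_Suc)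
      moreover from this have "runs (shift S [(X, id)]) ?t 8 (s (Suc j))"
        using m d True calculation by (intro runs_shiftI[where x = "w ! j"]) (auto simp: moved_def s_def fun_eq_iff)
      ultimately show ?thesis using m by (intro runs_weaken[OF runs_Cond[where n = 8]]) auto
    next
      case False
      then have "pad k w ! j = 1" using j by (simp add: pad_def nth_append)
      then have "take (Suc j) (pad k w) = take j (pad k w) @ [1]"
        using j length_pad[OF w(2)] by (simp add: take_Suc_conv_app_nth)
      then have "runs (Push X 1) ?t 1 (s (Suc j))"
        using False d by (intro runs_weaken[OF runs_Push]) (auto simp: s_def fun_eq_iff)
      moreover have "peek (?t S) = 3" using False d by (simp add: s_def)
      ultimately show ?thesis by (intro runs_weaken[OF runs_Cond[where n = 1]]) auto
    qed
    moreover have t: "?t = ((s j)(3 := tl (s j 3)))(2 := 2 # ((s j)(3 := tl (s j 3))) 2)"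
      using j d by (auto simp: s_def fun_eq_iff replicate_diff)
    ultimately show ?thesis
      unfolding t by (intro runs_weaken[OF runs_Seq_Pop[OF runs_Seq_Push[where n = 9]]]) auto
  qed
  have 1: "runs (Loop 3 {1} (Seq (Pop 3) (Seq (Push 2 2) (Cond S {1, 2} (shift S [(X, id)]) (Push X 1)))))
      mem (k * 14 + 1) (s k)"
    by (rule runs_LoopI[where s = s, OF _ body])
      (use d mem in \<open>auto simp: s_def fun_eq_iff replicate_diff\<close>)
  let ?t = "(s k)(2 := [], 3 := replicate k 1)"
  have 2: "runs (move 2 {2} [(3, \<lambda>_. 1)]) (s k) (k * 9 + 1) ?t"
    by (rule runs_moveI[where xs = "replicate k 2" and ys = "[]"])
      (use d in \<open>auto simp: moved_def s_def fun_eq_iff map_replicate_const\<close>)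
  show ?thesis unfolding load_def
    by (rule runs_weaken[OF runs_Seq[OF 1 runs_Seq[OF 2 runs_Pop]]])
      (use d mem w length_pad[OF w(2)] in \<open>auto simp: s_def fun_eq_iff\<close>)
qed

section \<open>Output templates, instantiated for every arc and copy number\<close>

datatype item = Lit nat | Word nat | Index

text \<open>Words and copy number are used again by later items, so they pass through scratch stack
  4 and are put back. A word is copied to the output on the way back, when it leaves stack 4 in
  reading order; the copy number consists of two constant blocks, whose direction does not
  matter.\<close>

fun emit :: "item \<Rightarrow> com" where
  "emit (Lit c) = Push 0 c"
| "emit (Word X) = Seq (move X {1, 2} [(4, id)]) (move 4 {1, 2} [(X, id), (0, id)])"
| "emit Index = Seq (move 2 {2} [(4, \<lambda>_. 2), (0, \<lambda>_. 2)]) (Seq (move 4 {2} [(2, \<lambda>_. 2)])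
     (Seq (move 3 {1} [(4, \<lambda>_. 1), (0, \<lambda>_. 1)]) (move 4 {1} [(3, \<lambda>_. 1)])))"

primrec emits :: "item list \<Rightarrow> com" where
  "emits [] = Skip"
| "emits (x # xs) = Seq (emit x) (emits xs)"

fun item_out :: "store \<Rightarrow> item \<Rightarrow> nat list" where
  "item_out mem (Lit c) = [c]"
| "item_out mem (Word X) = rev (mem X)"
| "item_out mem Index = mem 2 @ mem 3"

definition emit_ready :: "nat \<Rightarrow> store \<Rightarrow> bool" where
  "emit_ready k mem \<longleftrightarrow> mem 4 = [] \<and> (\<exists>a b. mem 2 = replicate a 2 \<and> mem 3 = replicate b 1 \<and> a + b \<le> k) \<and>
     (\<forall>X\<in>{5, 6}. set (mem X) \<subseteq> {1, 2} \<and> length (mem X) \<le> k)"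

lemma runs_emit:
  assumes "emit_ready k mem" "\<And>X. it = Word X \<Longrightarrow> X \<in> {5, 6}"
  shows "runs (emit it) mem (30 * k + 30) (mem(0 := rev (item_out mem it) @ mem 0))"
proof (cases it)
  case (Lit c)
  then show ?thesis by (auto intro: runs_weaken[OF runs_Push])
next
  case (Word X)
  have X: "X \<in> {5, 6}" using assms(2) Word by blast
  then have r: "set (mem X) \<subseteq> {1, 2}" "length (mem X) \<le> k" "mem 4 = []"
    using assms(1) unfolding emit_ready_def by blast+
  have d: "X \<noteq> 4" "X \<noteq> 0" using X by auto
  have 1: "runs (move X {1, 2} [(4, id)]) mem (k * 9 + 1) (mem(X := [], 4 := rev (mem X)))"
    by (rule runs_moveI[where xs = "mem X" and ys = "[]"]) (use r d in \<open>auto simp: moved_def fun_eq_iff\<close>)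
  have 2: "runs (move 4 {1, 2} [(X, id), (0, id)]) (mem(X := [], 4 := rev (mem X))) (k * 11 + 1)
     (mem(0 := mem X @ mem 0))"
    by (rule runs_moveI[where xs = "rev (mem X)" and ys = "[]"]) (use r d in \<open>auto simp: moved_def fun_eq_iff\<close>)
  show ?thesis unfolding Word emit.simps by (rule runs_weaken[OF runs_Seq[OF 1 2]]) auto
next
  case Index
  obtain a b where r: "mem 2 = replicate a 2" "mem 3 = replicate b 1" "a + b \<le> k" "mem 4 = []"
    using assms(1) unfolding emit_ready_def by blast
  let ?s1 = "mem(2 := [], 4 := replicate a 2, 0 := replicate a 2 @ mem 0)"
  let ?s2 = "mem(0 := replicate a 2 @ mem 0)"
  let ?s3 = "mem(3 := [], 4 := replicate b 1, 0 := replicate b 1 @ replicate a 2 @ mem 0)"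
  let ?s4 = "mem(0 := replicate b 1 @ replicate a 2 @ mem 0)"
  have 1: "runs (move 2 {2} [(4, \<lambda>_. 2), (0, \<lambda>_. 2)]) mem (a * 11 + 1) ?s1"
    by (rule runs_moveI[where xs = "replicate a 2" and ys = "[]"])
      (use r in \<open>auto simp: moved_simps\<close>)
  have 2: "runs (move 4 {2} [(2, \<lambda>_. 2)]) ?s1 (a * 9 + 1) ?s2"
    by (rule runs_moveI[where xs = "replicate a 2" and ys = "[]"])
      (use r in \<open>auto simp: moved_simps\<close>)
  have 3: "runs (move 3 {1} [(4, \<lambda>_. 1), (0, \<lambda>_. 1)]) ?s2 (b * 11 + 1) ?s3"
    by (rule runs_moveI[where xs = "replicate b 1" and ys = "[]"])
      (use r in \<open>auto simp: moved_simps\<close>)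
  have 4: "runs (move 4 {1} [(3, \<lambda>_. 1)]) ?s3 (b * 9 + 1) ?s4"
    by (rule runs_moveI[where xs = "replicate b 1" and ys = "[]"])
      (use r in \<open>auto simp: moved_simps\<close>)
  have "runs (emit it) mem (30 * k + 30) ?s4" unfolding Index emit.simps
    by (rule runs_weaken[OF runs_Seq[OF 1 runs_Seq[OF 2 runs_Seq[OF 3 4]]]]) (use r(3) in auto)
  then show ?thesis by (rule runs_weaken) (auto simp: Index r)
qed

lemma runs_emits:
  assumes "emit_ready k mem" "\<And>X. Word X \<in> set its \<Longrightarrow> X \<in> {5, 6}"
  shows "runs (emits its) mem (length its * (30 * k + 31) + 1)
    (mem(0 := rev (concat (map (item_out mem) its)) @ mem 0))"
  using assms
proof (induction its arbitrary: mem)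
  case Nil
  then show ?case by (simp add: runs_weaken[OF runs_Skip])
next
  case (Cons it its)
  let ?s = "mem(0 := rev (item_out mem it) @ mem 0)"
  have 1: "runs (emit it) mem (30 * k + 30) ?s" using Cons.prems by (intro runs_emit) auto
  have r: "emit_ready k ?s" using Cons.prems(1) by (simp add: emit_ready_def)
  have "item_out ?s x = item_out mem x" if "x \<in> set its" for x
    using Cons.prems(2) that by (cases x) fastforce+
  then have m: "map (item_out ?s) its = map (item_out mem) its" by simp
  have 2: "runs (emits its) ?s (length its * (30 * k + 31) + 1)
     (?s(0 := rev (concat (map (item_out mem) its)) @ ?s 0))"
    unfolding m[symmetric] by (rule Cons.IH[OF r]) (use Cons.prems(2) in auto)
  show ?case unfolding emits.simps
    by (rule runs_weaken[OF runs_Seq[OF 1 2]]) auto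
qed

fun item_val :: "nat \<Rightarrow> nat list \<times> nat list \<Rightarrow> nat \<Rightarrow> item \<Rightarrow> nat list" where
  "item_val k e i (Lit c) = [c]"
| "item_val k e i (Word X) = (if X = 5 then pad k (fst e) else pad k (snd e))"
| "item_val k e i Index = replicate i 2 @ replicate (k - i) 1"

definition vals :: "nat \<Rightarrow> item list \<Rightarrow> nat list \<times> nat list \<Rightarrow> nat \<Rightarrow> nat list" where
  "vals k its e i = concat (map (item_val k e i) its)"

text \<open>A pass consumes the arc list it reads, which is why the input arcs are copied to four
  stacks. The inner loop advances the copy number by turning a mark of stack 3 into one of stack 2,
  and thereby also counts to \<open>k\<close>.\<close>

definition arc_pass :: "nat \<Rightarrow> item list \<Rightarrow> com" where
  "arc_pass S its = Loop S {1, 2, 3} (Seq (load S 5) (Seq (load S 6)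
     (Seq (Loop 3 {1} (Seq (emits its) (Seq (Pop 3) (Push 2 2))))
     (Seq (move 2 {2} [(3, \<lambda>_. 1)]) (Seq (move 5 {1, 2} []) (move 6 {1, 2} []))))))"

definition arc_words :: "(nat list \<times> nat list) list \<Rightarrow> nat list" where
  "arc_words es = concat (map (\<lambda>(u, v). u @ [3] @ v @ [3]) es)"

lemma runs_arc_pass:
  assumes S: "S \<in> {15, 16, 17, 18}" and its: "\<And>X. Word X \<in> set its \<Longrightarrow> X \<in> {5, 6}"
    and mem: "mem S = arc_words es" "mem 3 = replicate k 1" "mem 2 = []" "mem 4 = []" "mem 5 = []" "mem 6 = []"
    and es: "\<And>u v w. (u, v) \<in> set es \<Longrightarrow> w \<in> {u, v} \<Longrightarrow> set w \<subseteq> {1, 2} \<and> length w \<le> k"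
  shows "runs (arc_pass S its) mem (length es * ((length its * (30 * k + 31) + 120) * (k + 1)) + 1)
    (mem(S := [], 0 := rev (concat (map (\<lambda>e. concat (map (vals k its e) [0..<k])) es)) @ mem 0))"
  using mem es
proof (induction es arbitrary: mem)
  case Nil
  then show ?case unfolding arc_pass_def
    by (intro runs_weaken[OF runs_Loop_exit]) (auto simp: arc_words_def fun_eq_iff)
next
  case (Cons e es)
  obtain u v where e: "e = (u, v)" by force
  have w: "set u \<subseteq> {1, 2}" "length u \<le> k" "set v \<subseteq> {1, 2}" "length v \<le> k"
    using Cons.prems(7)[of u v] e by auto
  have d: "S \<notin> {0, 2, 3, 4, 5, 6}" "S \<in> {14, 15, 16, 17, 18}" using S by auto
  have S0: "mem S = u @ 3 # v @ 3 # arc_words es" using Cons.prems(1) e by (simp add: arc_words_def)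
  let ?s1 = "mem(S := v @ 3 # arc_words es, 5 := rev (pad k u))"
  let ?s2 = "mem(S := arc_words es, 5 := rev (pad k u), 6 := rev (pad k v))"
  have 1: "runs (load S 5) mem (30 * k + 30) ?s1"
    by (rule runs_load) (use Cons.prems(2-6) S0 w d in auto)
  have 2: "runs (load S 6) ?s1 (30 * k + 30) ?s2"
    by (rule runs_weaken[OF runs_load[where w = v and r = "arc_words es" and k = k]])
      (use Cons.prems(2-6) w d in \<open>auto simp: fun_eq_iff\<close>)
  define s where "s j = ?s2(3 := replicate (k - j) 1, 2 := replicate j 2,
      0 := rev (concat (map (vals k its e) [0..<j])) @ mem 0)" for j
  let ?E = "length its * (30 * k + 31) + 1"
  have body: "runs (Seq (emits its) (Seq (Pop 3) (Push 2 2))) (s j) (?E + 4) (s (Suc j))" if j: "j < k" for j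
  proof -
    have "\<exists>a b. replicate j (2::nat) = replicate a 2 \<and> replicate (k - j) (1::nat) = replicate b 1 \<and> a + b \<le> k"
      using j by (intro exI[of _ j] exI[of _ "k - j"]) auto
    then have "emit_ready k (s j)"
      using j d w Cons.prems(4) set_pad by (simp add: emit_ready_def s_def length_pad)
    note r = runs_emits[OF this its]
    have "item_out (s j) x = item_val k e j x" if "x \<in> set its" for x
      using its[of "case x of Word X \<Rightarrow> X"] that d by (cases x) (auto simp: s_def e)
    then have "map (item_out (s j)) its = map (item_val k e j) its" by simp
    then have m: "concat (map (item_out (s j)) its) = vals k its e j"
      unfolding vals_def by (rule arg_cong)
    show ?thesis
      by (rule runs_weaken[OF runs_Seq[OF r runs_Seq_Pop[OF runs_Push]]])
        (use j d m in \<open>auto simp: s_def fun_eq_iff replicate_diff\<close>)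
  qed
  have 3: "runs (Loop 3 {1} (Seq (emits its) (Seq (Pop 3) (Push 2 2)))) ?s2 (k * (?E + 4 + 1) + 1) (s k)"
    by (rule runs_LoopI[where s = s, OF _ body])
      (use d Cons.prems in \<open>auto simp: s_def fun_eq_iff replicate_diff\<close>)
  let ?s4 = "(s k)(2 := [], 3 := replicate k 1)"
  have 4: "runs (move 2 {2} [(3, \<lambda>_. 1)]) (s k) (k * 9 + 1) ?s4"
    by (rule runs_moveI[where xs = "replicate k 2" and ys = "[]"])
      (use d in \<open>auto simp: moved_def s_def fun_eq_iff map_replicate_const\<close>)
  have 5: "runs (move 5 {1, 2} []) ?s4 (k * 7 + 1) (?s4(5 := []))"
    by (rule runs_moveI[where xs = "rev (pad k u)" and ys = "[]"])
      (use d w set_pad length_pad in \<open>auto simp: moved_def s_def fun_eq_iff\<close>)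
  have 6: "runs (move 6 {1, 2} []) (?s4(5 := [])) (k * 7 + 1) (?s4(5 := [], 6 := []))"
    by (rule runs_moveI[where xs = "rev (pad k v)" and ys = "[]"])
      (use d w set_pad length_pad in \<open>auto simp: moved_def s_def fun_eq_iff\<close>)
  note it = runs_Seq[OF 1 runs_Seq[OF 2 runs_Seq[OF 3 runs_Seq[OF 4 runs_Seq[OF 5 6]]]]]
  have rest: "runs (arc_pass S its) (?s4(5 := [], 6 := []))
     (length es * ((length its * (30 * k + 31) + 120) * (k + 1)) + 1)
     ((?s4(5 := [], 6 := []))(S := [], 0 := rev (concat (map (\<lambda>e. concat (map (vals k its e) [0..<k])) es)) @ (?s4(5 := [], 6 := [])) 0))"
    by (rule Cons.IH) (use d Cons.prems in \<open>auto simp: s_def\<close>)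
  show ?case
    unfolding arc_pass_def
  proof (rule runs_weaken[OF runs_Loop_step[OF _ it rest[unfolded arc_pass_def]]])
    show "peek (mem S) \<in> {1, 2, 3}" using S0 w by (cases u) auto
    show "(?s4(5 := [], 6 := []))(S := [], 0 := rev (concat (map (\<lambda>e. concat (map (vals k its e) [0..<k])) es)) @ (?s4(5 := [], 6 := [])) 0)
      = mem(S := [], 0 := rev (concat (map (\<lambda>e. concat (map (vals k its e) [0..<k])) (e # es))) @ mem 0)"
      using d Cons.prems by (auto simp: s_def fun_eq_iff)
  qed (simp add: algebra_simps)
qed

section \<open>Binary numerals, increment and decrement, and the computation of the new
  bound\<close>

declare bin.simps [simp del]

lemma bin_0 [simp]: "bin 0 = []"
  by (simp add: bin.simps)

lemma bin_even: "even n \<Longrightarrow> 0 < n \<Longrightarrow> bin n = 1 # bin (n div 2)"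
  by (simp add: bin.simps[of n])

lemma bin_odd: "odd n \<Longrightarrow> bin n = 2 # bin (n div 2)"
  by (auto simp: bin.simps[of n] odd_pos)

lemma bin_eq_Nil [simp]: "bin n = [] \<longleftrightarrow> n = 0"
  by (auto simp: bin.simps[of n])

lemma set_bin: "set (bin n) \<subseteq> {1, 2}"
proof (induction n rule: bin.induct)
  case (1 n)
  then show ?case by (cases "n = 0") (auto simp: bin.simps[of n])
qed

lemma length_bin_le: "length (bin n) \<le> n"
proof (induction n rule: bin.induct)
  case (1 n)
  then show ?case by (cases "n = 0") (auto simp: bin.simps[of n])
qed

lemma last_bin: "0 < n \<Longrightarrow> last (bin n) = 2"
proof (induction n rule: bin.induct)
  case (1 n)
  show ?case
  proof (cases "n div 2 = 0")
    case True
    then have "n = 1" using 1 by simp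
    then show ?thesis by (simp add: bin_odd)
  next
    case False
    then show ?thesis using 1 by (auto simp: bin.simps[of n])
  qed
qed

text \<open>A digit in front doubles the value and adds 0 or 1, so induction from the low end
  reaches every word without a leading zero; the last digit is the most significant one.\<close>

lemma range_bin:
  assumes "set w \<subseteq> {1, 2}" "w = [] \<or> last w = 2"
  shows "w \<in> range bin"
  using assms
proof (induction w)
  case Nil
  then show ?case using bin_0 by (metis rangeI)
next
  case (Cons d w)
  then have "w \<in> range bin" by (cases "w = []") auto
  then obtain n where n: "w = bin n" by blast
  show ?case
  proof (cases "d = 1")
    case True
    then have "w \<noteq> []" using Cons.prems by auto
    then have "0 < n" using n by auto
    then have "bin (2 * n) = d # w" using True n by (simp add: bin_even)
    then show ?thesis by (metis rangeI)
  next
    case False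
    then have "bin (2 * n + 1) = d # w" using Cons.prems n by (simp add: bin_odd)
    then show ?thesis by (metis rangeI)
  qed
qed

text \<open>The carry rule: the initial run of digits 2 becomes digits 1, and the digit 1 after it
  becomes 2. If there is no such digit, then \<open>r = []\<close> and the 2 is a new leading digit.
  Read from right to left this is the borrow rule behind \<open>decrement\<close>.\<close>

lemma bin_Suc_carry:
  obtains a r where "bin n = replicate a 2 @ r" "bin (Suc n) = replicate a 1 @ 2 # tl r"
    "r = [] \<or> r = 1 # tl r \<and> tl r \<noteq> []"
proof (induction n arbitrary: thesis rule: less_induct)
  case (less n)
  show ?case
  proof (cases "even n")
    case True
    then have "bin (Suc n) = 2 # bin (n div 2)" by (simp add: bin_odd)
    moreover have "bin n = [] \<or> bin n = 1 # bin (n div 2) \<and> n div 2 \<noteq> 0"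
    proof (cases "n = 0")
      case False
      then have "n div 2 \<noteq> 0" using True by (metis div_eq_0_iff even_zero dvd_div_eq_0_iff zero_neq_numeral)
      then show ?thesis using True False bin_even[of n] by blast
    qed simp
    ultimately show ?thesis using less.prems[of 0 "bin n"] by auto
  next
    case False
    then have "n div 2 < n" by (simp add: odd_pos)
    then obtain a r where r: "bin (n div 2) = replicate a 2 @ r" "bin (Suc (n div 2)) = replicate a 1 @ 2 # tl r"
      "r = [] \<or> r = 1 # tl r \<and> tl r \<noteq> []" using less.IH by blast
    have "bin n = 2 # bin (n div 2)" "bin (Suc n) = 1 # bin (Suc (n div 2))"
      using False by (simp_all add: bin_odd bin_even)
    then show ?thesis using less.prems[of "Suc a" r] r by simp
  qed
qed

lemma length_bin_Suc: "length (bin n) \<le> length (bin (Suc n))"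
  by (rule bin_Suc_carry[of n]) auto

lemma length_bin_mono: "m \<le> n \<Longrightarrow> length (bin m) \<le> length (bin n)"
  using lift_Suc_mono_le[of "\<lambda>n. length (bin n)"] length_bin_Suc by blast

definition increment :: com where
  "increment = Seq (move 13 {2} [(4, \<lambda>_. 1)]) (Seq (Cond 13 {1} (Pop 13) Skip)
     (Seq (Push 13 2) (move 4 {1} [(13, \<lambda>_. 1)])))"

lemma runs_increment:
  assumes "mem 13 = bin n" "mem 4 = []"
  shows "runs increment mem (20 * n + 20) (mem(13 := bin (Suc n)))"
proof -
  obtain a r where r: "bin n = replicate a 2 @ r" "bin (Suc n) = replicate a 1 @ 2 # tl r"
    "r = [] \<or> r = 1 # tl r \<and> tl r \<noteq> []" by (rule bin_Suc_carry)
  have a: "a \<le> n" using length_bin_le[of n] r(1) by simp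
  have pr: "peek r \<notin> {2}" "r \<noteq> [] \<Longrightarrow> peek r = 1" using r(3) by (auto simp: peek_def split: list.split)
  let ?s1 = "mem(13 := r, 4 := replicate a 1)" and ?s2 = "mem(13 := tl r, 4 := replicate a 1)"
  have 1: "runs (move 13 {2} [(4, \<lambda>_. 1)]) mem (a * 9 + 1) ?s1"
    by (rule runs_moveI[where xs = "replicate a 2" and ys = r])
      (use r assms pr in \<open>auto simp: moved_simps\<close>)
  have 2: "runs (Cond 13 {1} (Pop 13) Skip) ?s1 2 ?s2"
  proof (cases "r = []")
    case True
    then show ?thesis by (intro runs_weaken[OF runs_Cond[where n = 1 and mem' = ?s1]]) (auto intro: runs_Skip[unfolded One_nat_def])
  next
    case False
    have "runs (Pop 13) ?s1 1 ?s2" by (rule runs_weaken[OF runs_Pop]) auto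
    then show ?thesis using pr False by (intro runs_weaken[OF runs_Cond[where n = 1]]) auto
  qed
  have 3: "runs (move 4 {1} [(13, \<lambda>_. 1)]) (?s2(13 := 2 # ?s2 13)) (a * 9 + 1) (mem(13 := bin (Suc n)))"
    by (rule runs_moveI[where xs = "replicate a 1" and ys = "[]"])
      (use r assms in \<open>auto simp: moved_simps\<close>)
  show ?thesis unfolding increment_def
    by (rule runs_weaken[OF runs_Seq[OF 1 runs_Seq[OF 2 runs_Seq_Push[OF 3]]]])
      (use a in auto)
qed

text \<open>Once the 2 ending the run of 1s is popped, further digits mean that the borrow leaves a
  1 in its place; an empty stack means that it was the leading digit, which must vanish to keep the
  numeral canonical.\<close>

definition decrement :: com where
  "decrement = Seq (move 8 {1} [(4, \<lambda>_. 2)]) (Seq (Pop 8) (Seq (Cond 8 {1, 2} (Push 8 1) Skip)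
     (move 4 {2} [(8, \<lambda>_. 2)])))"

text \<open>The time is measured in the length of the numeral, not in its value as for
  \<open>increment\<close>: the given \<open>K\<close> may be exponential in the input length,
  whereas \<open>increment\<close> only counts up to the polynomially bounded new bound.\<close>

lemma runs_decrement:
  assumes "mem 8 = bin (Suc n)" "mem 4 = []" "length (bin (Suc n)) \<le> L"
  shows "runs decrement mem (20 * L + 20) (mem(8 := bin n))"
proof -
  obtain a r where r: "bin n = replicate a 2 @ r" "bin (Suc n) = replicate a 1 @ 2 # tl r"
    "r = [] \<or> r = 1 # tl r \<and> tl r \<noteq> []" by (rule bin_Suc_carry)
  have a: "a \<le> L" using assms(3) r(2) by simp
  have "set (tl r) \<subseteq> {1, 2}" using set_bin[of "Suc n"] r(2) by auto
  then have pr: "tl r \<noteq> [] \<Longrightarrow> peek (tl r) \<in> {1, 2}" by (cases "tl r") auto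
  let ?s1 = "mem(8 := 2 # tl r, 4 := replicate a 2)" and ?s2 = "mem(8 := tl r, 4 := replicate a 2)"
    and ?s3 = "mem(8 := r, 4 := replicate a 2)"
  have 1: "runs (move 8 {1} [(4, \<lambda>_. 2)]) mem (a * 9 + 1) ?s1"
    by (rule runs_moveI[where xs = "replicate a 1" and ys = "2 # tl r"])
      (use r assms in \<open>auto simp: moved_simps\<close>)
  have e: "?s2 = ?s1(8 := tl (?s1 8))" by auto
  have 2: "runs (Cond 8 {1, 2} (Push 8 1) Skip) (?s1(8 := tl (?s1 8))) 2 ?s3"
  proof (cases "r = []")
    case True
    then have e: "?s3 = ?s2" by simp
    show ?thesis using True unfolding \<open>?s2 = _\<close>[symmetric] e
      by (intro runs_weaken[OF runs_Cond[where n = 1]]) (auto intro: runs_Skip[unfolded One_nat_def])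
  next
    case False
    then have "runs (Push 8 1) ?s2 1 ?s3" using r(3) by (intro runs_weaken[OF runs_Push]) auto
    then show ?thesis using pr False r(3) unfolding e[symmetric] by (intro runs_weaken[OF runs_Cond[where n = 1]]) auto
  qed
  have 3: "runs (move 4 {2} [(8, \<lambda>_. 2)]) ?s3 (a * 9 + 1) (mem(8 := bin n))"
    by (rule runs_moveI[where xs = "replicate a 2" and ys = "[]"])
      (use r assms in \<open>auto simp: moved_simps\<close>)
  show ?thesis unfolding decrement_def
    by (rule runs_weaken[OF runs_Seq[OF 1 runs_Seq_Pop[OF runs_Seq[OF 2 3]]]])
      (use a in auto)
qed

text \<open>Compares the binary \<open>K\<close> with the unary \<open>n\<close> in \<open>n\<close>
  rounds. It leaves \<open>min n K\<close> in unary on stack 9 and \<open>K - n\<close> on stack 8,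
  which is nonzero exactly if \<open>K\<close> is too large. The vertex count moves to stack 12 as
  the first summand of the new bound.\<close>

definition bound_loop :: com where
  "bound_loop = Loop 10 {1} (Seq (Pop 10) (Seq (Push 12 1)
     (Cond 8 {1, 2} (Seq decrement (Push 9 1)) Skip)))"

lemma peek_bin: "peek (bin n) \<in> {1, 2} \<longleftrightarrow> 0 < n"
proof (cases "n = 0")
  case False
  then obtain d w where "bin n = d # w" by (metis bin_eq_Nil neq_Nil_conv)
  then show ?thesis using set_bin[of n] False by simp
qed simp

lemma runs_bound_loop:
  assumes "mem 10 = replicate n 1" "mem 12 = []" "mem 8 = bin K" "mem 9 = []" "mem 4 = []" "length (bin K) \<le> L"
  shows "runs bound_loop mem (n * (20 * L + 30) + 1)
    (mem(10 := [], 12 := replicate n 1, 8 := bin (K - n), 9 := replicate (min n K) 1))"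
proof -
  define s where "s j = mem(10 := replicate (n - j) 1, 12 := replicate j 1, 8 := bin (K - j),
     9 := replicate (min j K) 1)" for j
  have body: "runs (Seq (Pop 10) (Seq (Push 12 1) (Cond 8 {1, 2} (Seq decrement (Push 9 1)) Skip)))
     (s j) (20 * L + 29) (s (Suc j))" if "j < n" for j
  proof -
    let ?t = "mem(10 := replicate (n - Suc j) 1, 12 := replicate (Suc j) 1, 8 := bin (K - j),
     9 := replicate (min j K) 1)"
    have t: "?t = (s j)(10 := tl (s j 10), 12 := 1 # ((s j)(10 := tl (s j 10))) 12)"
      using that by (auto simp: s_def fun_eq_iff replicate_diff)
    have "runs (Cond 8 {1, 2} (Seq decrement (Push 9 1)) Skip) ?t (20 * L + 23) (s (Suc j))"
    proof (cases "j < K")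
      case True
      then have K: "K - j = Suc (K - Suc j)" by simp
      have "length (bin (K - j)) \<le> L" using assms(6) length_bin_mono[of "K - j" K] by simp
      then have "runs decrement ?t (20 * L + 20) (?t(8 := bin (K - Suc j)))"
        using assms K by (intro runs_decrement) auto
      then have "runs (Seq decrement (Push 9 1)) ?t (20 * L + 22) (s (Suc j))"
        by (rule runs_weaken[OF runs_Seq[OF _ runs_Push]])
          (use True in \<open>auto simp: s_def fun_eq_iff min_def\<close>)
      then show ?thesis using True peek_bin[of "K - j"] by (intro runs_weaken[OF runs_Cond[where n = "20 * L + 22"]]) auto
    next
      case False
      then have e: "?t = s (Suc j)" by (auto simp: s_def fun_eq_iff min_def)
      have "peek (s (Suc j) 8) = 0" using False by (simp add: s_def)
      then show ?thesis unfolding e using runs_Skip[of "s (Suc j)"]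
        by (intro runs_weaken[OF runs_Cond[where n = 1]]) auto
    qed
    then show ?thesis unfolding t by (intro runs_weaken[OF runs_Seq_Pop[OF runs_Seq_Push[where n = "20 * L + 23"]]]) auto
  qed
  show ?thesis unfolding bound_loop_def
    by (rule runs_LoopI[where s = s, OF _ body])
      (use assms in \<open>auto simp: s_def fun_eq_iff replicate_diff\<close>)
qed

definition add_copies :: com where
  "add_copies = Seq (move 3 {1} [(2, \<lambda>_. 2), (12, \<lambda>_. 1)]) (move 2 {2} [(3, \<lambda>_. 1)])"

text \<open>Each arc contributes \<open>k\<close>, and another \<open>k\<close> as long as marks are
  left on stack 9; running out of arcs or of marks is what computes the minimum in the new
  bound.\<close>

definition count_loop :: com where
  "count_loop = Loop 11 {1} (Seq (Pop 11) (Seq add_copies (Cond 9 {1} (Seq (Pop 9) add_copies) Skip)))"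

lemma runs_add_copies:
  assumes "mem 3 = replicate k 1" "mem 2 = []"
  shows "runs add_copies mem (20 * k + 3) (mem(12 := replicate k 1 @ mem 12))"
proof -
  have 1: "runs (move 3 {1} [(2, \<lambda>_. 2), (12, \<lambda>_. 1)]) mem (k * 11 + 1)
     (mem(3 := [], 2 := replicate k 2, 12 := replicate k 1 @ mem 12))"
    by (rule runs_moveI[where xs = "replicate k 1" and ys = "[]"])
      (use assms in \<open>auto simp: moved_simps\<close>)
  have 2: "runs (move 2 {2} [(3, \<lambda>_. 1)]) (mem(3 := [], 2 := replicate k 2, 12 := replicate k 1 @ mem 12))
     (k * 9 + 1) (mem(12 := replicate k 1 @ mem 12))"
    by (rule runs_moveI[where xs = "replicate k 2" and ys = "[]"])
      (use assms in \<open>auto simp: moved_simps\<close>)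
  show ?thesis unfolding add_copies_def by (rule runs_weaken[OF runs_Seq[OF 1 2]]) auto
qed

lemma runs_count_loop:
  assumes "mem 3 = replicate k 1" "mem 2 = []" "mem 11 = replicate m 1" "mem 9 = replicate u 1" "mem 12 = replicate n 1"
  shows "runs count_loop mem (m * (40 * k + 15) + 1)
    (mem(11 := [], 9 := replicate (u - m) 1, 12 := replicate (n + k * (m + min u m)) 1))"
proof -
  define s where "s j = mem(11 := replicate (m - j) 1, 9 := replicate (u - j) 1,
     12 := replicate (n + k * (j + min u j)) 1)" for j
  have body: "runs (Seq (Pop 11) (Seq add_copies (Cond 9 {1} (Seq (Pop 9) add_copies) Skip)))
     (s j) (40 * k + 14) (s (Suc j))" if "j < m" for j
  proof -
    let ?t = "(s j)(11 := tl (s j 11))"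
    let ?t2 = "?t(12 := replicate k 1 @ ?t 12)"
    have 1: "runs add_copies ?t (20 * k + 3) ?t2"
      by (rule runs_add_copies) (use assms in \<open>auto simp: s_def\<close>)
    have 2: "runs (Cond 9 {1} (Seq (Pop 9) add_copies) Skip) ?t2 (20 * k + 7) (s (Suc j))"
    proof (cases "j < u")
      case True
      then have mn: "min u j = j" "min u (Suc j) = Suc j" by auto
      let ?t3 = "?t2(9 := tl (?t2 9))"
      have "runs add_copies ?t3 (20 * k + 3) (?t3(12 := replicate k 1 @ ?t3 12))"
        by (rule runs_add_copies) (use assms in \<open>auto simp: s_def\<close>)
      then have "runs (Seq (Pop 9) add_copies) ?t2 (20 * k + 5) (s (Suc j))"
        by (rule runs_weaken[OF runs_Seq_Pop[OF _]])
          (use True \<open>j < m\<close> in \<open>auto simp: s_def fun_eq_iff replicate_diff mn algebra_simps simp flip: replicate_add\<close>)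
      moreover have "peek (?t2 9) = 1" using True by (simp add: s_def replicate_diff)
      ultimately show ?thesis by (intro runs_weaken[OF runs_Cond[where n = "20 * k + 5"]]) auto
    next
      case False
      then have "?t2 = s (Suc j)" using \<open>j < m\<close>
        by (auto simp: s_def fun_eq_iff replicate_diff min_def algebra_simps simp flip: replicate_add)
      moreover have "peek (?t2 9) = 0" using False by (simp add: s_def)
      ultimately show ?thesis using runs_Skip[of ?t2]
        by (intro runs_weaken[OF runs_Cond[where n = 1]]) auto
    qed
    show ?thesis by (rule runs_weaken[OF runs_Seq_Pop[OF runs_Seq[OF 1 2]]]) auto
  qed
  show ?thesis unfolding count_loop_def
    by (rule runs_LoopI[where s = s, OF _ body])
      (use assms in \<open>auto simp: s_def fun_eq_iff replicate_diff\<close>)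
qed

definition binary_loop :: com where
  "binary_loop = Loop 12 {1} (Seq (Pop 12) increment)"

lemma runs_binary_loop:
  assumes "mem 12 = replicate c 1" "mem 13 = []" "mem 4 = []"
  shows "runs binary_loop mem (c * (20 * c + 23) + 1) (mem(12 := [], 13 := bin c))"
proof -
  define s where "s j = mem(12 := replicate (c - j) 1, 13 := bin j)" for j
  have body: "runs (Seq (Pop 12) increment) (s j) (20 * c + 22) (s (Suc j))" if "j < c" for j
  proof -
    let ?t = "(s j)(12 := tl (s j 12))"
    have "runs increment ?t (20 * j + 20) (?t(13 := bin (Suc j)))"
      by (rule runs_increment) (use assms in \<open>auto simp: s_def\<close>)
    then show ?thesis
      by (rule runs_weaken[OF runs_Seq_Pop[OF _]]) (use that in \<open>auto simp: s_def fun_eq_iff replicate_diff\<close>)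
  qed
  show ?thesis unfolding binary_loop_def
    by (rule runs_LoopI[where s = s, OF _ body])
      (use assms in \<open>auto simp: s_def fun_eq_iff replicate_diff\<close>)
qed

definition vertex_pass :: com where
  "vertex_pass = Loop 14 {1, 2, 3} (Seq (load 14 5) (Seq (emits [Word 5, Lit 2, Lit 3]) (move 5 {1, 2} [])))"

definition vertex_words :: "nat list list \<Rightarrow> nat list" where
  "vertex_words vs = concat (map (\<lambda>v. v @ [3]) vs)"

lemma runs_vertex_pass:
  assumes "mem 14 = vertex_words vs" "mem 3 = replicate k 1" "mem 2 = []" "mem 4 = []" "mem 5 = []" "mem 6 = []"
    and "\<And>v. v \<in> set vs \<Longrightarrow> set v \<subseteq> {1, 2} \<and> length v \<le> k"
  shows "runs vertex_pass mem (length vs * (140 * (k + 1)) + 1)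
    (mem(14 := [], 0 := rev (concat (map (\<lambda>v. pad k v @ [2, 3]) vs)) @ mem 0))"
  using assms
proof (induction vs arbitrary: mem)
  case Nil
  then show ?case unfolding vertex_pass_def
    by (intro runs_weaken[OF runs_Loop_exit]) (auto simp: vertex_words_def fun_eq_iff)
next
  case (Cons v vs)
  have v: "set v \<subseteq> {1, 2}" "length v \<le> k" using Cons.prems(7)[of v] by auto
  have S0: "mem 14 = v @ 3 # vertex_words vs" using Cons.prems(1) by (simp add: vertex_words_def)
  let ?s1 = "mem(14 := vertex_words vs, 5 := rev (pad k v))"
  have 1: "runs (load 14 5) mem (30 * k + 30) ?s1"
    by (rule runs_load) (use Cons.prems(2-6) S0 v in auto)
  have "\<exists>a b. replicate a (2::nat) = [] \<and> replicate k (1::nat) = replicate b 1 \<and> a + b \<le> k"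
    by (intro exI[of _ 0] exI[of _ k]) auto
  then have "emit_ready k ?s1" using Cons.prems v set_pad length_pad by (auto simp: emit_ready_def)
  then have 2: "runs (emits [Word 5, Lit 2, Lit 3]) ?s1 (3 * (30 * k + 31) + 1)
     (?s1(0 := rev (pad k v @ [2, 3]) @ ?s1 0))"
    by (intro runs_weaken[OF runs_emits[where k = k]]) auto
  have 3: "runs (move 5 {1, 2} []) (?s1(0 := rev (pad k v @ [2, 3]) @ ?s1 0)) (k * 7 + 1)
     (mem(14 := vertex_words vs, 0 := rev (pad k v @ [2, 3]) @ mem 0))"
    by (rule runs_moveI[where xs = "rev (pad k v)" and ys = "[]"])
      (use v set_pad length_pad Cons.prems in \<open>auto simp: moved_def fun_eq_iff\<close>)
  note it = runs_Seq[OF 1 runs_Seq[OF 2 3]]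
  let ?s3 = "mem(14 := vertex_words vs, 0 := rev (pad k v @ [2, 3]) @ mem 0)"
  have rest: "runs vertex_pass ?s3 (length vs * (140 * (k + 1)) + 1)
     (?s3(14 := [], 0 := rev (concat (map (\<lambda>v. pad k v @ [2, 3]) vs)) @ ?s3 0))"
    by (rule Cons.IH) (use Cons.prems in auto)
  show ?case
    unfolding vertex_pass_def
  proof (rule runs_weaken[OF runs_Loop_step[OF _ it rest[unfolded vertex_pass_def]]])
    show "peek (mem 14) \<in> {1, 2, 3}" using S0 v by (cases v) auto
  qed auto
qed

subsection \<open>Checking the input format\<close>

definition vertex_code :: "nat list \<Rightarrow> nat list" where
  "vertex_code vs = vertex_words (map bin vs)"

definition arc_code :: "(nat \<times> nat) list \<Rightarrow> nat list" where
  "arc_code es = arc_words (map (\<lambda>(a, b). (bin a, bin b)) es)"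

text \<open>The format of \<open>enc\<close> for arbitrary lists: they may be unsorted or
  repetitive, and arcs may have foreign endpoints. Parsing establishes this format and nothing
  more.\<close>

definition list_code :: "nat list \<Rightarrow> (nat \<times> nat) list \<Rightarrow> nat \<Rightarrow> nat list" where
  "list_code vs es K = vertex_code vs @ [4] @ arc_code es @ [4] @ bin K"

lemma vertex_code_simps [simp]:
  "vertex_code [] = []" "vertex_code (vs @ [v]) = vertex_code vs @ bin v @ [3]"
  by (simp_all add: vertex_code_def vertex_words_def)

lemma arc_code_simps [simp]:
  "arc_code [] = []" "arc_code (es @ [(u, v)]) = arc_code es @ bin u @ [3] @ bin v @ [3]"
  by (simp_all add: arc_code_def arc_words_def)

definition read_word :: "(nat \<times> (nat \<Rightarrow> nat)) list \<Rightarrow> com" where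
  "read_word outs = Seq (Cond 0 {1} (Push 7 1) Skip) (move 0 {1, 2} outs)"

text \<open>The input is read backwards, so that a numeral with a leading zero shows up as a word whose
  first symbol is 1.\<close>

lemma runs_read_word:
  assumes "mem 0 = xs @ ys" "set xs \<subseteq> {1, 2}" "peek ys \<notin> {1, 2}"
    "distinct (map fst outs)" "0 \<notin> fst ` set outs" "7 \<notin> fst ` set outs"
  shows "runs (read_word outs) mem (length xs * (2 * length outs + 7) + 4)
    ((moved 0 outs xs ys mem)(7 := if peek xs = 1 then 1 # mem 7 else mem 7))"
proof -
  let ?s = "mem(7 := if peek xs = 1 then 1 # mem 7 else mem 7)"
  have p: "peek (mem 0) = 1 \<longleftrightarrow> peek xs = 1"
    using assms(1,3) by (cases xs) auto
  have 1: "runs (Cond 0 {1} (Push 7 1) Skip) mem 2 ?s"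
  proof (cases "peek xs = 1")
    case True
    then show ?thesis using p runs_Push[of 7 1 mem] by (intro runs_weaken[OF runs_Cond[where n = 1]]) auto
  next
    case False
    then show ?thesis using p runs_Skip[of mem] by (intro runs_weaken[OF runs_Cond[where n = 1]]) auto
  qed
  have n: "map_of outs 7 = None" using assms(6) by (simp add: map_of_eq_None_iff)
  have 2: "runs (move 0 {1, 2} outs) ?s (length xs * (2 * length outs + 7) + 1)
     ((moved 0 outs xs ys mem)(7 := if peek xs = 1 then 1 # mem 7 else mem 7))"
    by (rule runs_moveI[where xs = xs and ys = ys])
      (use assms n in \<open>auto simp: moved_def fun_eq_iff split: option.splits\<close>)
  show ?thesis unfolding read_word_def
    by (rule runs_weaken[OF runs_Seq[OF 1 2]]) auto
qed

lemma peek_rev_bin: "peek (rev (bin n)) \<noteq> 1"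
proof (cases "n = 0")
  case False
  then have "bin n = butlast (bin n) @ [2]"
    using append_butlast_last_id[of "bin n"] last_bin[of n] by simp
  from arg_cong[OF this, of "\<lambda>x. peek (rev x)"] show ?thesis by simp
qed simp

lemma rev_bin_if_peek:
  assumes "set xs \<subseteq> {1, 2}" "peek xs \<noteq> 1"
  shows "\<exists>n. xs = rev (bin n)"
proof -
  have "rev xs = [] \<or> last (rev xs) = 2" using assms by (cases xs) auto
  then have "rev xs \<in> range bin" using assms(1) by (intro range_bin) auto
  then show ?thesis by (metis imageE rev_rev_ident)
qed

lemma runs_read_bin:
  assumes "mem 0 = rev (bin n) @ ys" "peek ys \<notin> {1, 2}"
    "distinct (map fst outs)" "0 \<notin> fst ` set outs" "7 \<notin> fst ` set outs"
    "moved 0 outs (rev (bin n)) ys mem = \<tau>" "length (bin n) * (2 * length outs + 7) + 4 \<le> B"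
  shows "runs (read_word outs) mem B \<tau>"
proof -
  have "map_of outs 7 = None" using assms(5) by (simp add: map_of_eq_None_iff)
  then have "(moved 0 outs (rev (bin n)) ys mem)(7 := mem 7) = moved 0 outs (rev (bin n)) ys mem"
    by (auto simp: moved_def)
  then show ?thesis
    using runs_weaken[OF runs_read_word[of mem "rev (bin n)" ys outs]] assms set_bin[of n] peek_rev_bin[of n]
    by simp
qed

lemma peek_dropWhile: "peek (dropWhile P xs) = 0 \<or> \<not> P (peek (dropWhile P xs))"
  by (induction xs) auto

text \<open>Each reader has two specifications. On well-formed input the final store is given
  exactly; on arbitrary input, as here, only termination in time is claimed, and that an empty
  failure flag at the end certifies the format of the part read.\<close>

lemma runs_read_word_any:
  assumes "distinct (map fst outs)" "0 \<notin> fst ` set outs" "7 \<notin> fst ` set outs" "length (mem 0) \<le> L"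
  shows "\<exists>mem'. runs (read_word outs) mem (L * (2 * length outs + 7) + 4) mem' \<and> length (mem' 0) \<le> length (mem 0) \<and>
    set (mem' 0) \<subseteq> set (mem 0) \<and> (mem' 7 = [] \<longrightarrow> mem 7 = [] \<and> (\<exists>n. mem 0 = rev (bin n) @ mem' 0))"
proof -
  let ?xs = "takeWhile (\<lambda>x. x \<in> {1, 2}) (mem 0)" and ?ys = "dropWhile (\<lambda>x. x \<in> {1, 2}) (mem 0)"
  have s: "mem 0 = ?xs @ ?ys" "set ?xs \<subseteq> {1, 2}" by (simp, meson set_takeWhileD subsetI)
  have p: "peek ?ys \<notin> {1, 2}"
    using peek_dropWhile[of "\<lambda>x. x \<in> {1, 2}" "mem 0"] by auto
  let ?s = "(moved 0 outs ?xs ?ys mem)(7 := if peek ?xs = 1 then 1 # mem 7 else mem 7)"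
  have "length ?xs \<le> L" using assms(4) length_takeWhile_le le_trans by blast
  then have 1: "runs (read_word outs) mem (L * (2 * length outs + 7) + 4) ?s"
    by (intro runs_weaken[OF runs_read_word[of mem ?xs ?ys outs, OF s p assms(1-3)]]) auto
  have 3: "?s 0 = ?ys" by (simp add: moved_def)
  show ?thesis
  proof (intro exI[of _ ?s] conjI impI)
    show "length (?s 0) \<le> length (mem 0)" unfolding 3 by (rule length_dropWhile_le)
    show "set (?s 0) \<subseteq> set (mem 0)" unfolding 3 by (meson set_dropWhileD subsetI)
    assume a: "?s 7 = []"
    then show "mem 7 = []" by (simp split: if_splits)
    from a have "peek ?xs \<noteq> 1" by (auto split: if_splits)
    from rev_bin_if_peek[OF s(2) this] obtain n where "?xs = rev (bin n)" ..
    then show "\<exists>n. mem 0 = rev (bin n) @ ?s 0" unfolding 3 using s(1) by metis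
  qed (rule 1)
qed

definition read_vertex :: com where
  "read_vertex = Seq (shift 0 [(14, id)]) (Seq (read_word [(14, id)]) (Push 10 1))"

definition read_vertices :: com where
  "read_vertices = Loop 0 {3} read_vertex"

lemma runs_read_vertices:
  assumes "mem 0 = rev (vertex_code vs) @ ys" "peek ys \<notin> {1, 2, 3}" "length (mem 0) \<le> L"
  shows "runs read_vertices mem (length vs * (9 * L + 20) + 1)
    (mem(0 := ys, 14 := vertex_code vs @ mem 14, 10 := replicate (length vs) 1 @ mem 10))"
  using assms
proof (induction vs arbitrary: mem rule: rev_induct)
  case Nil
  then show ?case unfolding read_vertices_def
    by (intro runs_weaken[OF runs_Loop_exit]) (auto simp: fun_eq_iff)
next
  case (snoc v vs)
  let ?r = "rev (vertex_code vs) @ ys"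
  have z: "mem 0 = 3 # rev (bin v) @ ?r" using snoc.prems(1) by simp
  have pr: "peek ?r \<notin> {1, 2}" using snoc.prems(2) by (cases vs rule: rev_cases) auto
  let ?s1 = "mem(0 := rev (bin v) @ ?r, 14 := 3 # mem 14)"
  let ?s2 = "mem(0 := ?r, 14 := bin v @ 3 # mem 14)"
  let ?s3 = "?s2(10 := 1 # ?s2 10)"
  have 1: "runs (shift 0 [(14, id)]) mem 8 ?s1"
    by (rule runs_shiftI[where x = 3]) (use z in \<open>auto simp: moved_def fun_eq_iff\<close>)
  have 2: "runs (read_word [(14, id)]) ?s1 (length (bin v) * 9 + 4) ?s2"
    by (rule runs_read_bin[where n = v]) (use pr in \<open>auto simp: moved_def fun_eq_iff\<close>)
  have lv: "length (bin v) \<le> L" using z snoc.prems(3) by simp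
  have body: "runs read_vertex mem (9 * L + 19) ?s3" unfolding read_vertex_def
    by (rule runs_weaken[OF runs_Seq[OF 1 runs_Seq[OF 2 runs_Push]]])
      (use lv in auto)
  have rest: "runs read_vertices ?s3 (length vs * (9 * L + 20) + 1)
    (?s3(0 := ys, 14 := vertex_code vs @ ?s3 14, 10 := replicate (length vs) 1 @ ?s3 10))"
    by (rule snoc.IH) (use snoc.prems z in auto)
  have "peek (mem 0) \<in> {3}" using z by simp
  from runs_Loop_step[OF this body rest[unfolded read_vertices_def]] show ?case
    unfolding read_vertices_def
    by (rule runs_weaken) (auto simp: fun_eq_iff replicate_app_Cons_same)
qed

text \<open>Every round consumes at least the separator 3, so the input length bounds the number of
  rounds. An empty flag at the end implies an empty flag after each round, so the certificates of
  the single rounds combine.\<close>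

lemma runs_read_vertices_any:
  assumes "length (mem 0) \<le> L"
  shows "\<exists>mem'. runs read_vertices mem (length (mem 0) * (9 * L + 20) + 1) mem' \<and> length (mem' 0) \<le> length (mem 0) \<and>
    set (mem' 0) \<subseteq> set (mem 0) \<and> (mem' 7 = [] \<longrightarrow> mem 7 = [] \<and> (\<exists>vs. mem 0 = rev (vertex_code vs) @ mem' 0))"
  using assms
proof (induction "length (mem 0)" arbitrary: mem rule: less_induct)
  case less
  show ?case
  proof (cases "peek (mem 0) = 3")
    case False
    then have "runs read_vertices mem (length (mem 0) * (9 * L + 20) + 1) mem"
      unfolding read_vertices_def by (intro runs_weaken[OF runs_Loop_exit]) auto
    moreover have "mem 0 = rev (vertex_code []) @ mem 0" by simp
    ultimately show ?thesis by blast
  next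
    case True
    then obtain xs where z: "mem 0 = 3 # xs" by (cases "mem 0") auto
    let ?s1 = "mem(0 := xs, 14 := 3 # mem 14)"
    have 1: "runs (shift 0 [(14, id)]) mem 8 ?s1"
      by (rule runs_shiftI[where x = 3]) (use z in \<open>auto simp: moved_def fun_eq_iff\<close>)
    obtain mem2 where 2: "runs (read_word [(14, id)]) ?s1 (L * 9 + 4) mem2" "length (mem2 0) \<le> length xs"
      "set (mem2 0) \<subseteq> set xs" "mem2 7 = [] \<Longrightarrow> mem 7 = [] \<and> (\<exists>n. xs = rev (bin n) @ mem2 0)"
      using runs_read_word_any[of "[(14, id)]" ?s1 L] less.prems z by auto
    let ?s3 = "mem2(10 := 1 # mem2 10)"
    have body: "runs read_vertex mem (9 * L + 19) ?s3" unfolding read_vertex_def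
      by (rule runs_weaken[OF runs_Seq[OF 1 runs_Seq[OF 2(1) runs_Push]]]) auto
    have "length (?s3 0) < length (mem 0)" using 2(2) z by simp
    from less.hyps[of ?s3, OF this] this less.prems obtain mem' where
      3: "runs read_vertices ?s3 (length (?s3 0) * (9 * L + 20) + 1) mem'" "length (mem' 0) \<le> length (?s3 0)"
        "set (mem' 0) \<subseteq> set (?s3 0)" "mem' 7 = [] \<Longrightarrow> ?s3 7 = [] \<and> (\<exists>vs. ?s3 0 = rev (vertex_code vs) @ mem' 0)"
      by force
    have "peek (mem 0) \<in> {3}" using z by simp
    from runs_Loop_step[OF this body 3(1)[unfolded read_vertices_def]]
    have r: "runs read_vertices mem (length (mem 0) * (9 * L + 20) + 1) mem'"
      unfolding read_vertices_def
    proof (rule runs_weaken)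
      have "length (?s3 0) * (9 * L + 20) \<le> length xs * (9 * L + 20)" using 2(2) by simp
      then show "9 * L + 19 + (length (?s3 0) * (9 * L + 20) + 1) + 1 \<le> length (mem 0) * (9 * L + 20) + 1"
        unfolding z list.size mult_Suc by simp
    qed simp
    have "mem 7 = [] \<and> (\<exists>vs. mem 0 = rev (vertex_code vs) @ mem' 0)" if "mem' 7 = []"
    proof -
      from 3(4)[OF that] obtain vs where vs: "mem2 7 = []" "mem2 0 = rev (vertex_code vs) @ mem' 0" by auto
      from 2(4)[OF vs(1)] obtain n where n: "mem 7 = []" "xs = rev (bin n) @ mem2 0" by auto
      have "mem 0 = rev (vertex_code (vs @ [n])) @ mem' 0" using z n(2) vs(2) by simp
      then show ?thesis using n(1) by blast
    qed
    then show ?thesis using r 2(2,3) 3(2,3) z by (intro exI[of _ mem']) auto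
  qed
qed

abbreviation arc_stacks :: "(nat \<times> (nat \<Rightarrow> nat)) list" where
  "arc_stacks \<equiv> [(15, id), (16, id), (17, id), (18, id)]"

definition read_arc :: com where
  "read_arc = Seq (shift 0 arc_stacks) (Seq (read_word arc_stacks)
     (Seq (Cond 0 {3} (shift 0 arc_stacks) (Push 7 1)) (Seq (read_word arc_stacks) (Push 11 1))))"

definition read_arcs :: com where
  "read_arcs = Loop 0 {3} read_arc"

lemma runs_read_arcs:
  assumes "mem 0 = rev (arc_code es) @ ys" "peek ys \<notin> {1, 2, 3}" "length (mem 0) \<le> L"
  shows "runs read_arcs mem (length es * (30 * L + 45) + 1)
    (mem(0 := ys, 11 := replicate (length es) 1 @ mem 11, 15 := arc_code es @ mem 15,
       16 := arc_code es @ mem 16, 17 := arc_code es @ mem 17, 18 := arc_code es @ mem 18))"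
  using assms
proof (induction es arbitrary: mem rule: rev_induct)
  case Nil
  then show ?case unfolding read_arcs_def
    by (intro runs_weaken[OF runs_Loop_exit]) (auto simp: fun_eq_iff)
next
  case (snoc e es)
  obtain u v where e: "e = (u, v)" by force
  let ?r = "rev (arc_code es) @ ys"
  have z: "mem 0 = 3 # rev (bin v) @ 3 # rev (bin u) @ ?r" using snoc.prems(1) by (simp add: e)
  have pr: "peek ?r \<notin> {1, 2}" using snoc.prems(2) by (cases es rule: rev_cases) auto
  define st where "st x y = mem(0 := x, 15 := y @ mem 15, 16 := y @ mem 16, 17 := y @ mem 17, 18 := y @ mem 18)" for x y
  let ?w = "bin u @ 3 # bin v @ [3]"
  let ?s5 = "(st ?r ?w)(11 := 1 # (st ?r ?w) 11)"
  have 1: "runs (shift 0 arc_stacks) mem 14 (st (rev (bin v) @ 3 # rev (bin u) @ ?r) [3])"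
    by (rule runs_shiftI[where x = 3]) (use z in \<open>auto simp: moved_def st_def fun_eq_iff\<close>)
  have 2: "runs (read_word arc_stacks) (st (rev (bin v) @ 3 # rev (bin u) @ ?r) [3])
     (length (bin v) * 15 + 4) (st (3 # rev (bin u) @ ?r) (bin v @ [3]))"
    by (rule runs_read_bin[where n = v]) (auto simp: moved_def st_def fun_eq_iff)
  have "runs (shift 0 arc_stacks) (st (3 # rev (bin u) @ ?r) (bin v @ [3])) 14 (st (rev (bin u) @ ?r) (3 # bin v @ [3]))"
    by (rule runs_shiftI[where x = 3]) (auto simp: moved_def st_def fun_eq_iff)
  then have 3: "runs (Cond 0 {3} (shift 0 arc_stacks) (Push 7 1))
      (st (3 # rev (bin u) @ ?r) (bin v @ [3])) 15 (st (rev (bin u) @ ?r) (3 # bin v @ [3]))"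
    by (intro runs_weaken[OF runs_Cond[where n = 14]]) (auto simp: st_def)
  have 4: "runs (read_word arc_stacks) (st (rev (bin u) @ ?r) (3 # bin v @ [3])) (length (bin u) * 15 + 4) (st ?r ?w)"
    by (rule runs_read_bin[where n = u]) (use pr in \<open>auto simp: moved_def st_def fun_eq_iff\<close>)
  have l: "length (bin u) \<le> L" "length (bin v) \<le> L" using z snoc.prems(3) by simp_all
  have body: "runs read_arc mem (30 * L + 44) ?s5" unfolding read_arc_def
    by (rule runs_weaken[OF runs_Seq[OF 1 runs_Seq[OF 2 runs_Seq[OF 3 runs_Seq[OF 4 runs_Push]]]]]) (use l in auto)
  have rest: "runs read_arcs ?s5 (length es * (30 * L + 45) + 1)
    (?s5(0 := ys, 11 := replicate (length es) 1 @ ?s5 11, 15 := arc_code es @ ?s5 15,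
       16 := arc_code es @ ?s5 16, 17 := arc_code es @ ?s5 17, 18 := arc_code es @ ?s5 18))"
    by (rule snoc.IH) (use snoc.prems z in \<open>auto simp: st_def\<close>)
  have "peek (mem 0) \<in> {3}" using z by simp
  from runs_Loop_step[OF this body rest[unfolded read_arcs_def]] show ?case
    unfolding read_arcs_def
    by (rule runs_weaken) (auto simp: fun_eq_iff replicate_app_Cons_same st_def e)
qed

lemma runs_read_arcs_any:
  assumes "length (mem 0) \<le> L"
  shows "\<exists>mem'. runs read_arcs mem (length (mem 0) * (30 * L + 45) + 1) mem' \<and> length (mem' 0) \<le> length (mem 0) \<and>
    set (mem' 0) \<subseteq> set (mem 0) \<and> (mem' 7 = [] \<longrightarrow> mem 7 = [] \<and> (\<exists>es. mem 0 = rev (arc_code es) @ mem' 0))"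
  using assms
proof (induction "length (mem 0)" arbitrary: mem rule: less_induct)
  case less
  show ?case
  proof (cases "peek (mem 0) = 3")
    case False
    then have "runs read_arcs mem (length (mem 0) * (30 * L + 45) + 1) mem"
      unfolding read_arcs_def by (intro runs_weaken[OF runs_Loop_exit]) auto
    moreover have "mem 0 = rev (arc_code []) @ mem 0" by simp
    ultimately show ?thesis by blast
  next
    case True
    then obtain xs where z: "mem 0 = 3 # xs" by (cases "mem 0") auto
    let ?s1 = "moved 0 arc_stacks [3] xs mem"
    have 1: "runs (shift 0 arc_stacks) mem 14 ?s1"
      by (rule runs_shiftI[where x = 3]) (use z in auto)
    have s1: "?s1 0 = xs" "?s1 7 = mem 7" by (auto simp: moved_def)
    obtain mem2 where 2: "runs (read_word arc_stacks) ?s1 (L * 15 + 4) mem2" "length (mem2 0) \<le> length xs"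
      "set (mem2 0) \<subseteq> set xs" "mem2 7 = [] \<Longrightarrow> mem 7 = [] \<and> (\<exists>n. xs = rev (bin n) @ mem2 0)"
      using runs_read_word_any[of arc_stacks ?s1 L] less.prems z s1 by auto
    obtain mem3 where 3: "runs (Cond 0 {3} (shift 0 arc_stacks) (Push 7 1)) mem2 15 mem3"
      "length (mem3 0) \<le> length (mem2 0)" "set (mem3 0) \<subseteq> set (mem2 0)" "mem3 7 = [] \<Longrightarrow> mem2 7 = [] \<and> mem2 0 = 3 # mem3 0"
    proof (cases "peek (mem2 0) = 3")
      case True
      then obtain ys where y: "mem2 0 = 3 # ys" by (cases "mem2 0") auto
      let ?t = "moved 0 arc_stacks [3] ys mem2"
      have "runs (shift 0 arc_stacks) mem2 14 ?t" by (rule runs_shiftI[where x = 3]) (use y in auto)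
      then have "runs (Cond 0 {3} (shift 0 arc_stacks) (Push 7 1)) mem2 15 ?t"
        using True by (intro runs_weaken[OF runs_Cond[where n = 14]]) auto
      then show ?thesis by (rule that) (auto simp: moved_def y)
    next
      case False
      have "runs (Cond 0 {3} (shift 0 arc_stacks) (Push 7 1)) mem2 15 (mem2(7 := 1 # mem2 7))"
        using False runs_Push[of 7 1 mem2] by (intro runs_weaken[OF runs_Cond[where n = 1]]) auto
      then show ?thesis by (rule that) auto
    qed
    have "length (mem3 0) \<le> L" using 2(2) 3(2) less.prems z by simp
    then obtain mem4 where 4: "runs (read_word arc_stacks) mem3 (L * 15 + 4) mem4" "length (mem4 0) \<le> length (mem3 0)"
      "set (mem4 0) \<subseteq> set (mem3 0)" "mem4 7 = [] \<Longrightarrow> mem3 7 = [] \<and> (\<exists>n. mem3 0 = rev (bin n) @ mem4 0)"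
      using runs_read_word_any[of arc_stacks mem3 L] by auto
    let ?s5 = "mem4(11 := 1 # mem4 11)"
    have body: "runs read_arc mem (30 * L + 44) ?s5" unfolding read_arc_def
      by (rule runs_weaken[OF runs_Seq[OF 1 runs_Seq[OF 2(1) runs_Seq[OF 3(1) runs_Seq[OF 4(1) runs_Push]]]]]) auto
    have "length (?s5 0) < length (mem 0)" using 2(2) 3(2) 4(2) z by simp
    from less.hyps[of ?s5, OF this] this less.prems obtain mem' where
      5: "runs read_arcs ?s5 (length (?s5 0) * (30 * L + 45) + 1) mem'" "length (mem' 0) \<le> length (?s5 0)"
        "set (mem' 0) \<subseteq> set (?s5 0)" "mem' 7 = [] \<Longrightarrow> ?s5 7 = [] \<and> (\<exists>es. ?s5 0 = rev (arc_code es) @ mem' 0)"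
      by force
    have "peek (mem 0) \<in> {3}" using z by simp
    from runs_Loop_step[OF this body 5(1)[unfolded read_arcs_def]]
    have r: "runs read_arcs mem (length (mem 0) * (30 * L + 45) + 1) mem'"
      unfolding read_arcs_def
    proof (rule runs_weaken)
      have "length (?s5 0) \<le> length xs" using 2(2) 3(2) 4(2) by simp
      then have "length (?s5 0) * (30 * L + 45) \<le> length xs * (30 * L + 45)" by (intro mult_right_mono) auto
      then show "30 * L + 44 + (length (?s5 0) * (30 * L + 45) + 1) + 1 \<le> length (mem 0) * (30 * L + 45) + 1"
        unfolding z list.size mult_Suc by simp
    qed simp
    have "mem 7 = [] \<and> (\<exists>es. mem 0 = rev (arc_code es) @ mem' 0)" if "mem' 7 = []"
    proof -
      from 5(4)[OF that] obtain es where es: "mem4 7 = []" "mem4 0 = rev (arc_code es) @ mem' 0" by auto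
      from 4(4)[OF es(1)] obtain u where u: "mem3 7 = []" "mem3 0 = rev (bin u) @ mem4 0" by auto
      from 3(4)[OF u(1)] have w: "mem2 7 = []" "mem2 0 = 3 # mem3 0" by auto
      from 2(4)[OF w(1)] obtain v where v: "mem 7 = []" "xs = rev (bin v) @ mem2 0" by auto
      have "mem 0 = rev (arc_code (es @ [(u, v)])) @ mem' 0" using z v(2) u(2) w(2) es(2) by simp
      then show ?thesis using v(1) by blast
    qed
    moreover have "set (mem' 0) \<subseteq> set (mem 0)" using 2(3) 3(3) 4(3) 5(3) z by auto
    ultimately show ?thesis using r 2(2) 3(2) 4(2) 5(2) z by (intro exI[of _ mem']) auto
  qed
qed

section \<open>The lists that the reduction writes, as templates\<close>

definition lower_code :: "item list" where
  "lower_code = [Index, Word 6, Lit 2, Word 5, Lit 2]"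

definition upper_code :: "item list" where
  "upper_code = lower_code @ [Lit 2]"

text \<open>The vertex \<open>v\<close>, the \<open>i\<close>-th lower and the \<open>i\<close>-th upper copy of the arc \<open>(u, v)\<close> get the
  little-endian numerals \<open>v 2\<close>, \<open>i v 2 u 2\<close> and \<open>i v 2 u 2 2\<close> with \<open>u\<close>, \<open>v\<close> padded
  to \<open>k\<close> digits. In this way all lists come out in increasing order.\<close>

definition lower_vertices :: "item list" where
  "lower_vertices = lower_code @ [Lit 3]"
definition upper_vertices :: "item list" where
  "upper_vertices = upper_code @ [Lit 3]"
definition tail_arcs :: "item list" where
  "tail_arcs = [Word 5, Lit 2, Lit 3] @ upper_code @ [Lit 3]"
text \<open>Both arcs leaving a lower copy are written in the same round, since the lexicographic
  order groups arcs by their first vertex.\<close>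

definition head_arcs :: "item list" where
  "head_arcs = lower_code @ [Lit 3, Word 6, Lit 2, Lit 3] @ lower_code @ [Lit 3] @ upper_code @ [Lit 3]"

definition all_vals :: "nat \<Rightarrow> item list \<Rightarrow> (nat list \<times> nat list) list \<Rightarrow> nat list" where
  "all_vals k its es = concat (map (\<lambda>e. concat (map (vals k its e) [0..<k])) es)"

definition output_word :: "nat \<Rightarrow> nat list list \<Rightarrow> (nat list \<times> nat list) list \<Rightarrow> nat \<Rightarrow> nat list" where
  "output_word k vs es c = concat (map (\<lambda>v. pad k v @ [2, 3]) vs) @ all_vals k lower_vertices es @
     all_vals k upper_vertices es @ [4] @ all_vals k tail_arcs es @ all_vals k head_arcs es @ [4] @ bin c"

definition main :: com where
  "main = Seq count_loop (Seq binary_loop (Seq vertex_pass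
     (Seq (arc_pass 15 lower_vertices) (Seq (arc_pass 16 upper_vertices) (Seq (Push 0 4)
     (Seq (arc_pass 17 tail_arcs) (Seq (arc_pass 18 head_arcs) (Seq (Push 0 4)
     (Seq (move 13 {1, 2} [(0, id)]) (Seq (move 3 {1} []) (move 9 {1} [])))))))))))"

text \<open>The factor \<open>660 * k + 802\<close> is \<open>22 * (30 * k + 31) + 120\<close>,
  where 22 is the length of \<open>head_arcs\<close>, the longest template.\<close>

definition arc_time :: "nat \<Rightarrow> nat \<Rightarrow> nat" where
  "arc_time k m = m * ((660 * k + 802) * (k + 1)) + 1"

definition main_time :: "nat \<Rightarrow> nat \<Rightarrow> nat \<Rightarrow> nat \<Rightarrow> nat \<Rightarrow> nat" where
  "main_time k u n m c = (m * (40 * k + 15) + 1) + (c * (20 * c + 23) + 1) + (n * (140 * (k + 1)) + 1) +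
     4 * arc_time k m + (c * 9 + 1) + (k * 7 + 1) + (u * 7 + 1) + 20"

lemma runs_main:
  fixes vs es k u
  defines "c \<equiv> length vs + k * (length es + min u (length es))"
  assumes vs: "\<And>v. v \<in> set vs \<Longrightarrow> set v \<subseteq> {1, 2} \<and> length v \<le> k"
    and es: "\<And>u v w. (u, v) \<in> set es \<Longrightarrow> w \<in> {u, v} \<Longrightarrow> set w \<subseteq> {1, 2} \<and> length w \<le> k"
  shows "runs main ((\<lambda>_. [])(3 := replicate k 1, 9 := replicate u 1, 11 := replicate (length es) 1,
      12 := replicate (length vs) 1, 14 := vertex_words vs, 15 := arc_words es, 16 := arc_words es,
      17 := arc_words es, 18 := arc_words es))
    (main_time k u (length vs) (length es) c) ((\<lambda>_. [])(0 := rev (output_word k vs es c)))"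
proof -
  let ?n = "length vs" and ?m = "length es" and ?a = "arc_words es" and ?u = "replicate (u - length es) 1"
  define st :: "nat list \<Rightarrow> nat list \<Rightarrow> nat list \<Rightarrow> nat list \<Rightarrow> nat list \<Rightarrow> nat list \<Rightarrow> nat list \<Rightarrow> nat list \<Rightarrow> nat list \<Rightarrow> nat list \<Rightarrow> store"
    where "st a9 a11 a12 a13 a14 a15 a16 a17 a18 a0 = (\<lambda>_. [])(0 := a0, 3 := replicate k 1, 9 := a9, 11 := a11, 12 := a12,
      13 := a13, 14 := a14, 15 := a15, 16 := a16, 17 := a17, 18 := a18)"
      for a9 a11 a12 a13 a14 a15 a16 a17 a18 a0
  note st = st_def fun_eq_iff
  have its: "X \<in> {5, 6}" if "Word X \<in> set lower_vertices \<union> set upper_vertices \<union> set tail_arcs \<union> set head_arcs" for X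
    using that unfolding lower_vertices_def upper_vertices_def tail_arcs_def head_arcs_def lower_code_def upper_code_def
    by auto
  have len: "length lower_vertices \<le> 22" "length upper_vertices \<le> 22" "length tail_arcs \<le> 22" "length head_arcs \<le> 22"
    unfolding lower_vertices_def upper_vertices_def tail_arcs_def head_arcs_def lower_code_def upper_code_def by auto
  have tm: "?m * ((l * (30 * k + 31) + 120) * (k + 1)) + 1 \<le> arc_time k ?m" if "l \<le> 22" for l
  proof -
    have "l * (30 * k + 31) \<le> 22 * (30 * k + 31)" using that by (intro mult_right_mono) auto
    then have "l * (30 * k + 31) + 120 \<le> 660 * k + 802" by simp
    then show ?thesis unfolding arc_time_def
      by (intro add_right_mono mult_left_mono mult_right_mono) auto
  qed
  define w0 where "w0 = rev (concat (map (\<lambda>v. pad k v @ [2, 3]) vs))"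
  define w1 where "w1 = rev (all_vals k lower_vertices es) @ w0"
  define w2 where "w2 = rev (all_vals k upper_vertices es) @ w1"
  define w3 where "w3 = rev (all_vals k tail_arcs es) @ 4 # w2"
  define w4 where "w4 = rev (all_vals k head_arcs es) @ w3"
  have 1: "runs count_loop (st (replicate u 1) (replicate ?m 1) (replicate ?n 1) [] (vertex_words vs) ?a ?a ?a ?a [])
      (?m * (40 * k + 15) + 1) (st ?u [] (replicate c 1) [] (vertex_words vs) ?a ?a ?a ?a [])"
    by (rule runs_weaken[OF runs_count_loop[where k = k and u = u]]) (auto simp: st c_def)
  have 2: "runs binary_loop (st ?u [] (replicate c 1) [] (vertex_words vs) ?a ?a ?a ?a [])
      (c * (20 * c + 23) + 1) (st ?u [] [] (bin c) (vertex_words vs) ?a ?a ?a ?a [])"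
    by (rule runs_weaken[OF runs_binary_loop[where c = c]]) (auto simp: st)
  have 3: "runs vertex_pass (st ?u [] [] (bin c) (vertex_words vs) ?a ?a ?a ?a [])
      (?n * (140 * (k + 1)) + 1) (st ?u [] [] (bin c) [] ?a ?a ?a ?a w0)"
    by (rule runs_weaken[OF runs_vertex_pass[where k = k and vs = vs]]) (use vs in \<open>auto simp: st w0_def\<close>)
  have 4: "runs (arc_pass 15 lower_vertices) (st ?u [] [] (bin c) [] ?a ?a ?a ?a w0)
      (arc_time k ?m) (st ?u [] [] (bin c) [] [] ?a ?a ?a w1)"
    by (rule runs_weaken[OF runs_arc_pass[where k = k and es = es] tm[OF len(1)]])
      (use es its in \<open>auto simp: st w1_def all_vals_def\<close>)
  have 5: "runs (arc_pass 16 upper_vertices) (st ?u [] [] (bin c) [] [] ?a ?a ?a w1)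
      (arc_time k ?m) (st ?u [] [] (bin c) [] [] [] ?a ?a w2)"
    by (rule runs_weaken[OF runs_arc_pass[where k = k and es = es] tm[OF len(2)]])
      (use es its in \<open>auto simp: st w2_def all_vals_def\<close>)
  have 6: "runs (Push 0 4) (st ?u [] [] (bin c) [] [] [] ?a ?a w2) 1 (st ?u [] [] (bin c) [] [] [] ?a ?a (4 # w2))"
    by (rule runs_weaken[OF runs_Push]) (auto simp: st)
  have 7: "runs (arc_pass 17 tail_arcs) (st ?u [] [] (bin c) [] [] [] ?a ?a (4 # w2))
      (arc_time k ?m) (st ?u [] [] (bin c) [] [] [] [] ?a w3)"
    by (rule runs_weaken[OF runs_arc_pass[where k = k and es = es] tm[OF len(3)]])
      (use es its in \<open>auto simp: st w3_def all_vals_def\<close>)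
  have 8: "runs (arc_pass 18 head_arcs) (st ?u [] [] (bin c) [] [] [] [] ?a w3)
      (arc_time k ?m) (st ?u [] [] (bin c) [] [] [] [] [] w4)"
    by (rule runs_weaken[OF runs_arc_pass[where k = k and es = es] tm[OF len(4)]])
      (use es its in \<open>auto simp: st w4_def all_vals_def\<close>)
  have 9: "runs (Push 0 4) (st ?u [] [] (bin c) [] [] [] [] [] w4) 1 (st ?u [] [] (bin c) [] [] [] [] [] (4 # w4))"
    by (rule runs_weaken[OF runs_Push]) (auto simp: st)
  have 10: "runs (move 13 {1, 2} [(0, id)]) (st ?u [] [] (bin c) [] [] [] [] [] (4 # w4)) (c * 9 + 1)
     (st ?u [] [] [] [] [] [] [] [] (rev (bin c) @ 4 # w4))"
    by (rule runs_moveI[where xs = "bin c" and ys = "[]"])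
      (use set_bin[of c] length_bin_le[of c] in \<open>auto simp: moved_def st\<close>)
  have 11: "runs (move 3 {1} []) (st ?u [] [] [] [] [] [] [] [] (rev (bin c) @ 4 # w4)) (k * 7 + 1)
     ((\<lambda>_. [])(0 := rev (bin c) @ 4 # w4, 9 := ?u))"
    by (rule runs_moveI[where xs = "replicate k 1" and ys = "[]"]) (auto simp: moved_def st)
  have 12: "runs (move 9 {1} []) ((\<lambda>_. [])(0 := rev (bin c) @ 4 # w4, 9 := ?u)) (u * 7 + 1)
     ((\<lambda>_. [])(0 := rev (bin c) @ 4 # w4))"
    by (rule runs_moveI[where xs = "?u" and ys = "[]"]) (auto simp: moved_def fun_eq_iff)
  have start: "(\<lambda>_. [])(3 := replicate k 1, 9 := replicate u 1, 11 := replicate (length es) 1,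
      12 := replicate (length vs) 1, 14 := vertex_words vs, 15 := ?a, 16 := ?a, 17 := ?a, 18 := ?a)
    = st (replicate u 1) (replicate ?m 1) (replicate ?n 1) [] (vertex_words vs) ?a ?a ?a ?a []"
    by (auto simp: st)
  show ?thesis unfolding main_def start
    by (rule runs_weaken[OF runs_Seq[OF 1 runs_Seq[OF 2 runs_Seq[OF 3 runs_Seq[OF 4 runs_Seq[OF 5 runs_Seq[OF 6 runs_Seq[OF 7 runs_Seq[OF 8 runs_Seq[OF 9 runs_Seq[OF 10 runs_Seq[OF 11 12]]]]]]]]]]]])
      (auto simp: st main_time_def output_word_def w0_def w1_def w2_def w3_def w4_def)
qed

section \<open>Parsing, rejecting and the complete program\<close>

definition separator :: com where
  "separator = Cond 0 {4} (Pop 0) (Push 7 1)"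

text \<open>The end of the input lies on top of stack 0, so the bound is read first and the vertices
  last. A symbol left over after that is a format error as well.\<close>

definition parse :: com where
  "parse = Seq (read_word [(8, id)]) (Seq separator (Seq read_arcs (Seq separator
     (Seq read_vertices (Cond 0 {1, 2, 3, 4} (Push 7 1) Skip)))))"

lemma runs_separator: "mem 0 = 4 # xs \<Longrightarrow> mem(0 := xs) = \<tau> \<Longrightarrow> runs separator mem 2 \<tau>"
  unfolding separator_def using runs_Pop[of 0 mem] by (intro runs_weaken[OF runs_Cond[where n = 1]]) auto

lemma runs_separator_any:
  "\<exists>mem'. runs separator mem 2 mem' \<and> length (mem' 0) \<le> length (mem 0) \<and> set (mem' 0) \<subseteq> set (mem 0) \<and>
    (mem' 7 = [] \<longrightarrow> mem 7 = [] \<and> mem 0 = 4 # mem' 0)"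
proof (cases "peek (mem 0) = 4")
  case True
  then obtain xs where x: "mem 0 = 4 # xs" by (cases "mem 0") auto
  show ?thesis by (rule exI[of _ "mem(0 := xs)"]) (use x runs_separator[of mem xs, OF x refl] in auto)
next
  case False
  then have "runs separator mem 2 (mem(7 := 1 # mem 7))"
    unfolding separator_def using runs_Push[of 7 1 mem] by (intro runs_weaken[OF runs_Cond[where n = 1]]) auto
  then show ?thesis by (intro exI[of _ "mem(7 := 1 # mem 7)"]) auto
qed

lemma length_arc_code: "length es \<le> length (arc_code es)"
  by (induction es rule: rev_induct) auto

lemma length_vertex_code: "length vs \<le> length (vertex_code vs)"
  by (induction vs rule: rev_induct) auto

definition parse_time :: "nat \<Rightarrow> nat" where
  "parse_time L = (L * 9 + 4) + (L * (30 * L + 45) + 1) + (L * (9 * L + 20) + 1) + 11"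

lemma runs_parse:
  assumes "length (list_code vs es K) \<le> L"
  shows "runs parse ((\<lambda>_. [])(0 := rev (list_code vs es K), 3 := J)) (parse_time L)
    ((\<lambda>_. [])(3 := J, 8 := bin K, 10 := replicate (length vs) 1, 11 := replicate (length es) 1,
      14 := vertex_code vs, 15 := arc_code es, 16 := arc_code es, 17 := arc_code es, 18 := arc_code es))"
proof -
  let ?e = "arc_code es" and ?v = "vertex_code vs"
  define st where "st x k a b c d = ((\<lambda>_. [])(0 := x, 3 := J, 8 := k, 10 := a, 11 := b,
      14 := c, 15 := d, 16 := d, 17 := d, 18 := d) :: store)" for x k a b c d
  have w: "rev (list_code vs es K) = rev (bin K) @ 4 # rev ?e @ 4 # rev ?v" by (simp add: list_code_def)
  have l: "length (bin K) + length ?e + length ?v + 2 \<le> L" using assms by (simp add: list_code_def)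
  have m: "length es \<le> L" "length vs \<le> L" using l length_arc_code[of es] length_vertex_code[of vs] by auto
  have 1: "runs (read_word [(8, id)]) (st (rev (list_code vs es K)) [] [] [] [] []) (L * 9 + 4)
      (st (4 # rev ?e @ 4 # rev ?v) (bin K) [] [] [] [])"
    by (rule runs_read_bin[where n = K and ys = "4 # rev ?e @ 4 # rev ?v"])
      (use l in \<open>auto simp: w st_def moved_def fun_eq_iff\<close>)
  have 2: "runs separator (st (4 # rev ?e @ 4 # rev ?v) (bin K) [] [] [] []) 2
      (st (rev ?e @ 4 # rev ?v) (bin K) [] [] [] [])"
    by (rule runs_separator) (auto simp: st_def fun_eq_iff)
  have 3: "runs read_arcs (st (rev ?e @ 4 # rev ?v) (bin K) [] [] [] []) (L * (30 * L + 45) + 1)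
      (st (4 # rev ?v) (bin K) [] (replicate (length es) 1) [] ?e)"
    by (rule runs_weaken[OF runs_read_arcs[where es = es and ys = "4 # rev ?v" and L = L]])
      (use l m in \<open>auto simp: st_def fun_eq_iff\<close>)
  have 4: "runs separator (st (4 # rev ?v) (bin K) [] (replicate (length es) 1) [] ?e) 2
      (st (rev ?v) (bin K) [] (replicate (length es) 1) [] ?e)"
    by (rule runs_separator) (auto simp: st_def fun_eq_iff)
  let ?f = "st [] (bin K) (replicate (length vs) 1) (replicate (length es) 1) ?v ?e"
  have 5: "runs read_vertices (st (rev ?v) (bin K) [] (replicate (length es) 1) [] ?e) (L * (9 * L + 20) + 1) ?f"
    by (rule runs_weaken[OF runs_read_vertices[where vs = vs and ys = "[]" and L = L]])
      (use l m in \<open>auto simp: st_def fun_eq_iff\<close>)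
  have 6: "runs (Cond 0 {1, 2, 3, 4} (Push 7 1) Skip) ?f 2 ?f"
    using runs_Skip[of ?f] by (intro runs_weaken[OF runs_Cond[where n = 1]]) (auto simp: st_def)
  have e: "(\<lambda>_. [])(0 := rev (list_code vs es K), 3 := J) = st (rev (list_code vs es K)) [] [] [] [] []"
    by (auto simp: st_def fun_eq_iff)
  show ?thesis unfolding parse_def e
    by (rule runs_weaken[OF runs_Seq[OF 1 runs_Seq[OF 2 runs_Seq[OF 3 runs_Seq[OF 4 runs_Seq[OF 5 6]]]]]])
      (auto simp: parse_time_def st_def fun_eq_iff)
qed

lemma runs_parse_any:
  assumes "length (mem 0) \<le> L" "set (mem 0) \<subseteq> {1, 2, 3, 4}"
  shows "\<exists>mem'. runs parse mem (parse_time L) mem' \<and>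
    (mem' 7 = [] \<longrightarrow> (\<exists>vs es K. mem 0 = rev (list_code vs es K)))"
proof -
  obtain mem1 where 1: "runs (read_word [(8, id)]) mem (L * 9 + 4) mem1" "length (mem1 0) \<le> length (mem 0)"
    "set (mem1 0) \<subseteq> set (mem 0)" "mem1 7 = [] \<Longrightarrow> \<exists>n. mem 0 = rev (bin n) @ mem1 0"
    using runs_read_word_any[of "[(8, id)]" mem L] assms(1) by auto
  obtain mem2 where 2: "runs separator mem1 2 mem2" "length (mem2 0) \<le> length (mem1 0)"
    "set (mem2 0) \<subseteq> set (mem1 0)" "mem2 7 = [] \<Longrightarrow> mem1 7 = [] \<and> mem1 0 = 4 # mem2 0"
    using runs_separator_any[of mem1] by auto
  have l2: "length (mem2 0) \<le> L" using 1 2 assms(1) by linarith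
  obtain mem3 where 3: "runs read_arcs mem2 (length (mem2 0) * (30 * L + 45) + 1) mem3" "length (mem3 0) \<le> length (mem2 0)"
    "set (mem3 0) \<subseteq> set (mem2 0)" "mem3 7 = [] \<Longrightarrow> mem2 7 = [] \<and> (\<exists>es. mem2 0 = rev (arc_code es) @ mem3 0)"
    using runs_read_arcs_any[of mem2 L] l2 by auto
  obtain mem4 where 4: "runs separator mem3 2 mem4" "length (mem4 0) \<le> length (mem3 0)"
    "set (mem4 0) \<subseteq> set (mem3 0)" "mem4 7 = [] \<Longrightarrow> mem3 7 = [] \<and> mem3 0 = 4 # mem4 0"
    using runs_separator_any[of mem3] by auto
  have l4: "length (mem4 0) \<le> L" using l2 3(2) 4(2) by linarith
  obtain mem5 where 5: "runs read_vertices mem4 (length (mem4 0) * (9 * L + 20) + 1) mem5" "length (mem5 0) \<le> length (mem4 0)"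
    "set (mem5 0) \<subseteq> set (mem4 0)" "mem5 7 = [] \<Longrightarrow> mem4 7 = [] \<and> (\<exists>vs. mem4 0 = rev (vertex_code vs) @ mem5 0)"
    using runs_read_vertices_any[of mem4 L] l4 by auto
  obtain mem6 where 6: "runs (Cond 0 {1, 2, 3, 4} (Push 7 1) Skip) mem5 2 mem6" "mem6 7 = [] \<Longrightarrow> mem5 7 = [] \<and> mem5 0 = []"
  proof (cases "mem5 0")
    case Nil
    then have "runs (Cond 0 {1, 2, 3, 4} (Push 7 1) Skip) mem5 2 mem5"
      using runs_Skip[of mem5] by (intro runs_weaken[OF runs_Cond[where n = 1]]) auto
    then show ?thesis using that Nil by blast
  next
    case (Cons x xs)
    then have "x \<in> set (mem5 0)" by simp
    then have "x \<in> {1, 2, 3, 4}" using assms(2) 1(3) 2(3) 3(3) 4(3) 5(3) by blast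
    then have "runs (Cond 0 {1, 2, 3, 4} (Push 7 1) Skip) mem5 2 (mem5(7 := 1 # mem5 7))"
      using Cons runs_Push[of 7 1 mem5] by (intro runs_weaken[OF runs_Cond[where n = 1]]) auto
    then show ?thesis by (rule that) auto
  qed
  have "length (mem2 0) * (30 * L + 45) \<le> L * (30 * L + 45)" "length (mem4 0) * (9 * L + 20) \<le> L * (9 * L + 20)"
    using l2 l4 by (simp_all only: mult_le_mono1)
  then have r: "runs parse mem (parse_time L) mem6" unfolding parse_def
    by (intro runs_weaken[OF runs_Seq[OF 1(1) runs_Seq[OF 2(1) runs_Seq[OF 3(1) runs_Seq[OF 4(1) runs_Seq[OF 5(1) 6(1)]]]]]])
      (simp_all only: parse_time_def)
  have "\<exists>vs es K. mem 0 = rev (list_code vs es K)" if "mem6 7 = []"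
  proof -
    from 6(2)[OF that] have e5: "mem5 7 = []" "mem5 0 = []" by auto
    from 5(4)[OF e5(1)] obtain vs where e4: "mem4 7 = []" "mem4 0 = rev (vertex_code vs)" using e5 by auto
    from 4(4)[OF e4(1)] have e3: "mem3 7 = []" "mem3 0 = 4 # mem4 0" by auto
    from 3(4)[OF e3(1)] obtain es where e2: "mem2 7 = []" "mem2 0 = rev (arc_code es) @ mem3 0" by auto
    from 2(4)[OF e2(1)] have e1: "mem1 7 = []" "mem1 0 = 4 # mem2 0" by auto
    from 1(4)[OF e1(1)] obtain n where "mem 0 = rev (bin n) @ mem1 0" by auto
    then have "mem 0 = rev (list_code vs es n)" using e1 e2 e3 e4 by (simp add: list_code_def)
    then show ?thesis by blast
  qed
  then show ?thesis using r by blast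
qed

text \<open>Rejection must end with the empty output and, like every run, with all other stacks
  empty, although a failed parse leaves contents that are not known exactly.\<close>

primrec clear :: "nat \<Rightarrow> com" where
  "clear 0 = Skip"
| "clear (Suc n) = Seq (Loop n {1, 2, 3, 4} (Pop n)) (clear n)"

lemma runs_clear_one:
  "set (mem i) \<subseteq> {1, 2, 3, 4} \<Longrightarrow> runs (Loop i {1, 2, 3, 4} (Pop i)) mem (2 * length (mem i) + 1) (mem(i := []))"
proof (induction "mem i" arbitrary: mem)
  case Nil
  then show ?case by (intro runs_weaken[OF runs_Loop_exit]) (auto simp: fun_eq_iff)
next
  case (Cons x xs)
  let ?s = "mem(i := tl (mem i))"
  have xs: "xs = ?s i" using Cons.hyps(2) by (metis fun_upd_same list.sel(3))
  have s: "set (?s i) \<subseteq> {1, 2, 3, 4}" using Cons.prems unfolding xs[symmetric] Cons.hyps(2)[symmetric] by auto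
  have "peek (mem i) \<in> {1, 2, 3, 4}" using Cons.prems unfolding Cons.hyps(2)[symmetric] by auto
  from runs_Loop_step[OF this runs_Pop Cons.hyps(1)[of ?s, OF xs s]] show ?case
    by (rule runs_weaken) (auto simp: Cons.hyps(2)[symmetric])
qed

lemma runs_clear:
  assumes "\<And>i. set (mem i) \<subseteq> {1, 2, 3, 4}" "\<And>i. length (mem i) \<le> B"
  shows "runs (clear n) mem (n * (2 * B + 2) + 1) (\<lambda>i. if i < n then [] else mem i)"
  using assms
proof (induction n arbitrary: mem)
  case 0
  then show ?case using runs_Skip by simp
next
  case (Suc n)
  have 1: "runs (Loop n {1, 2, 3, 4} (Pop n)) mem (2 * B + 1) (mem(n := []))"
    by (rule runs_weaken[OF runs_clear_one]) (use Suc.prems in auto)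
  have 2: "runs (clear n) (mem(n := [])) (n * (2 * B + 2) + 1) (\<lambda>i. if i < n then [] else (mem(n := [])) i)"
    by (rule Suc.IH) (use Suc.prems in auto)
  show ?case unfolding clear.simps
    by (rule runs_weaken[OF runs_Seq[OF 1 2]]) (auto simp: fun_eq_iff)
qed

text \<open>For \<open>K = 0\<close> or \<open>K > n\<close> the new bound may still be admissible
  for the new graph, so the output would not reveal the defect and both cases are tested
  directly.\<close>

definition check_bound :: com where
  "check_bound = Seq (Cond 8 {1, 2} Skip (Push 7 1)) (Seq bound_loop (Cond 8 {1, 2} (Push 7 1) Skip))"

definition bound_time :: "nat \<Rightarrow> nat" where
  "bound_time L = L * (20 * L + 30) + 7"

lemma runs_check_bound:
  assumes "n \<le> L" "length (bin K) \<le> L"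
    and mem: "mem 10 = replicate n 1" "mem 12 = []" "mem 8 = bin K" "mem 9 = []" "mem 4 = []" "mem 7 = []"
  shows "runs check_bound mem (bound_time L) (mem(10 := [], 12 := replicate n 1, 8 := bin (K - n),
    9 := replicate (min n K) 1, 7 := replicate (if K = 0 \<or> n < K then 1 else 0) 1))"
proof -
  let ?f = "replicate (if K = 0 then 1 else 0) (1::nat)"
  let ?s1 = "mem(7 := ?f)"
  let ?s2 = "mem(10 := [], 12 := replicate n 1, 8 := bin (K - n), 9 := replicate (min n K) 1, 7 := ?f)"
  let ?s3 = "mem(10 := [], 12 := replicate n 1, 8 := bin (K - n),
    9 := replicate (min n K) 1, 7 := replicate (if K = 0 \<or> n < K then 1 else 0) 1)"
  have 1: "runs (Cond 8 {1, 2} Skip (Push 7 1)) mem 2 ?s1"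
  proof (cases "K = 0")
    case True
    have "runs (Push 7 1) mem 1 ?s1" by (rule runs_weaken[OF runs_Push]) (use True mem in auto)
    then show ?thesis using True mem by (intro runs_weaken[OF runs_Cond[where n = 1]]) auto
  next
    case False
    have "runs Skip mem 1 ?s1" by (rule runs_weaken[OF runs_Skip]) (use False mem in auto)
    then show ?thesis using False mem peek_bin[of K] by (intro runs_weaken[OF runs_Cond[where n = 1]]) auto
  qed
  have 2: "runs bound_loop ?s1 (n * (20 * L + 30) + 1) ?s2"
    by (rule runs_weaken[OF runs_bound_loop[where n = n and K = K and L = L]])
      (use assms in \<open>auto simp: fun_eq_iff\<close>)
  have 3: "runs (Cond 8 {1, 2} (Push 7 1) Skip) ?s2 2 ?s3"
  proof (cases "n < K")
    case True
    have "runs (Push 7 1) ?s2 1 ?s3" by (rule runs_weaken[OF runs_Push]) (use True mem in auto)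
    then show ?thesis using True mem peek_bin[of "K - n"] by (intro runs_weaken[OF runs_Cond[where n = 1]]) auto
  next
    case False
    have "runs Skip ?s2 1 ?s3" by (rule runs_weaken[OF runs_Skip]) (use False mem in auto)
    then show ?thesis using False mem by (intro runs_weaken[OF runs_Cond[where n = 1]]) auto
  qed
  have "n * (20 * L + 30) \<le> L * (20 * L + 30)" using assms(1) by (simp only: mult_le_mono1)
  then show ?thesis unfolding check_bound_def
    by (intro runs_weaken[OF runs_Seq[OF 1 runs_Seq[OF 2 3]]])
      (simp_all only: bound_time_def)
qed

text \<open>The first two moves carry the input to stack 1 and back, dropping a mark on stack 3 for
  every symbol each time. This restores the input and produces \<open>k\<close> in unary as twice
  its length.\<close>

definition program :: com where
  "program = Seq (move 0 {1, 2, 3, 4} [(1, id), (3, \<lambda>_. 1)]) (Seq (move 1 {1, 2, 3, 4} [(0, id), (3, \<lambda>_. 1)])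
     (Seq parse (Cond 7 {1, 2, 3, 4} (clear 19) (Seq check_bound (Cond 7 {1, 2, 3, 4} (clear 19) main)))))"

definition new_bound :: "nat \<Rightarrow> nat \<Rightarrow> nat \<Rightarrow> nat \<Rightarrow> nat" where
  "new_bound k n m K = n + k * (m + min K m)"

definition code_output :: "nat \<Rightarrow> nat list \<Rightarrow> (nat \<times> nat) list \<Rightarrow> nat \<Rightarrow> nat list" where
  "code_output k vs es K = output_word k (map bin vs) (map (\<lambda>(a, b). (bin a, bin b)) es)
     (new_bound k (length vs) (length es) K)"

definition is_instance :: "nat list \<Rightarrow> nat list \<times> (nat \<times> nat) list \<times> nat \<Rightarrow> bool" where
  "is_instance w p \<longleftrightarrow> (case p of (vs, es, K) \<Rightarrow> w = list_code vs es K \<and> 0 < K \<and> K \<le> length vs)"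

text \<open>The default \<open>[]\<close> is a word outside \<open>AHP_lang\<close>. Parsing is
  unique, so the choice operator merely names the decoded triple.\<close>

definition reduction :: "nat list \<Rightarrow> nat list" where
  "reduction w = (if \<exists>p. is_instance w p
     then (case SOME p. is_instance w p of (vs, es, K) \<Rightarrow> code_output (2 * length w) vs es K) else [])"

text \<open>The inner sum bounds the stack heights at the time of clearing: at most
  \<open>2 * L\<close> before parsing and at most one more per step.\<close>

definition clear_time :: "nat \<Rightarrow> nat" where
  "clear_time L = 19 * (2 * (2 * L + (parse_time L + bound_time L)) + 2) + 1"

definition program_time :: "nat \<Rightarrow> nat" where
  "program_time L = 2 * (L * 11 + 1) + parse_time L + bound_time L + clear_time L +
     main_time (2 * L) L L L (L + 2 * L * (L + L)) + 10"

lemma well_formed_pushes: "0 < R \<Longrightarrow> well_formed R (pushes ps) \<longleftrightarrow> (\<forall>(i, x) \<in> set ps. i < R \<and> 0 < x \<and> x < 5)"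
  by (induction ps) auto

lemma well_formed_shift:
  "well_formed R (shift X outs) \<longleftrightarrow> X < R \<and> (\<forall>(i, f) \<in> set outs. i < R \<and> (\<forall>x\<in>{1, 2, 3, 4}. 0 < f x \<and> f x < 5))"
proof (cases "X < R")
  case True
  then have "0 < R" by simp
  then show ?thesis using True
    by (simp add: shift_def shift_sym_def well_formed_pushes case_prod_beta) blast
qed (simp add: shift_def)

lemma well_formed_move: "well_formed R (move X S outs) \<longleftrightarrow> well_formed R (shift X outs)"
  by (auto simp: move_def shift_def)

lemma well_formed_clear: "n \<le> R \<Longrightarrow> 0 < R \<Longrightarrow> well_formed R (clear n)"
  by (induction n) auto

lemma well_formed_parse: "well_formed 19 parse"
  by (simp add: parse_def read_word_def separator_def read_arcs_def read_arc_def read_vertices_def read_vertex_def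
      well_formed_move well_formed_shift)

lemma well_formed_check_bound: "well_formed 19 check_bound"
  by (simp add: check_bound_def bound_loop_def decrement_def well_formed_move well_formed_shift)

lemma well_formed_main: "well_formed 19 main"
  by (simp add: main_def count_loop_def add_copies_def binary_loop_def increment_def vertex_pass_def
      arc_pass_def load_def lower_vertices_def upper_vertices_def tail_arcs_def head_arcs_def
      lower_code_def upper_code_def well_formed_move well_formed_shift)

lemma well_formed_program: "well_formed 19 program"
  by (simp add: program_def well_formed_parse well_formed_check_bound well_formed_main
      well_formed_clear well_formed_move well_formed_shift)

lemma runs_clear_all:
  assumes v: "valid_store 19 mem" and l: "\<And>i. length (mem i) \<le> 2 * L + (parse_time L + bound_time L)"
  shows "runs (clear 19) mem (clear_time L) (\<lambda>_. [])"
proof (rule runs_weaken[OF runs_clear])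
  show "set (mem i) \<subseteq> {1, 2, 3, 4}" for i
  proof
    fix x assume "x \<in> set (mem i)"
    then have "0 < x" "x < 5" using v by (auto simp: valid_store_def)
    then show "x \<in> {1, 2, 3, 4}" by auto
  qed
  show "length (mem i) \<le> 2 * L + (parse_time L + bound_time L)" for i by (rule l)
  show "(\<lambda>i. if i < 19 then [] else mem i) = (\<lambda>_. [])" using v by (auto simp: valid_store_def)
  show "19 * (2 * (2 * L + (parse_time L + bound_time L)) + 2) + 1 \<le> clear_time L" by (simp add: clear_time_def)
qed

lemma peek_valid: "valid_store R mem \<Longrightarrow> peek (mem i) \<in> {1, 2, 3, 4} \<longleftrightarrow> mem i \<noteq> []"
proof (cases "mem i")
  case (Cons x xs)
  assume "valid_store R mem"
  then have "0 < x" "x < 5" using Cons by (auto simp: valid_store_def dest!: spec[of _ i])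
  then show ?thesis using Cons by auto
qed simp

lemma length_bin_word: "w \<in> set vs \<Longrightarrow> length (bin w) \<le> length (vertex_code vs)"
  by (induction vs rule: rev_induct) (auto simp: vertex_code_def vertex_words_def)

lemma length_bin_arc: "(a, b) \<in> set es \<Longrightarrow> length (bin a) + length (bin b) \<le> length (arc_code es)"
  by (induction es rule: rev_induct) (auto simp: arc_code_def arc_words_def)

lemma main_time_mono:
  assumes "u \<le> L" "n \<le> L" "m \<le> L" "c \<le> c'"
  shows "main_time k u n m c \<le> main_time k L L L c'"
proof -
  have "arc_time k m \<le> arc_time k L" using assms unfolding arc_time_def by (intro add_right_mono mult_le_mono1)
  moreover have "m * (40 * k + 15) \<le> L * (40 * k + 15)" "n * (140 * (k + 1)) \<le> L * (140 * (k + 1))"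
    using assms by (auto intro!: mult_le_mono1)
  moreover have "c * (20 * c + 23) \<le> c' * (20 * c' + 23)" using assms by (intro mult_le_mono) auto
  ultimately show ?thesis using assms unfolding main_time_def by linarith
qed

lemma runs_program:
  assumes w: "w \<in> lists {1, 2, 3, 4}"
  shows "runs program (\<lambda>i. if i = 0 then rev w else []) (program_time (length w))
    (\<lambda>i. if i = 0 then rev (reduction w) else [])"
proof -
  define L where "L = length w"
  define J where "J = replicate (2 * L) (1::nat)"
  have sw: "set w \<subseteq> {1, 2, 3, 4}" using w by auto
  let ?s0 = "(\<lambda>i. if i = 0 then rev w else [])"
  let ?s1 = "(\<lambda>_. [])(0 := rev w, 3 := J)"
  have 1: "runs (move 0 {1, 2, 3, 4} [(1, id), (3, \<lambda>_. 1)]) ?s0 (L * 11 + 1)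
     ((\<lambda>_. [])(1 := w, 3 := replicate L 1))"
    by (rule runs_moveI[where xs = "rev w" and ys = "[]"])
      (use sw in \<open>auto simp: moved_def fun_eq_iff L_def map_replicate_const\<close>)
  have 2: "runs (move 1 {1, 2, 3, 4} [(0, id), (3, \<lambda>_. 1)]) ((\<lambda>_. [])(1 := w, 3 := replicate L 1)) (L * 11 + 1) ?s1"
    by (rule runs_moveI[where xs = "w" and ys = "[]"])
      (use sw in \<open>auto simp: moved_def fun_eq_iff L_def J_def map_replicate_const mult_2 replicate_add\<close>)
  have v1: "valid_store 19 ?s1" using sw by (auto simp: valid_store_def J_def)
  have l1: "length (?s1 i) \<le> 2 * L" for i by (simp add: J_def L_def)
  define rest where "rest = Cond 7 {1, 2, 3, 4} (clear 19) (Seq check_bound (Cond 7 {1, 2, 3, 4} (clear 19) main))"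
  have *: ?thesis if "runs (Seq parse rest) ?s1 (parse_time L + bound_time L + clear_time L +
     main_time (2 * L) L L L (L + 2 * L * (L + L)) + 6) (\<lambda>i. if i = 0 then rev (reduction w) else [])"
    unfolding program_def rest_def[symmetric]
    by (rule runs_weaken[OF runs_Seq[OF 1 runs_Seq[OF 2 that]]]) (auto simp: program_time_def L_def)
  show ?thesis
  proof (cases "\<exists>vs es K. w = list_code vs es K")
    case False
    then have r: "reduction w = []" by (auto simp: reduction_def is_instance_def)
    obtain mem where p: "runs parse ?s1 (parse_time L) mem" "mem 7 \<noteq> []"
      using runs_parse_any[of ?s1 L] False sw by (auto simp: L_def)
    note vl = runs_valid_store[OF v1 l1 well_formed_parse p(1)]
    then have "\<And>i. length (mem i) \<le> 2 * L + (parse_time L + bound_time L)" by (meson le_add1 add_left_mono le_trans)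
    then have "runs (clear 19) mem (clear_time L) (\<lambda>_. [])" using vl by (intro runs_clear_all) auto
    then have "runs rest mem (clear_time L + 1) (\<lambda>_. [])" unfolding rest_def
      using vl p(2) peek_valid[of 19 mem 7] by (intro runs_Cond) auto
    from runs_Seq[OF p(1) this] show ?thesis by (intro *) (erule runs_weaken, auto simp: r)
  next
    case True
    \<comment> \<open>The decoding is taken to be the very triple that \<open>reduction\<close>
      selects, whenever there is an instance at all; so the run and the specification speak of the
      same lists.\<close>
    then obtain vs es K where d: "w = list_code vs es K" and
      p: "(\<exists>q. is_instance w q) \<Longrightarrow> is_instance w (vs, es, K) \<and> (SOME q. is_instance w q) = (vs, es, K)"
    proof (cases "\<exists>q. is_instance w q")
      case True
      obtain vs es K where e: "(SOME q. is_instance w q) = (vs, es, K)" by (metis prod_cases3)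
      then have "is_instance w (vs, es, K)" using True by (metis someI_ex)
      then show ?thesis using that[of vs es K] e by (auto simp: is_instance_def)
    qed (use that in blast)
    let ?n = "length vs" and ?m = "length es"
    have l: "length (bin K) + length (arc_code es) + length (vertex_code vs) + 2 \<le> L"
      using d by (simp add: list_code_def L_def)
    have nm: "?m \<le> L" "?n \<le> L" using l length_arc_code[of es] length_vertex_code[of vs] by auto
    define mem where "mem = ((\<lambda>_. [])(3 := J, 8 := bin K, 10 := replicate ?n 1, 11 := replicate ?m 1,
      14 := vertex_code vs, 15 := arc_code es, 16 := arc_code es, 17 := arc_code es, 18 := arc_code es) :: store)"
    have p1: "runs parse ?s1 (parse_time L) mem"
      using runs_parse[of vs es K L J] d by (simp add: L_def mem_def)
    have v2: "valid_store 19 mem" using runs_valid_store[OF v1 l1 well_formed_parse p1] by blast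
    have l2: "length (mem i) \<le> 2 * L" for i using l nm by (simp add: mem_def J_def)
    define \<tau> where "\<tau> = mem(10 := [], 12 := replicate ?n 1, 8 := bin (K - ?n),
      9 := replicate (min ?n K) 1, 7 := replicate (if K = 0 \<or> ?n < K then 1 else 0) 1)"
    have p2: "runs check_bound mem (bound_time L) \<tau>" unfolding \<tau>_def
      by (rule runs_check_bound) (use nm l in \<open>auto simp: mem_def\<close>)
    note v3 = runs_valid_store[OF v2 l2 well_formed_check_bound p2]
    let ?f = "\<lambda>i. if i = 0 then rev (reduction w) else []"
    have "runs (Cond 7 {1, 2, 3, 4} (clear 19) main) \<tau> (clear_time L + main_time (2 * L) L L L (L + 2 * L * (L + L)) + 1) ?f"
    proof (cases "0 < K \<and> K \<le> ?n")
      case False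
      have "\<not> (\<exists>q. is_instance w q)" using p False by (auto simp: is_instance_def)
      then have r: "reduction w = []" by (simp add: reduction_def)
      have "\<And>i. length (\<tau> i) \<le> 2 * L + (parse_time L + bound_time L)"
        using v3 by (meson le_add2 add_left_mono le_trans)
      then have "runs (clear 19) \<tau> (clear_time L) (\<lambda>_. [])" using v3 by (intro runs_clear_all) auto
      moreover have "\<tau> 7 \<noteq> []" using False by (simp add: \<tau>_def not_le)
      moreover have f: "?f = (\<lambda>_. [])" by (auto simp: r)
      ultimately show ?thesis unfolding f
        using v3 peek_valid[of 19 \<tau> 7] by (intro runs_weaken[OF runs_Cond[where n = "clear_time L"]]) auto
    next
      case True
      then have "is_instance w (vs, es, K)" using d by (simp add: is_instance_def)
      then have r: "reduction w = code_output (2 * L) vs es K"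
        using p by (auto simp: reduction_def L_def)
      have t: "\<tau> 7 = []" using True by (simp add: \<tau>_def)
      have m: "min ?n K = K" "K - ?n = 0" using True by auto
      define ws where "ws = map bin vs"
      define fs where "fs = map (\<lambda>(a, b). (bin a, bin b)) es"
      have e: "\<tau> = (\<lambda>_. [])(3 := replicate (2 * L) 1, 9 := replicate K 1, 11 := replicate (length fs) 1,
         12 := replicate (length ws) 1, 14 := vertex_words ws, 15 := arc_words fs, 16 := arc_words fs,
         17 := arc_words fs, 18 := arc_words fs)"
        using True m by (auto simp: \<tau>_def mem_def fun_eq_iff J_def ws_def fs_def vertex_code_def arc_code_def)
      have "set v \<subseteq> {1, 2} \<and> length v \<le> 2 * L" if "v \<in> set ws" for v
        using that length_bin_word l set_bin unfolding ws_def by fastforce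
      moreover have "set x \<subseteq> {1, 2} \<and> length x \<le> 2 * L" if "(u, v) \<in> set fs" "x \<in> {u, v}" for u v x
      proof -
        from that(1) obtain a b where "(a, b) \<in> set es" "u = bin a" "v = bin b" by (auto simp: fs_def)
        then show ?thesis using that(2) length_bin_arc[of a b es] l set_bin[of a] set_bin[of b] by auto
      qed
      ultimately have "runs main \<tau> (main_time (2 * L) K (length ws) (length fs) (length ws + 2 * L * (length fs + min K (length fs))))
        ((\<lambda>_. [])(0 := rev (output_word (2 * L) ws fs (length ws + 2 * L * (length fs + min K (length fs))))))"
        unfolding e by (intro runs_main) auto
      moreover have "(\<lambda>_. [])(0 := rev (output_word (2 * L) ws fs (length ws + 2 * L * (length fs + min K (length fs))))) = ?f"
        by (auto simp: r code_output_def new_bound_def ws_def fs_def)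
      moreover have "main_time (2 * L) K (length ws) (length fs) (length ws + 2 * L * (length fs + min K (length fs)))
         \<le> main_time (2 * L) L L L (L + 2 * L * (L + L))"
        using nm True by (intro main_time_mono add_mono mult_left_mono) (auto simp: ws_def fs_def)
      ultimately have "runs main \<tau> (clear_time L + main_time (2 * L) L L L (L + 2 * L * (L + L))) ?f"
        by (auto intro: runs_weaken)
      then show ?thesis using t by (intro runs_Cond) auto
    qed
    from runs_Seq[OF p2 this] have "runs rest mem (bound_time L + (clear_time L + main_time (2 * L) L L L (L + 2 * L * (L + L)) + 1) + 1 + 1) ?f"
      unfolding rest_def by (intro runs_Cond) (simp add: mem_def)
    from runs_Seq[OF p1 this] show ?thesis by (intro *) (erule runs_weaken, auto)
  qed
qed

subsection \<open>Polynomial bounds\<close>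

text \<open>With the base \<open>n + 1\<close> powers grow with the exponent even at
  \<open>n = 0\<close>, so a single constant can serve as factor and exponent and be enlarged
  freely. \<open>poly_bounded_monomial\<close> returns to the base \<open>n\<close>, where the added
  constant covers \<open>n = 0\<close>.\<close>

definition poly_bounded :: "(nat \<Rightarrow> nat) \<Rightarrow> bool" where
  "poly_bounded f \<longleftrightarrow> (\<exists>c. \<forall>n. f n \<le> c * (n + 1) ^ c)"

lemma poly_bounded_const: "poly_bounded (\<lambda>_. a)"
  unfolding poly_bounded_def by (intro exI[of _ a]) simp

lemma poly_bounded_id: "poly_bounded (\<lambda>n. n)"
  unfolding poly_bounded_def by (intro exI[of _ 1]) simp

lemma poly_bounded_add:
  assumes "poly_bounded f" "poly_bounded g"
  shows "poly_bounded (\<lambda>n. f n + g n)"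
proof -
  obtain a b where a: "\<And>n. f n \<le> a * (n + 1) ^ a" and b: "\<And>n. g n \<le> b * (n + 1) ^ b"
    using assms unfolding poly_bounded_def by blast
  have "f n + g n \<le> (a + b) * (n + 1) ^ (a + b)" for n
  proof -
    have "a * (n + 1) ^ a \<le> a * (n + 1) ^ (a + b)" "b * (n + 1) ^ b \<le> b * (n + 1) ^ (a + b)"
      by (auto intro!: mult_left_mono power_increasing)
    then show ?thesis using a[of n] b[of n] unfolding add_mult_distrib by linarith
  qed
  then show ?thesis unfolding poly_bounded_def by blast
qed

lemma poly_bounded_mult:
  assumes "poly_bounded f" "poly_bounded g"
  shows "poly_bounded (\<lambda>n. f n * g n)"
proof -
  obtain a b where a: "\<And>n. f n \<le> a * (n + 1) ^ a" and b: "\<And>n. g n \<le> b * (n + 1) ^ b"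
    using assms unfolding poly_bounded_def by blast
  have "f n * g n \<le> (a * b + a + b) * (n + 1) ^ (a * b + a + b)" for n
  proof -
    have "f n * g n \<le> (a * (n + 1) ^ a) * (b * (n + 1) ^ b)" using a b by (intro mult_mono) auto
    also have "\<dots> = (a * b) * (n + 1) ^ (a + b)" by (simp only: power_add mult_ac)
    also have "\<dots> \<le> (a * b + a + b) * (n + 1) ^ (a * b + a + b)"
      by (intro mult_mono power_increasing) auto
    finally show ?thesis .
  qed
  then show ?thesis unfolding poly_bounded_def by blast
qed

lemma poly_bounded_monomial:
  assumes "poly_bounded f"
  shows "\<exists>c. \<forall>n. f n \<le> c * n ^ c + c"
proof -
  obtain a where a: "\<And>n. f n \<le> a * (n + 1) ^ a" using assms unfolding poly_bounded_def by blast
  let ?c = "a * 2 ^ a + a"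
  have "f n \<le> ?c * n ^ ?c + ?c" for n
  proof (cases "n = 0")
    case True
    then show ?thesis using a[of n] by simp
  next
    case False
    have "f n \<le> a * (n + 1) ^ a" by (rule a)
    also have "\<dots> \<le> a * (2 * n) ^ a" using False by (intro mult_left_mono power_mono) auto
    also have "\<dots> = (a * 2 ^ a) * n ^ a" by (simp add: power_mult_distrib)
    also have "\<dots> \<le> ?c * n ^ ?c" using False by (intro mult_mono power_increasing) auto
    finally show ?thesis by simp
  qed
  then show ?thesis by blast
qed

lemmas poly_bounded_intros = poly_bounded_const poly_bounded_id poly_bounded_add poly_bounded_mult

lemma poly_bounded_program_time: "poly_bounded program_time"
  unfolding program_time_def[abs_def] clear_time_def main_time_def arc_time_def parse_time_def bound_time_def
  by (intro poly_bounded_intros)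

theorem reduction_poly_time:
  "\<exists>M c. wf_tm M \<and> (\<forall>w \<in> lists {1, 2, 3, 4}. \<exists>k \<le> c * length w ^ c + c.
     fst ((tm_step M ^^ k) (tm_init w)) = 1 \<and> tm_output ((tm_step M ^^ k) (tm_init w)) = reduction w)"
proof -
  have "poly_bounded (\<lambda>n. program_time n * (2 * (n + program_time n) + 4) + 3)"
    by (intro poly_bounded_intros poly_bounded_program_time)
  from poly_bounded_monomial[OF this] obtain c where
    c: "\<And>n. program_time n * (2 * (n + program_time n) + 4) + 3 \<le> c * n ^ c + c" by blast
  from stack_program_to_tm[OF well_formed_program runs_program]
  show ?thesis using c le_trans by meson
qed

section \<open>The reduction on graphs\<close>

text \<open>A closed walk of minimal positive length repeats no vertex, since the stretch between
  two equal vertices would be a shorter closed walk.\<close>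

lemma dicycle_if_trancl_refl:
  assumes "(x, x) \<in> R\<^sup>+"
  shows "\<exists>cs. is_dicycle R cs"
proof -
  define P where "P n \<longleftrightarrow> 0 < n \<and> (\<exists>x. (x, x) \<in> R ^^ n)" for n
  have "\<exists>n. P n" using assms unfolding P_def by (auto simp: trancl_power)
  then obtain n where n: "P n" "\<And>m. m < n \<Longrightarrow> \<not> P m" using exists_least_iff[of P] by blast
  then obtain y f where f: "f 0 = y" "f n = y" "\<And>i. i < n \<Longrightarrow> (f i, f (Suc i)) \<in> R" and n0: "0 < n"
    unfolding P_def relpow_fun_conv by blast
  have "f i \<noteq> f j" if "i < j" "j < n" for i j
  proof
    assume e: "f i = f j"
    have "(f i, f j) \<in> R ^^ (j - i)"
      unfolding relpow_fun_conv by (rule exI[of _ "\<lambda>l. f (i + l)"]) (use f(3) that in auto)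
    then have "P (j - i)" using e that by (auto simp: P_def)
    then show False using n(2)[of "j - i"] that by simp
  qed
  then have "inj_on f {0..<n}" unfolding inj_on_def by (metis atLeastLessThan_iff linorder_neqE_nat)
  moreover have "(f i, f (Suc i mod n)) \<in> R" if "i < n" for i
  proof (cases "Suc i = n")
    case True
    then show ?thesis using f(3)[OF that] f(1,2) by simp
  qed (use f(3)[OF that] that in simp)
  ultimately have "is_dicycle R (map f [0..<n])"
    using n0 by (auto simp: is_dicycle_def distinct_map)
  then show ?thesis ..
qed

text \<open>A map sending each arc of a cycle to a walk sends the cycle to a closed walk. It is
  applied to ranks, to refute cycles, and to the parts of a partition, to carry a cycle into the
  quotient.\<close>

lemma trancl_refl_along_dicycle:
  assumes "is_dicycle E cs" "\<And>u v. (u, v) \<in> cycle_arcs cs \<Longrightarrow> (g u, g v) \<in> R\<^sup>+"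
  shows "(g (cs ! 0), g (cs ! 0)) \<in> R\<^sup>+"
proof -
  have n0: "0 < length cs" using assms(1) by (simp add: is_dicycle_def)
  have arc: "(g (cs ! i), g (cs ! ((i + 1) mod length cs))) \<in> R\<^sup>+" if "i < length cs" for i
    using that by (intro assms(2)) (auto simp: cycle_arcs_def)
  have "(g (cs ! 0), g (cs ! i)) \<in> R\<^sup>*" if "i < length cs" for i
    using that
  proof (induction i)
    case (Suc i)
    then show ?case using arc[of i] by (simp add: rtrancl_trans trancl_into_rtrancl)
  qed simp
  from this[of "length cs - 1"] arc[of "length cs - 1"] n0 show ?thesis
    by (simp add: rtrancl_trancl_trancl)
qed

lemma no_dicycle_if_ranked:
  assumes "\<And>x y. (x, y) \<in> E \<Longrightarrow> (f x :: nat) < f y"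
  shows "\<not> (\<exists>cs. is_dicycle E cs)"
proof
  assume "\<exists>cs. is_dicycle E cs"
  then obtain cs where cs: "is_dicycle E cs" ..
  have "(f (cs ! 0), f (cs ! 0)) \<in> {(x, y). x < y}\<^sup>+"
  proof (rule trancl_refl_along_dicycle[OF cs])
    fix u v assume "(u, v) \<in> cycle_arcs cs"
    then have "(u, v) \<in> E" using cs unfolding cycle_arcs_def is_dicycle_def by blast
    from assms[OF this] show "(f u, f v) \<in> {(x, y). x < y}\<^sup>+" by blast
  qed
  moreover have "{(x, y). x < y}\<^sup>+ = {(x, y). x < (y :: nat)}" by (intro trancl_id transI) auto
  ultimately show False by simp
qed

text \<open>The number of proper ancestors is a rank: along an arc from \<open>u\<close> to
  \<open>v\<close> all ancestors are kept and \<open>u\<close> itself is added, which is not its own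
  ancestor when there is no cycle.\<close>

lemma rank_if_no_dicycle:
  assumes "finite E" "\<not> (\<exists>cs. is_dicycle E cs)"
  obtains t :: "'a \<Rightarrow> nat" where "\<And>u v. (u, v) \<in> E \<Longrightarrow> t u < t v"
proof
  fix u v assume uv: "(u, v) \<in> E"
  have fin: "finite {x. (x, y) \<in> E\<^sup>+}" for y
  proof -
    have "finite (Domain (E\<^sup>+))" using assms(1) by (simp add: trancl_domain finite_Domain)
    moreover have "{x. (x, y) \<in> E\<^sup>+} \<subseteq> Domain (E\<^sup>+)" by blast
    ultimately show ?thesis by (rule rev_finite_subset)
  qed
  have "{x. (x, u) \<in> E\<^sup>+} \<subset> {x. (x, v) \<in> E\<^sup>+}"
  proof
    show "{x. (x, u) \<in> E\<^sup>+} \<subseteq> {x. (x, v) \<in> E\<^sup>+}" using uv by (auto intro: trancl_into_trancl)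
    have "u \<notin> {x. (x, u) \<in> E\<^sup>+}" using assms(2) dicycle_if_trancl_refl[of u E] by blast
    moreover have "u \<in> {x. (x, v) \<in> E\<^sup>+}" using uv by blast
    ultimately show "{x. (x, u) \<in> E\<^sup>+} \<noteq> {x. (x, v) \<in> E\<^sup>+}" by blast
  qed
  then show "card {x. (x, u) \<in> E\<^sup>+} < card {x. (x, v) \<in> E\<^sup>+}" using fin psubset_card_mono by blast
qed

lemma quotient_arcsI:
  "P \<in> \<pi> \<Longrightarrow> Q \<in> \<pi> \<Longrightarrow> P \<noteq> Q \<Longrightarrow> u \<in> P \<Longrightarrow> v \<in> Q \<Longrightarrow> (u, v) \<in> R \<Longrightarrow> (P, Q) \<in> quotient_arcs R \<pi>"
  unfolding quotient_arcs_def by blast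

text \<open>Vertex names are abstract injections with disjoint ranges, which keeps the graph
  argument free of numerals; \<open>node\<close>, \<open>lower\<close> and \<open>upper\<close>
  instantiate them later.\<close>

locale arc_gadget =
  fixes V :: "'a set" and E :: "('a \<times> 'a) set" and k :: nat
    and N :: "'a \<Rightarrow> 'b" and A B :: "'a \<times> 'a \<Rightarrow> nat \<Rightarrow> 'b"
  assumes finV: "finite V" and EV: "E \<subseteq> V \<times> V"
    and N_inj: "\<And>u v. u \<in> V \<Longrightarrow> v \<in> V \<Longrightarrow> N u = N v \<Longrightarrow> u = v"
    and A_inj: "\<And>d e i j. d \<in> E \<Longrightarrow> e \<in> E \<Longrightarrow> i < k \<Longrightarrow> j < k \<Longrightarrow> A d i = A e j \<Longrightarrow> d = e \<and> i = j"
    and B_inj: "\<And>d e i j. d \<in> E \<Longrightarrow> e \<in> E \<Longrightarrow> i < k \<Longrightarrow> j < k \<Longrightarrow> B d i = B e j \<Longrightarrow> d = e \<and> i = j"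
    and NA: "\<And>v e i. v \<in> V \<Longrightarrow> e \<in> E \<Longrightarrow> i < k \<Longrightarrow> N v \<noteq> A e i"
    and NB: "\<And>v e i. v \<in> V \<Longrightarrow> e \<in> E \<Longrightarrow> i < k \<Longrightarrow> N v \<noteq> B e i"
    and AB: "\<And>d e i j. d \<in> E \<Longrightarrow> e \<in> E \<Longrightarrow> i < k \<Longrightarrow> j < k \<Longrightarrow> A d i \<noteq> B e j"
begin

definition VN where "VN = N ` V"
definition VA where "VA = (\<lambda>(e, i). A e i) ` (E \<times> {..<k})"
definition VB where "VB = (\<lambda>(e, i). B e i) ` (E \<times> {..<k})"
definition new_vertices where "new_vertices = VN \<union> VA \<union> VB"

definition new_arcs where
  "new_arcs = {(N (fst e), B e i) | e i. e \<in> E \<and> i < k} \<union> {(A e i, N (snd e)) | e i. e \<in> E \<and> i < k} \<union>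
    {(A e i, B e i) | e i. e \<in> E \<and> i < k}"

lemma finE: "finite E"
  using finV EV finite_subset by blast

lemma ends_in_V: "e \<in> E \<Longrightarrow> fst e \<in> V \<and> snd e \<in> V"
  using EV by auto

lemma disjoint: "VN \<inter> VA = {}" "VN \<inter> VB = {}" "VA \<inter> VB = {}"
  using NA NB AB by (auto simp: VN_def VA_def VB_def)

lemma in_parts: "e \<in> E \<Longrightarrow> i < k \<Longrightarrow> A e i \<in> VA" "e \<in> E \<Longrightarrow> i < k \<Longrightarrow> B e i \<in> VB"
  by (auto simp: VA_def VB_def)

lemma not_in_VN: "e \<in> E \<Longrightarrow> i < k \<Longrightarrow> A e i \<notin> VN" "e \<in> E \<Longrightarrow> i < k \<Longrightarrow> B e i \<notin> VN"
  using in_parts[of e i] disjoint(1,2) by auto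

lemma card_parts: "card VN = card V" "card VA = card E * k" "card VB = card E * k"
proof -
  show "card VN = card V" unfolding VN_def by (rule card_image) (auto simp: inj_on_def N_inj)
  have "inj_on (\<lambda>(e, i). A e i) (E \<times> {..<k})" by (rule inj_onI) (use A_inj in force)
  then show "card VA = card E * k" unfolding VA_def by (simp add: card_image card_cartesian_product)
  have "inj_on (\<lambda>(e, i). B e i) (E \<times> {..<k})" by (rule inj_onI) (use B_inj in force)
  then show "card VB = card E * k" unfolding VB_def by (simp add: card_image card_cartesian_product)
qed

lemma finite_parts: "finite VN" "finite VA" "finite VB"
  using finV finE by (auto simp: VN_def VA_def VB_def)

lemma card_new_vertices: "card new_vertices = card V + 2 * (card E * k)"
  using disjoint finite_parts card_parts unfolding new_vertices_def
  by (simp add: card_Un_disjoint Int_Un_distrib2)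

text \<open>All arcs go upwards from lower copies over nodes to upper copies. This gives acyclicity
  and also the limit of three vertices per path.\<close>

definition level :: "'b \<Rightarrow> nat" where
  "level x = (if x \<in> VA then 0 else if x \<in> VN then 1 else 2)"

lemma level_simps:
  "x \<in> VA \<Longrightarrow> level x = 0" "x \<in> VN \<Longrightarrow> level x = 1" "x \<in> VB \<Longrightarrow> level x = 2"
  using disjoint by (auto simp: level_def)

lemma new_arcs_cases:
  assumes "(x, y) \<in> new_arcs"
  obtains e i where "e \<in> E" "i < k" "x = N (fst e)" "y = B e i" "x \<in> VN" "y \<in> VB"
    | e i where "e \<in> E" "i < k" "x = A e i" "y = N (snd e)" "x \<in> VA" "y \<in> VN"
    | e i where "e \<in> E" "i < k" "x = A e i" "y = B e i" "x \<in> VA" "y \<in> VB"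
  using assms ends_in_V unfolding new_arcs_def VN_def VA_def VB_def by fastforce

lemma level_less: "(x, y) \<in> new_arcs \<Longrightarrow> level x < level y"
  by (erule new_arcs_cases) (simp_all add: level_simps)

lemma new_dag: "is_dag new_vertices new_arcs"
proof -
  have "new_arcs \<subseteq> new_vertices \<times> new_vertices"
    unfolding new_vertices_def by (auto elim: new_arcs_cases)
  moreover have "finite new_vertices" using finite_parts by (simp add: new_vertices_def)
  ultimately show ?thesis
    using no_dicycle_if_ranked[of new_arcs level, OF level_less] by (simp add: is_dag_def digraph_def)
qed

section \<open>From a feedback arc set to a partition\<close>

definition pairs :: "('a \<times> 'a) set \<Rightarrow> 'b set set" where
  "pairs D = (\<lambda>(e, i). {A e i, B e i}) ` (D \<times> {..<k})"

definition removal_partition :: "('a \<times> 'a) set \<Rightarrow> 'b set set" where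
  "removal_partition F = (\<lambda>x. {x}) ` VN \<union> pairs (E - F) \<union>
     (\<lambda>(e, i). {A e i}) ` (F \<times> {..<k}) \<union> (\<lambda>(e, i). {B e i}) ` (F \<times> {..<k})"

text \<open>A kept arc contributes \<open>k\<close> pairs and a removed arc \<open>2 k\<close>
  singletons; with \<open>f\<close> of \<open>m\<close> arcs removed,
  \<open>(m - f) + 2 f = m + f\<close>.\<close>

lemma card_removal_partition:
  assumes "F \<subseteq> E"
  shows "card (removal_partition F) \<le> card V + k * (card E + card F)"
proof -
  have fF: "finite F" using assms finE finite_subset by blast
  have "card (removal_partition F) \<le> card V + card (E - F) * k + card F * k + card F * k"
    unfolding removal_partition_def pairs_def
    by (intro card_Un_le[THEN order.trans] add_mono card_image_le[THEN order.trans])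
      (use fF finE finite_parts card_parts in \<open>auto simp: card_cartesian_product\<close>)
  also have "card E = card (E - F) + card F"
    using assms fF by (simp add: card_Diff_subset card_mono finE)
  ultimately show ?thesis by (simp add: algebra_simps)
qed

lemma removal_partition_cases:
  assumes "P \<in> removal_partition F"
  obtains v where "v \<in> V" "P = {N v}"
    | e i where "e \<in> E - F" "i < k" "P = {A e i, B e i}"
    | e i where "e \<in> F" "i < k" "P = {A e i}"
    | e i where "e \<in> F" "i < k" "P = {B e i}"
  using assms unfolding removal_partition_def pairs_def VN_def by fastforce

lemma part_of_N:
  assumes "F \<subseteq> E" "P \<in> removal_partition F" "N v \<in> P" "v \<in> V"
  shows "P = {N v}"
  using assms(2)
proof (cases rule: removal_partition_cases)
  case (2 e i)
  then show ?thesis using NA[of v e i] NB[of v e i] assms by auto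
next
  case (3 e i)
  then show ?thesis using NA[of v e i] assms by auto
next
  case (4 e i)
  then show ?thesis using NB[of v e i] assms by auto
qed (use assms in auto)

lemma part_of_A:
  assumes "F \<subseteq> E" "P \<in> removal_partition F" "A e i \<in> P" "e \<in> E" "i < k"
  shows "P = (if e \<in> F then {A e i} else {A e i, B e i})"
  using assms(2)
proof (cases rule: removal_partition_cases)
  case (1 v)
  then show ?thesis using NA[of v e i] assms by auto
next
  case (2 d j)
  then have "A e i = A d j" using AB[of e d i j] assms by auto
  then have "d = e \<and> j = i" using A_inj[of e d i j] 2 assms by auto
  then show ?thesis using 2 by auto
next
  case (3 d j)
  then have "d = e \<and> j = i" using A_inj[of e d i j] assms by auto
  then show ?thesis using 3 by auto
next
  case (4 d j)
  then show ?thesis using AB[of e d i j] assms by auto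
qed

lemma part_of_B:
  assumes "F \<subseteq> E" "P \<in> removal_partition F" "B e i \<in> P" "e \<in> E" "i < k"
  shows "P = (if e \<in> F then {B e i} else {A e i, B e i})"
  using assms(2)
proof (cases rule: removal_partition_cases)
  case (1 v)
  then show ?thesis using NB[of v e i] assms by auto
next
  case (2 d j)
  then have "B e i = B d j" using AB[of d e j i] assms by auto
  then have "d = e \<and> j = i" using B_inj[of e d i j] 2 assms by auto
  then show ?thesis using 2 by auto
next
  case (3 d j)
  then show ?thesis using AB[of d e j i] assms by auto
next
  case (4 d j)
  then have "d = e \<and> j = i" using B_inj[of e d i j] assms by auto
  then show ?thesis using 4 by auto
qed

lemma removal_H_partition:
  assumes F: "F \<subseteq> E"
  shows "H_partition new_vertices new_arcs (removal_partition F)"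
  unfolding H_partition_def is_partition_def
proof (intro conjI ballI impI)
  show "P \<noteq> {}" if "P \<in> removal_partition F" for P
    using that by (cases rule: removal_partition_cases) auto
  show "\<Union> (removal_partition F) = new_vertices"
  proof (intro equalityI subsetI)
    show "x \<in> new_vertices" if "x \<in> \<Union> (removal_partition F)" for x
      using that F unfolding new_vertices_def removal_partition_def pairs_def VN_def VA_def VB_def by auto
    fix x assume "x \<in> new_vertices"
    then consider "x \<in> VN" | e i where "e \<in> E" "i < k" "x = A e i \<or> x = B e i"
      unfolding new_vertices_def VA_def VB_def by auto
    then show "x \<in> \<Union> (removal_partition F)"
    proof cases
      case (2 e i)
      show ?thesis
      proof (cases "e \<in> F")
        case True
        then have "{A e i} \<in> removal_partition F" "{B e i} \<in> removal_partition F"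
          using 2(2) by (auto simp: removal_partition_def)
        then show ?thesis using 2(3) by blast
      next
        case False
        then have "{A e i, B e i} \<in> removal_partition F"
          using 2(1,2) by (auto simp: removal_partition_def pairs_def)
        then show ?thesis using 2(3) by blast
      qed
    qed (auto simp: removal_partition_def)
  qed
  show "P \<inter> Q = {}" if PQ: "P \<in> removal_partition F" "Q \<in> removal_partition F" "P \<noteq> Q" for P Q
  proof (rule ccontr)
    assume "P \<inter> Q \<noteq> {}"
    then obtain x where x: "x \<in> P" "x \<in> Q" by blast
    from PQ(1) x(1) consider v where "v \<in> V" "x = N v"
      | e i where "e \<in> E" "i < k" "x = A e i" | e i where "e \<in> E" "i < k" "x = B e i"
      by (cases rule: removal_partition_cases) (use F in auto)
    then show False
    proof cases
      case 1
      then show ?thesis using part_of_N[OF F] PQ x by metis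
    next
      case 2
      then show ?thesis using part_of_A[OF F] PQ x by metis
    next
      case 3
      then show ?thesis using part_of_B[OF F] PQ x by metis
    qed
  qed
  show "has_ham_path new_arcs P" if "P \<in> removal_partition F" for P
    using that
  proof (cases rule: removal_partition_cases)
    case (2 e i)
    then have "(A e i, B e i) \<in> new_arcs" unfolding new_arcs_def by blast
    moreover have "A e i \<noteq> B e i" using 2 AB by blast
    ultimately show ?thesis using 2 unfolding has_ham_path_def by (intro exI[of _ "[A e i, B e i]"]) auto
  qed (auto simp: has_ham_path_def intro!: exI[of _ "[_]"])
qed

text \<open>Contracting the pairs of a kept arc \<open>(u, v)\<close> makes it a path from \<open>N u\<close> to \<open>N v\<close>, so a
  topological order of the kept arcs gives one of the quotient.\<close>

lemma removal_H_star_partition: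
  assumes F: "feedback_arc_set E F"
  shows "H_star_partition new_vertices new_arcs (removal_partition F)"
proof -
  have FE: "F \<subseteq> E" using F by (simp add: feedback_arc_set_def)
  have "\<not> (\<exists>cs. is_dicycle (E - F) cs)"
  proof
    assume "\<exists>cs. is_dicycle (E - F) cs"
    then obtain cs where cs: "is_dicycle (E - F) cs" ..
    then have "is_dicycle E cs" "cycle_arcs cs \<inter> F = {}"
      by (auto simp: is_dicycle_def cycle_arcs_def)
    then show False using F by (auto simp: feedback_arc_set_def)
  qed
  then obtain t :: "'a \<Rightarrow> nat" where t: "\<And>u v. (u, v) \<in> E - F \<Longrightarrow> t u < t v"
    using rank_if_no_dicycle[of "E - F"] finE by auto
  \<comment> \<open>Chosen to exceed every rank \<open>2 * t v + 2\<close> and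
    \<open>2 * t v + 3\<close> with \<open>v \<in> V\<close>.\<close>
  define top where "top = 2 * Max (insert 0 (t ` V)) + 4"
  have tV: "2 * t v + 4 \<le> top" if "v \<in> V" for v
    using that finV unfolding top_def by simp
  define owner where "owner x = (SOME e. e \<in> E \<and> (\<exists>i<k. x = A e i \<or> x = B e i))" for x
  have owner: "owner (A e i) = e" "owner (B e i) = e" if e: "e \<in> E" "i < k" for e i
  proof -
    show "owner (A e i) = e" unfolding owner_def
    proof (rule some_equality)
      fix d assume d: "d \<in> E \<and> (\<exists>j<k. A e i = A d j \<or> A e i = B d j)"
      then obtain j where "j < k" "A e i = A d j \<or> A e i = B d j" by blast
      then show "d = e" using d e A_inj[of e d i j] AB[of e d i j] by auto
    qed (use e in auto)
    show "owner (B e i) = e" unfolding owner_def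
    proof (rule some_equality)
      fix d assume d: "d \<in> E \<and> (\<exists>j<k. B e i = A d j \<or> B e i = B d j)"
      then obtain j where "j < k" "B e i = A d j \<or> B e i = B d j" by blast
      then show "d = e" using d e B_inj[of e d i j] AB[of d e j i] by auto
    qed (use e in auto)
  qed
  \<comment> \<open>A rank that is constant on each part. The pairs of a kept arc
    \<open>(u, v)\<close> get the odd value \<open>2 * t u + 3\<close>, strictly between
    \<open>2 * t u + 2\<close> for \<open>N u\<close> and \<open>2 * t v + 2\<close> for
    \<open>N v\<close>. The singletons of removed arcs impose no order on \<open>u\<close> and
    \<open>v\<close>: lower copies go to the bottom, upper copies to the top.\<close>
  define rk where "rk x = (if x \<in> VN then 2 * t (inv_into V N x) + 2
    else if owner x \<in> F then (if x \<in> VA then 0 else top) else 2 * t (fst (owner x)) + 3)" for x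
  have rN: "rk (N v) = 2 * t v + 2" if "v \<in> V" for v
  proof -
    have "inj_on N V" by (auto simp: inj_on_def N_inj)
    then show ?thesis using that by (simp add: rk_def VN_def)
  qed
  have B_VA: "B e i \<notin> VA" if "e \<in> E" "i < k" for e i
    using in_parts(2)[OF that] disjoint(3) by blast
  have rA: "rk (A e i) = 2 * t (fst e) + 3" if e: "e \<in> E - F" "i < k" for e i
    using e owner[of e i] not_in_VN[of e i] by (simp add: rk_def)
  have rB: "rk (B e i) = 2 * t (fst e) + 3" if e: "e \<in> E - F" "i < k" for e i
    using e owner[of e i] not_in_VN[of e i] by (simp add: rk_def)
  have rA0: "rk (A e i) = 0" if e: "e \<in> F" "i < k" for e i
    using e FE owner[of e i] not_in_VN[of e i] in_parts[of e i] by (auto simp: rk_def)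
  have rB0: "rk (B e i) = top" if e: "e \<in> F" "i < k" for e i
    using e FE owner[of e i] not_in_VN[of e i] B_VA[of e i] by (auto simp: rk_def)
  have const: "rk x = rk (SOME y. y \<in> P)" if "P \<in> removal_partition F" "x \<in> P" for P x
    using that(1)
  proof (cases rule: removal_partition_cases)
    case (2 e i)
    have "(SOME y. y \<in> P) \<in> P" using that(2) by (rule someI)
    then show ?thesis using that(2) 2 rA[of e i] rB[of e i] by auto
  qed (use that(2) in auto)
  have "rk (SOME x. x \<in> P) < rk (SOME y. y \<in> Q)" if "(P, Q) \<in> quotient_arcs new_arcs (removal_partition F)" for P Q
  proof -
    from that obtain x y where PQ: "P \<in> removal_partition F" "Q \<in> removal_partition F" "P \<noteq> Q"
      and xy: "x \<in> P" "y \<in> Q" "(x, y) \<in> new_arcs" by (auto simp: quotient_arcs_def)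
    from xy(3) have "rk x < rk y"
    proof (cases rule: new_arcs_cases)
      case (1 e i)
      then show ?thesis using rN[of "fst e"] ends_in_V[of e] rB[of e i] rB0[of e i] tV[of "fst e"]
        by (cases "e \<in> F") auto
    next
      case (2 e i)
      then show ?thesis using rN[of "snd e"] ends_in_V[of e] rA[of e i] rA0[of e i] t[of "fst e" "snd e"]
        by (cases "e \<in> F") auto
    next
      case (3 e i)
      show ?thesis
      proof (cases "e \<in> F")
        case True
        then show ?thesis using 3 rA0[of e i] rB0[of e i] by (simp add: top_def)
      next
        case False
        then have "P = {A e i, B e i}" "Q = {A e i, B e i}"
          using part_of_A[OF FE PQ(1), of e i] part_of_B[OF FE PQ(2), of e i] xy(1,2) 3 by auto
        then show ?thesis using PQ(3) by simp
      qed
    qed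
    then show ?thesis using const[OF PQ(1) xy(1)] const[OF PQ(2) xy(2)] by simp
  qed
  from no_dicycle_if_ranked[of _ "\<lambda>P. rk (SOME x. x \<in> P)", OF this] removal_H_partition[OF FE]
  show ?thesis by (simp add: H_star_partition_def)
qed

text \<open>Every path of the new graph has at most three vertices, and only the pairs
  \<open>A e i, B e i\<close> are paths with two vertices that avoid \<open>N\<close>.\<close>

lemma card_ham_path:
  assumes "has_ham_path new_arcs P"
  shows "card P \<le> 1 + (if P \<in> pairs E then 1 else 0) + 2 * card (P \<inter> VN)"
proof -
  obtain ps where ps: "distinct ps" "set ps = P" "\<And>i. i + 1 < length ps \<Longrightarrow> (ps ! i, ps ! (i + 1)) \<in> new_arcs"
    using assms unfolding has_ham_path_def by blast
  have c: "card P = length ps" using ps(1,2) distinct_card by blast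
  have l2: "level x \<le> 2" for x by (simp add: level_def)
  have l3: "length ps \<le> 3"
  proof (rule ccontr)
    assume "\<not> length ps \<le> 3"
    then have "level (ps ! 0) < level (ps ! 1)" "level (ps ! 1) < level (ps ! 2)" "level (ps ! 2) < level (ps ! 3)"
      using ps(3)[of 0] ps(3)[of 1] ps(3)[of 2] by (simp_all add: level_less numeral_2_eq_2 numeral_3_eq_3)
    then show False using l2[of "ps ! 3"] by linarith
  qed
  show ?thesis
  proof (cases "P \<inter> VN = {}")
    case False
    \<comment> \<open>One node in the part already allows \<open>1 + 2 = 3\<close> vertices, the
      greatest possible number.\<close>
    then have "0 < card (P \<inter> VN)" using finite_parts(1) by (simp add: card_gt_0_iff)
    then show ?thesis using l3 c by linarith
  next
    case True
    show ?thesis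
    proof (cases "length ps \<le> 1")
      case True
      then show ?thesis using c by simp
    next
      case False
      have nN: "ps ! i \<notin> VN" if "i < length ps" for i using that True ps(2) nth_mem by blast
      have "(ps ! 0, ps ! 1) \<in> new_arcs" using ps(3)[of 0] False by simp
      moreover have "ps ! 0 \<notin> VN" "ps ! 1 \<notin> VN" by (rule nN, use False in linarith)+
      ultimately obtain e i where e: "e \<in> E" "i < k" "ps ! 0 = A e i" "ps ! 1 = B e i" "ps ! 1 \<in> VB"
        by (cases rule: new_arcs_cases) auto
      have "length ps = 2"
      proof (rule ccontr)
        assume "length ps \<noteq> 2"
        then have "(ps ! 1, ps ! 2) \<in> new_arcs" using ps(3)[of 1] False by (simp add: numeral_2_eq_2)
        then show False by (cases rule: new_arcs_cases) (use e(5) disjoint in auto)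
      qed
      then have "ps = [A e i, B e i]" using e by (auto intro!: nth_equalityI simp: less_Suc_eq numeral_2_eq_2)
      then have "P = {A e i, B e i}" using ps(2) by auto
      then have "P \<in> pairs E" using e by (auto simp: pairs_def)
      then show ?thesis using c \<open>length ps = 2\<close> by simp
    qed
  qed
qed

text \<open>\<open>card_ham_path\<close> summed over all parts: their sizes add up to
  \<open>n + 2 k m\<close>, and the sets \<open>P \<inter> VN\<close> partition the \<open>n\<close>
  nodes.\<close>

lemma card_H_partition:
  assumes "H_partition new_vertices new_arcs \<pi>"
  shows "2 * (card E * k) \<le> card \<pi> + card (\<pi> \<inter> pairs E) + card V"
proof -
  have un: "\<Union> \<pi> = new_vertices" and dj: "pairwise disjnt \<pi>" and hp: "\<And>P. P \<in> \<pi> \<Longrightarrow> has_ham_path new_arcs P"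
    using assms by (auto simp: H_partition_def is_partition_def pairwise_def disjnt_def)
  have finV': "finite new_vertices" using finite_parts by (simp add: new_vertices_def)
  have fin: "finite \<pi>" using un finV' by (metis finite_UnionD)
  have finP: "finite P" if "P \<in> \<pi>" for P using that un finV' by (metis Union_upper finite_subset)
  have "card new_vertices = (\<Sum>P\<in>\<pi>. card P)"
    unfolding un[symmetric] using dj finP by (simp add: card_Union_disjoint)
  also have "\<dots> \<le> (\<Sum>P\<in>\<pi>. 1 + (if P \<in> pairs E then 1 else 0) + 2 * card (P \<inter> VN))"
    by (intro sum_mono card_ham_path hp)
  also have "\<dots> = (\<Sum>P\<in>\<pi>. 1) + (\<Sum>P\<in>\<pi>. if P \<in> pairs E then 1 else 0) + 2 * (\<Sum>P\<in>\<pi>. card (P \<inter> VN))"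
    by (simp only: sum.distrib sum_distrib_left)
  also have "\<dots> = card \<pi> + card (\<pi> \<inter> pairs E) + 2 * (\<Sum>P\<in>\<pi>. card (P \<inter> VN))"
    using fin by (simp add: sum.If_cases)
  also have "(\<Sum>P\<in>\<pi>. card (P \<inter> VN)) = card (\<Union>P\<in>\<pi>. P \<inter> VN)"
    using fin finite_parts(1) dj
    by (intro card_UN_disjoint[symmetric]) (auto simp: pairwise_def disjnt_def)
  also have "(\<Union>P\<in>\<pi>. P \<inter> VN) = VN" using un by (auto simp: new_vertices_def)
  finally show ?thesis using card_new_vertices card_parts(1) by simp
qed

section \<open>From a partition to a feedback arc set\<close>

definition unpaired :: "'b set set \<Rightarrow> ('a \<times> 'a) set" where
  "unpaired \<pi> = {e \<in> E. \<forall>i<k. {A e i, B e i} \<notin> \<pi>}"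

text \<open>With \<open>f\<close> unpaired arcs there are at most \<open>k (m - f)\<close> pairs, so
  \<open>card_H_partition\<close> forces at least \<open>k (m + f) - n\<close> parts. If
  \<open>f\<close> were at least \<open>K + 1\<close>, the bound \<open>n + k (m + K)\<close> would
  give \<open>k\<close> at most \<open>2 n\<close>. The \<open>k\<close> copies amplify a single
  unpaired arc beyond what larger parts can save.\<close>

lemma card_unpaired:
  assumes "H_partition new_vertices new_arcs \<pi>" "card \<pi> \<le> card V + k * (card E + min K (card E))" "2 * card V < k"
  shows "card (unpaired \<pi>) \<le> K"
proof (rule ccontr)
  assume K: "\<not> card (unpaired \<pi>) \<le> K"
  have sub: "unpaired \<pi> \<subseteq> E" by (auto simp: unpaired_def)
  then have le: "card (unpaired \<pi>) \<le> card E" using finE by (simp add: card_mono)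
  have dc: "card (E - unpaired \<pi>) = card E - card (unpaired \<pi>)"
    using sub finE by (metis card_Diff_subset finite_subset)
  have "\<pi> \<inter> pairs E \<subseteq> pairs (E - unpaired \<pi>)" by (auto simp: pairs_def unpaired_def)
  moreover have "finite (pairs (E - unpaired \<pi>))" using finE by (simp add: pairs_def)
  ultimately have "card (\<pi> \<inter> pairs E) \<le> card (pairs (E - unpaired \<pi>))" by (rule card_mono[rotated])
  also have "\<dots> \<le> card ((E - unpaired \<pi>) \<times> {..<k})" unfolding pairs_def using finE by (intro card_image_le) auto
  also have "\<dots> = (card E - card (unpaired \<pi>)) * k" by (simp add: card_cartesian_product dc)
  finally have p: "card (\<pi> \<inter> pairs E) \<le> (card E - card (unpaired \<pi>)) * k" .
  have "2 * (card E * k) \<le> card V + k * (card E + K) + (card E - card (unpaired \<pi>)) * k + card V"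
    using card_H_partition[OF assms(1)] assms(2) p K le by (simp add: min_def)
  also have "(card E - card (unpaired \<pi>)) * k \<le> (card E - (K + 1)) * k" using K by (intro mult_right_mono) auto
  finally have "2 * (card E * k) \<le> 2 * card V + k * (card E + K) + (card E - (K + 1)) * k" by simp
  \<comment> \<open>Writing \<open>card E\<close> as \<open>d + (K + 1)\<close> removes the
    truncated subtraction.\<close>
  moreover have "card E = (card E - (K + 1)) + (K + 1)" using K le by simp
  then obtain d where "card E = d + (K + 1)" by blast
  ultimately show False using assms(3) by (simp add: algebra_simps)
qed

text \<open>One pair per arc is enough: if \<open>{A e i, B e i}\<close> is a part for
  \<open>e = (u, v)\<close>, the quotient leads from the part of \<open>N u\<close> through it to
  the part of \<open>N v\<close>. A cycle of such arcs yields a closed walk in the quotient; several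
  nodes may share a part, so the walk need not be a cycle itself, but it contains one.\<close>

lemma unpaired_feedback_arc_set:
  assumes "H_star_partition new_vertices new_arcs \<pi>"
  shows "feedback_arc_set E (unpaired \<pi>)"
  unfolding feedback_arc_set_def
proof (intro conjI allI impI)
  show "unpaired \<pi> \<subseteq> E" by (auto simp: unpaired_def)
  fix cs assume cs: "is_dicycle E cs"
  show "cycle_arcs cs \<inter> unpaired \<pi> \<noteq> {}"
  proof
    assume d: "cycle_arcs cs \<inter> unpaired \<pi> = {}"
    have un: "\<Union> \<pi> = new_vertices" and nocyc: "\<not> (\<exists>cs. is_dicycle (quotient_arcs new_arcs \<pi>) cs)"
      using assms by (auto simp: H_star_partition_def H_partition_def is_partition_def)
    define Q where "Q v = (SOME P. P \<in> \<pi> \<and> N v \<in> P)" for v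
    have Q: "Q v \<in> \<pi> \<and> N v \<in> Q v" if "v \<in> V" for v
    proof -
      have "N v \<in> \<Union> \<pi>" using that un by (simp add: new_vertices_def VN_def)
      then show ?thesis unfolding Q_def by (intro someI_ex[of "\<lambda>P. P \<in> \<pi> \<and> N v \<in> P"]) blast
    qed
    have "(Q (cs ! 0), Q (cs ! 0)) \<in> (quotient_arcs new_arcs \<pi>)\<^sup>+"
    proof (rule trancl_refl_along_dicycle[OF cs])
      fix u v assume uv: "(u, v) \<in> cycle_arcs cs"
      then have E: "(u, v) \<in> E" using cs by (auto simp: cycle_arcs_def is_dicycle_def)
      then have V: "u \<in> V" "v \<in> V" using EV by auto
      have "(u, v) \<notin> unpaired \<pi>" using uv d by blast
      then obtain i where i: "i < k" "{A (u, v) i, B (u, v) i} \<in> \<pi>" using E by (auto simp: unpaired_def)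
      let ?P = "{A (u, v) i, B (u, v) i}"
      have "N u \<notin> ?P" "N v \<notin> ?P" using NA NB E V i(1) by auto
      then have ne: "Q u \<noteq> ?P" "Q v \<noteq> ?P" using Q V by blast+
      have "(N u, B (u, v) i) \<in> new_arcs" using E i(1) by (force simp: new_arcs_def)
      from quotient_arcsI[OF _ i(2) ne(1) _ _ this] have "(Q u, ?P) \<in> quotient_arcs new_arcs \<pi>"
        using Q[OF V(1)] by simp
      moreover have "(A (u, v) i, N v) \<in> new_arcs" using E i(1) by (force simp: new_arcs_def)
      from quotient_arcsI[OF i(2) _ ne(2)[symmetric] _ _ this] have "(?P, Q v) \<in> quotient_arcs new_arcs \<pi>"
        using Q[OF V(2)] by simp
      ultimately show "(Q u, Q v) \<in> (quotient_arcs new_arcs \<pi>)\<^sup>+" by (rule trancl_into_trancl[OF r_into_trancl])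
    qed
    from dicycle_if_trancl_refl[OF this] nocyc show False by contradiction
  qed
qed

text \<open>Capping \<open>K\<close> by the number of arcs loses nothing, because a feedback arc set
  is a set of arcs.\<close>

theorem feedback_arc_set_iff_partition:
  assumes "2 * card V < k"
  shows "(\<exists>F. feedback_arc_set E F \<and> card F \<le> K) \<longleftrightarrow>
    (\<exists>\<pi>. H_star_partition new_vertices new_arcs \<pi> \<and> card \<pi> \<le> card V + k * (card E + min K (card E)))"
proof
  assume "\<exists>F. feedback_arc_set E F \<and> card F \<le> K"
  then obtain F where F: "feedback_arc_set E F" "card F \<le> K" by blast
  then have FE: "F \<subseteq> E" by (simp add: feedback_arc_set_def)
  then have "card F \<le> min K (card E)" using F(2) finE by (simp add: card_mono)
  then have "card V + k * (card E + card F) \<le> card V + k * (card E + min K (card E))" by simp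
  then show "\<exists>\<pi>. H_star_partition new_vertices new_arcs \<pi> \<and> card \<pi> \<le> card V + k * (card E + min K (card E))"
    using removal_H_star_partition[OF F(1)] card_removal_partition[OF FE] le_trans by blast
next
  assume "\<exists>\<pi>. H_star_partition new_vertices new_arcs \<pi> \<and> card \<pi> \<le> card V + k * (card E + min K (card E))"
  then obtain \<pi> where p: "H_star_partition new_vertices new_arcs \<pi>"
    "card \<pi> \<le> card V + k * (card E + min K (card E))" by blast
  then have "card (unpaired \<pi>) \<le> K"
    using assms by (intro card_unpaired) (auto simp: H_star_partition_def)
  then show "\<exists>F. feedback_arc_set E F \<and> card F \<le> K" using unpaired_feedback_arc_set[OF p(1)] by blast
qed

end

section \<open>The reduction on words\<close>

text \<open>Extends the inverse of \<open>bin\<close> to words with leading zeros, hence to padded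
  ones.\<close>

primrec num :: "nat list \<Rightarrow> nat" where
  "num [] = 0"
| "num (d # w) = (d - 1) + 2 * num w"

lemma num_append: "num (u @ v) = num u + 2 ^ length u * num v"
  by (induction u) (auto simp: algebra_simps)

lemma num_bin: "num (bin n) = n"
proof (induction n rule: bin.induct)
  case (1 n)
  then show ?case by (cases "n = 0") (auto simp: bin.simps[of n] elim: oddE)
qed

lemma num_less: "set w \<subseteq> {1, 2} \<Longrightarrow> num w < 2 ^ length w"
proof (induction w)
  case (Cons d w)
  then have "num w < 2 ^ length w" "d - 1 \<le> 1" by auto
  then show ?case by simp
qed simp

lemma bin_num: "set w \<subseteq> {1, 2} \<Longrightarrow> w = [] \<or> last w = 2 \<Longrightarrow> bin (num w) = w"
  using range_bin[of w] num_bin by auto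

lemma num_replicate: "num (replicate n 1) = 0" "num (replicate n 2) = 2 ^ n - 1"
proof -
  show "num (replicate n 1) = 0" by (induction n) auto
  have "num (replicate n 2) + 1 = 2 ^ n" by (induction n) auto
  then show "num (replicate n 2) = 2 ^ n - 1" by simp
qed

lemma num_pad_bin: "num (pad k (bin v)) = v"
  by (simp only: pad_def num_append num_replicate num_bin)

lemma less_power_length_bin: "length (bin v) \<le> k \<Longrightarrow> v < 2 ^ k"
  using num_less[OF set_bin, of v] num_bin[of v] less_le_trans[OF _ power_increasing[of "length (bin v)" k "2::nat"]]
  by simp

text \<open>The summand \<open>2 ^ k\<close> is the closing digit 2 behind the \<open>k\<close>
  padded digits; it makes the numeral canonical and exactly \<open>k + 1\<close> digits
  long.\<close>

definition node :: "nat \<Rightarrow> nat \<Rightarrow> nat" where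
  "node k v = v + 2 ^ k"

text \<open>The thermometer code of length \<open>k\<close> has value \<open>2 ^ i - 1\<close>; the
  head of the arc starts at digit \<open>k\<close> and the tail at digit \<open>2 * k + 1\<close>.
  The tail is the more significant block because arcs are ordered by their tails first.\<close>

definition lower :: "nat \<Rightarrow> nat \<times> nat \<Rightarrow> nat \<Rightarrow> nat" where
  "lower k e i = (2 ^ i - 1) + 2 ^ k * node k (snd e) + 2 ^ (2 * k + 1) * node k (fst e)"

definition upper :: "nat \<Rightarrow> nat \<times> nat \<Rightarrow> nat \<Rightarrow> nat" where
  "upper k e i = lower k e i + 2 ^ (3 * k + 2)"

lemma bin_node:
  assumes "length (bin v) \<le> k"
  shows "pad k (bin v) @ [2] = bin (node k v)"
proof -
  have "num (pad k (bin v) @ [2]) = node k v"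
    using length_pad[OF assms] by (simp add: num_append num_pad_bin node_def)
  moreover have "bin (num (pad k (bin v) @ [2])) = pad k (bin v) @ [2]"
    using set_pad[OF set_bin, of k v] by (intro bin_num) auto
  ultimately show ?thesis by simp
qed

lemma pad_bin_append: "length (bin v) \<le> k \<Longrightarrow> pad k (bin v) @ 2 # r = bin (node k v) @ r"
  by (simp flip: bin_node)

definition lower_word :: "nat \<Rightarrow> nat \<times> nat \<Rightarrow> nat \<Rightarrow> nat list" where
  "lower_word k e i = replicate i 2 @ replicate (k - i) 1 @ bin (node k (snd e)) @ bin (node k (fst e))"

lemma length_bin_node: "length (bin v) \<le> k \<Longrightarrow> length (bin (node k v)) = k + 1"
  using arg_cong[OF bin_node, of v k length] length_pad[of "bin v" k] by simp

lemma node_pos: "0 < node k v"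
  by (simp add: node_def)

lemma set_lower_word: "set (lower_word k e i) \<subseteq> {1, 2}"
  using set_bin[of "node k (fst e)"] set_bin[of "node k (snd e)"] by (auto simp: lower_word_def)

lemma num_lower_word:
  assumes "length (bin (fst e)) \<le> k" "length (bin (snd e)) \<le> k" "i \<le> k"
  shows "num (lower_word k e i) = lower k e i" "length (lower_word k e i) = 3 * k + 2"
proof -
  show "length (lower_word k e i) = 3 * k + 2"
    using assms by (simp add: lower_word_def length_bin_node)
  have "num (lower_word k e i) = (2 ^ i - 1) + 2 ^ i * (2 ^ (k - i) * (node k (snd e) + 2 ^ (k + 1) * node k (fst e)))"
    using assms unfolding lower_word_def num_append num_replicate num_bin by (simp add: length_bin_node)
  also have "\<dots> = (2 ^ i - 1) + 2 ^ k * (node k (snd e) + 2 ^ (k + 1) * node k (fst e))"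
    using assms(3) by (simp flip: power_add mult.assoc)
  also have "2 ^ k * (2 ^ (k + 1) * node k (fst e)) = 2 ^ (2 * k + 1) * node k (fst e)"
  proof -
    have "k + (k + 1) = 2 * k + 1" by simp
    then show ?thesis by (metis mult.assoc power_add)
  qed
  then have "(2 ^ i - 1) + 2 ^ k * (node k (snd e) + 2 ^ (k + 1) * node k (fst e)) = lower k e i"
    unfolding lower_def by (simp only: add_mult_distrib2 add.assoc)
  finally show "num (lower_word k e i) = lower k e i" .
qed

lemma bin_lower:
  assumes "length (bin (fst e)) \<le> k" "length (bin (snd e)) \<le> k" "i \<le> k"
  shows "lower_word k e i = bin (lower k e i)"
proof -
  have "bin (num (lower_word k e i)) = lower_word k e i"
    by (rule bin_num[OF set_lower_word]) (use node_pos[of k "fst e"] in \<open>simp add: lower_word_def last_bin\<close>)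
  then show ?thesis using num_lower_word[OF assms] by simp
qed

lemma bin_upper:
  assumes "length (bin (fst e)) \<le> k" "length (bin (snd e)) \<le> k" "i \<le> k"
  shows "lower_word k e i @ [2] = bin (upper k e i)"
proof -
  have "bin (num (lower_word k e i @ [2])) = lower_word k e i @ [2]"
    using set_lower_word by (intro bin_num) auto
  moreover have "num (lower_word k e i @ [2]) = upper k e i"
    using num_lower_word[OF assms] by (simp add: num_append upper_def)
  ultimately show ?thesis by simp
qed

definition new_vertex_list :: "nat \<Rightarrow> nat list \<Rightarrow> (nat \<times> nat) list \<Rightarrow> nat list" where
  "new_vertex_list k vs es = map (node k) vs @ concat (map (\<lambda>e. map (lower k e) [0..<k]) es) @
     concat (map (\<lambda>e. map (upper k e) [0..<k]) es)"

definition new_arc_list :: "nat \<Rightarrow> (nat \<times> nat) list \<Rightarrow> (nat \<times> nat) list" where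
  "new_arc_list k es = concat (map (\<lambda>e. map (\<lambda>i. (node k (fst e), upper k e i)) [0..<k]) es) @
     concat (map (\<lambda>e. concat (map (\<lambda>i. [(lower k e i, node k (snd e)), (lower k e i, upper k e i)]) [0..<k])) es)"

lemma vertex_code_append: "vertex_code (xs @ ys) = vertex_code xs @ vertex_code ys"
  by (simp add: vertex_code_def vertex_words_def)

lemma vertex_code_Cons: "vertex_code (x # xs) = bin x @ [3] @ vertex_code xs"
  by (simp add: vertex_code_def vertex_words_def)

lemma arc_code_append: "arc_code (xs @ ys) = arc_code xs @ arc_code ys"
  by (simp add: arc_code_def arc_words_def)

lemma arc_code_Cons: "arc_code ((a, b) # xs) = bin a @ [3] @ bin b @ [3] @ arc_code xs"
  by (simp add: arc_code_def arc_words_def)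

lemma vertex_code_concat: "vertex_code (concat xss) = concat (map vertex_code xss)"
  by (induction xss) (simp_all add: vertex_code_append)

lemma arc_code_concat: "arc_code (concat xss) = concat (map arc_code xss)"
  by (induction xss) (simp_all add: arc_code_append)

lemma vertex_code_map: "vertex_code (map f xs) = concat (map (\<lambda>x. bin (f x) @ [3]) xs)"
  by (simp add: vertex_code_def vertex_words_def comp_def)

lemma arc_code_map: "arc_code (map f xs) = concat (map (\<lambda>x. arc_code [f x]) xs)"
proof (induction xs)
  case (Cons x xs)
  then show ?case using arc_code_append[of "[f x]" "map f xs"] by simp
qed simp

text \<open>Under the length bounds the templates spell canonical numerals, so the word written is
  the code of the new vertex and arc lists.\<close>

lemma code_output_eq:
  assumes vs: "\<And>v. v \<in> set vs \<Longrightarrow> length (bin v) \<le> k"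
    and es: "\<And>u v. (u, v) \<in> set es \<Longrightarrow> length (bin u) \<le> k \<and> length (bin v) \<le> k"
  shows "code_output k vs es K =
    list_code (new_vertex_list k vs es) (new_arc_list k es) (new_bound k (length vs) (length es) K)"
proof -
  let ?g = "\<lambda>(a, b). (bin a, bin b)"
  have all: "all_vals k its (map ?g es) = concat (map (\<lambda>e. concat (map (h e) [0..<k])) es)"
    if h: "\<And>a b i. (a, b) \<in> set es \<Longrightarrow> i < k \<Longrightarrow> vals k its (bin a, bin b) i = h (a, b) i"
    for its and h :: "nat \<times> nat \<Rightarrow> nat \<Rightarrow> nat list"
    unfolding all_vals_def map_map comp_def using h
    by (intro arg_cong[of _ _ concat] map_cong) auto
  \<comment> \<open>The rules carry an arbitrary rest \<open>r\<close>, because the numerals occur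
    inside longer concatenations.\<close>
  have L: "replicate i 2 @ replicate (k - i) 1 @ bin (node k b) @ bin (node k a) @ r = bin (lower k (a, b) i) @ r"
    "bin (lower k (a, b) i) @ 2 # r = bin (upper k (a, b) i) @ r"
    and N: "pad k (bin a) @ 2 # r = bin (node k a) @ r" "pad k (bin b) @ 2 # r = bin (node k b) @ r"
    if "(a, b) \<in> set es" "i < k" for a b i r
  proof -
    have l: "length (bin a) \<le> k" "length (bin b) \<le> k" "i \<le> k" using es[of a b] that by auto
    show "pad k (bin a) @ 2 # r = bin (node k a) @ r" "pad k (bin b) @ 2 # r = bin (node k b) @ r"
      by (intro pad_bin_append l)+
    note w = bin_lower[of "(a, b)" k i, simplified, OF l, symmetric] bin_upper[of "(a, b)" k i, simplified, OF l, symmetric]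
    show "replicate i 2 @ replicate (k - i) 1 @ bin (node k b) @ bin (node k a) @ r = bin (lower k (a, b) i) @ r"
      unfolding w lower_word_def by simp
    show "bin (lower k (a, b) i) @ 2 # r = bin (upper k (a, b) i) @ r" unfolding w by simp
  qed
  have V: "concat (map (\<lambda>v. pad k v @ [2, 3]) (map bin vs)) = vertex_code (map (node k) vs)"
  proof -
    have "pad k (bin v) @ [2, 3] = bin (node k v) @ [3]" if "v \<in> set vs" for v
      by (intro pad_bin_append vs that)
    then show ?thesis unfolding vertex_code_map map_map comp_def by (intro arg_cong[of _ _ concat] map_cong) auto
  qed
  note item_defs = vals_def lower_vertices_def upper_vertices_def tail_arcs_def head_arcs_def lower_code_def upper_code_def
  have 1: "all_vals k lower_vertices (map ?g es) =
      vertex_code (concat (map (\<lambda>e. map (lower k e) [0..<k]) es))"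
    unfolding vertex_code_concat map_map comp_def vertex_code_map
  proof (rule all)
    fix a b i assume ab: "(a, b) \<in> set es" "i < k"
    note LN = L[OF ab] N[OF ab] L[OF ab, where r = "[]", unfolded append_Nil2] N[OF ab, where r = "[]", unfolded append_Nil2]
    show "vals k lower_vertices (bin a, bin b) i = bin (lower k (a, b) i) @ [3]"
      by (simp add: item_defs LN arc_code_Cons del: One_nat_def)
  qed
  have 2: "all_vals k upper_vertices (map ?g es) =
      vertex_code (concat (map (\<lambda>e. map (upper k e) [0..<k]) es))"
    unfolding vertex_code_concat map_map comp_def vertex_code_map
  proof (rule all)
    fix a b i assume ab: "(a, b) \<in> set es" "i < k"
    note LN = L[OF ab] N[OF ab] L[OF ab, where r = "[]", unfolded append_Nil2] N[OF ab, where r = "[]", unfolded append_Nil2]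
    show "vals k upper_vertices (bin a, bin b) i = bin (upper k (a, b) i) @ [3]"
      by (simp add: item_defs LN arc_code_Cons del: One_nat_def)
  qed
  have 3: "all_vals k tail_arcs (map ?g es) =
      arc_code (concat (map (\<lambda>e. map (\<lambda>i. (node k (fst e), upper k e i)) [0..<k]) es))"
    unfolding arc_code_concat map_map comp_def arc_code_map
  proof (rule all)
    fix a b i assume ab: "(a, b) \<in> set es" "i < k"
    note LN = L[OF ab] N[OF ab] L[OF ab, where r = "[]", unfolded append_Nil2] N[OF ab, where r = "[]", unfolded append_Nil2]
    show "vals k tail_arcs (bin a, bin b) i = arc_code [(node k (fst (a, b)), upper k (a, b) i)]"
      by (simp add: item_defs LN arc_code_Cons del: One_nat_def)
  qed
  have 4: "all_vals k head_arcs (map ?g es) =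
      arc_code (concat (map (\<lambda>e. concat (map (\<lambda>i. [(lower k e i, node k (snd e)), (lower k e i, upper k e i)]) [0..<k])) es))"
    unfolding arc_code_concat map_map comp_def arc_code_map
  proof (rule all)
    fix a b i assume ab: "(a, b) \<in> set es" "i < k"
    note LN = L[OF ab] N[OF ab] L[OF ab, where r = "[]", unfolded append_Nil2] N[OF ab, where r = "[]", unfolded append_Nil2]
    show "vals k head_arcs (bin a, bin b) i = arc_code [(lower k (a, b) i, node k (snd (a, b))), (lower k (a, b) i, upper k (a, b) i)]"
      by (simp add: item_defs LN arc_code_Cons del: One_nat_def)
  qed
  show ?thesis
    unfolding code_output_def output_word_def V 1 2 3 4
    by (simp add: list_code_def new_vertex_list_def new_arc_list_def vertex_code_append arc_code_append)
qed

subsection \<open>Unique parsing\<close>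

lemma split_at_separator:
  assumes "x \<notin> set us" "x \<notin> set us'" "us @ x # vs = us' @ x # vs'"
  shows "us = us' \<and> vs = vs'"
  using assms
proof (induction us arbitrary: us')
  case Nil
  then show ?case by (cases us') auto
next
  case (Cons u us)
  then show ?case by (cases us') auto
qed

lemma bin_inject: "bin a = bin b \<longleftrightarrow> a = b"
  using num_bin by metis

lemma three_notin_bin: "3 \<notin> set (bin n)" "4 \<notin> set (bin n)"
  using set_bin[of n] by auto

lemma vertex_code_inject: "vertex_code vs = vertex_code vs' \<Longrightarrow> vs = vs'"
proof (induction vs arbitrary: vs')
  case Nil
  then show ?case by (cases vs') (auto simp: vertex_code_Cons)
next
  case (Cons v vs)
  then obtain v' us where e: "vs' = v' # us" by (cases vs') (auto simp: vertex_code_Cons)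
  then have "bin v = bin v' \<and> vertex_code vs = vertex_code us"
    using Cons.prems three_notin_bin by (intro split_at_separator[of 3]) (auto simp: vertex_code_Cons)
  then show ?case using Cons.IH e by (simp add: bin_inject)
qed

lemma arc_code_inject: "arc_code es = arc_code es' \<Longrightarrow> es = es'"
proof (induction es arbitrary: es')
  case Nil
  then show ?case by (cases es') (auto simp: arc_code_Cons)
next
  case (Cons e es)
  obtain a b where ab: "e = (a, b)" by force
  from Cons.prems obtain a' b' us where e: "es' = (a', b') # us" by (cases es') (auto simp: ab arc_code_Cons)
  then have 1: "bin a = bin a' \<and> bin b @ 3 # arc_code es = bin b' @ 3 # arc_code us"
    using Cons.prems three_notin_bin by (intro split_at_separator[of 3]) (auto simp: ab arc_code_Cons)
  then have "bin b = bin b' \<and> arc_code es = arc_code us"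
    using three_notin_bin by (intro split_at_separator[of 3]) auto
  then show ?case using Cons.IH e 1 by (simp add: ab bin_inject)
qed

lemma four_notin_code: "4 \<notin> set (vertex_code vs)" "4 \<notin> set (arc_code es)"
proof -
  show "4 \<notin> set (vertex_code vs)"
    by (induction vs) (auto simp: vertex_code_Cons three_notin_bin)
  show "4 \<notin> set (arc_code es)"
    by (induction es) (auto simp: arc_code_Cons three_notin_bin)
qed

lemma list_code_inject:
  assumes "list_code vs es K = list_code vs' es' K'"
  shows "vs = vs' \<and> es = es' \<and> K = K'"
proof -
  have 1: "vertex_code vs = vertex_code vs' \<and> arc_code es @ 4 # bin K = arc_code es' @ 4 # bin K'"
    using assms four_notin_code by (intro split_at_separator[of 4]) (auto simp: list_code_def)
  then have "arc_code es = arc_code es' \<and> bin K = bin K'"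
    using four_notin_code by (intro split_at_separator[of 4]) auto
  then show ?thesis using 1 vertex_code_inject arc_code_inject bin_inject by blast
qed

lemma enc_eq: "enc V E K = list_code (sorted_list_of_set V) (sorted_list_of_set E) K"
proof -
  have "concat (map (\<lambda>(a, b). bin a @ [3] @ bin b @ [3]) es) = arc_code es" for es
    by (induction es) (auto simp: arc_code_Cons)
  moreover have "concat (map (\<lambda>v. bin v @ [3]) vs) = vertex_code vs" for vs
    by (induction vs) (auto simp: vertex_code_Cons)
  ultimately show ?thesis unfolding enc_def list_code_def by presburger
qed

subsection \<open>Order of the output lists\<close>

lemma sorted_list_of_set_eq_iff:
  fixes xs :: "'a :: linorder list"
  shows "sorted_list_of_set (set xs) = xs \<longleftrightarrow> sorted_wrt (<) xs"
  using strict_sorted_list_of_set[of "set xs"] strict_sorted_equal[of "sorted_list_of_set (set xs)" xs]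
  by (metis List.finite_set set_sorted_list_of_set)

lemma sorted_wrt_concat_map:
  assumes "sorted_wrt R es" "\<And>e. e \<in> set es \<Longrightarrow> sorted_wrt P (f e)"
    "\<And>d e x y. d \<in> set es \<Longrightarrow> e \<in> set es \<Longrightarrow> R d e \<Longrightarrow> x \<in> set (f d) \<Longrightarrow> y \<in> set (f e) \<Longrightarrow> P x y"
  shows "sorted_wrt P (concat (map f es))"
  using assms
proof (induction es)
  case (Cons e es)
  have "sorted_wrt P (concat (map f es))"
  proof (rule Cons.IH)
    fix a b x y assume "a \<in> set es" "b \<in> set es" "R a b" "x \<in> set (f a)" "y \<in> set (f b)"
    then show "P x y" by (intro Cons.prems(3)[of a b]) auto
  qed (use Cons.prems in auto)
  moreover have "P x y" if "x \<in> set (f e)" "d \<in> set es" "y \<in> set (f d)" for x y d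
    using that Cons.prems(1) by (intro Cons.prems(3)[of e d]) auto
  ultimately show ?case using Cons.prems(2)[of e] by (auto simp: sorted_wrt_append)
qed simp

text \<open>One representative \<open>g e\<close> per block suffices to recover the order of the
  blocks. This reads the sortedness of the input off the output.\<close>

lemma sorted_wrt_from_concat_map:
  assumes "sorted_wrt P (concat (map f es))" "\<And>e. e \<in> set es \<Longrightarrow> g e \<in> set (f e)"
    "\<And>d e. d \<in> set es \<Longrightarrow> e \<in> set es \<Longrightarrow> P (g d) (g e) \<Longrightarrow> R d e"
  shows "sorted_wrt R es"
  using assms
proof (induction es)
  case (Cons e es)
  have "sorted_wrt R es" by (rule Cons.IH) (use Cons.prems in \<open>auto simp: sorted_wrt_append\<close>)
  moreover have "R e d" if "d \<in> set es" for d
    using that Cons.prems by (intro Cons.prems(3)) (auto simp: sorted_wrt_append)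
  ultimately show ?case by simp
qed simp

section \<open>Order and distinctness of the new numbers\<close>

lemma node_less: "v < 2 ^ k \<Longrightarrow> node k v < 2 ^ (k + 1)"
  by (simp add: node_def)

lemma lower_low_part:
  assumes "v < 2 ^ k" "i < k"
  shows "(2 ^ i - 1) + 2 ^ k * node k v < 2 ^ (2 * k + 1)"
proof -
  have "(2::nat) ^ i < 2 ^ k" using assms(2) by simp
  moreover have "node k v + 1 \<le> 2 ^ (k + 1)" using node_less[OF assms(1)] by simp
  then have "2 ^ k * (node k v + 1) \<le> 2 ^ k * 2 ^ (k + 1)" by (rule mult_le_mono2)
  moreover have "k + (k + 1) = 2 * k + 1" by simp
  then have "(2::nat) ^ k * 2 ^ (k + 1) = 2 ^ (2 * k + 1)" by (metis power_add)
  ultimately show ?thesis by (simp only: distrib_left)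
qed

lemma mult_add_less: "a < b \<Longrightarrow> x < m \<Longrightarrow> x + m * a < y + m * (b::nat)"
proof -
  assume "a < b" "x < m"
  then have "m * (a + 1) \<le> m * b" by (intro mult_le_mono2) simp
  then show ?thesis using \<open>x < m\<close> by simp
qed

text \<open>Blocks are compared from the most significant one, first tail and then head. The index
  block stays below \<open>2 ^ k\<close> and cannot outweigh a difference in the head, so
  \<open>j\<close> is arbitrary.\<close>

lemma lower_less:
  assumes "d < e" "fst d < 2 ^ k" "snd d < 2 ^ k" "i < k"
  shows "lower k d i < lower k e j"
proof -
  obtain a b c f where de: "d = (a, b)" "e = (c, f)" by force
  then consider "a < c" | "a = c" "b < f" using assms(1) by (auto simp: less_prod_def le_less)
  then show ?thesis
  proof cases
    case 1
    then show ?thesis unfolding lower_def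
      by (intro mult_add_less lower_low_part) (use assms de in \<open>auto simp: node_def\<close>)
  next
    case 2
    have "(2::nat) ^ i < 2 ^ k" using assms(4) by simp
    then have "(2::nat) ^ i - 1 < 2 ^ k" by (rule less_imp_diff_less)
    then have "(2 ^ i - 1) + 2 ^ k * node k b < (2 ^ j - 1) + 2 ^ k * node k f"
      using 2 by (intro mult_add_less) (auto simp: node_def)
    then show ?thesis using 2 de by (simp add: lower_def)
  qed
qed

lemma lower_less_index: "i < j \<Longrightarrow> lower k e i < lower k e j"
proof -
  assume "i < j"
  then have "(2::nat) ^ i < 2 ^ j" by simp
  moreover have "(1::nat) \<le> 2 ^ i" by simp
  ultimately show ?thesis unfolding lower_def by linarith
qed

lemma lower_inject:
  assumes "fst d < 2 ^ k" "snd d < 2 ^ k" "fst e < 2 ^ k" "snd e < 2 ^ k" "i < k" "j < k"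
    "lower k d i = lower k e j"
  shows "d = e \<and> i = j"
proof -
  have "\<not> d < e" "\<not> e < d" using lower_less[of d e k i j] lower_less[of e d k j i] assms by auto
  then have "d = e" by (meson linorder_less_linear)
  moreover have "\<not> i < j" "\<not> j < i" using lower_less_index[of i j k e] lower_less_index[of j i k e] assms(7) calculation by auto
  ultimately show ?thesis by simp
qed

lemma node_less_lower: "v < 2 ^ k \<Longrightarrow> node k v < lower k e i"
proof -
  assume "v < 2 ^ k"
  then have "node k v < 2 ^ (k + 1)" by (rule node_less)
  also have "\<dots> \<le> 2 ^ (2 * k + 1)" by simp
  also have "\<dots> \<le> 2 ^ (2 * k + 1) * node k (fst e)" using node_pos[of k "fst e"] by simp
  also have "\<dots> \<le> lower k e i" by (simp add: lower_def)
  finally show ?thesis .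
qed

lemma node_less_upper: "v < 2 ^ k \<Longrightarrow> node k v < upper k e i"
  unfolding upper_def by (intro trans_less_add1 node_less_lower)

text \<open>A lower copy has \<open>3 * k + 2\<close> digits, so the additional top digit of an
  upper copy outweighs all of them.\<close>

lemma lower_less_upper:
  assumes "fst d < 2 ^ k" "snd d < 2 ^ k" "i < k"
  shows "lower k d i < upper k e j"
proof -
  have "lower k d i < 0 + 2 ^ (2 * k + 1) * 2 ^ (k + 1)"
    unfolding lower_def using assms by (intro mult_add_less lower_low_part node_less)
  also have "\<dots> = 2 ^ (3 * k + 2)" by (simp flip: power_add)
  also have "\<dots> \<le> upper k e j" by (simp add: upper_def)
  finally show ?thesis .
qed

lemma sorted_wrt_append3:
  assumes "sorted_wrt R as" "\<And>x y. x \<in> set as \<Longrightarrow> y \<in> set bs \<Longrightarrow> R x y"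
    "\<And>x y. x \<in> set bs \<Longrightarrow> y \<in> set cs \<Longrightarrow> R x y" "\<And>x y. x \<in> set as \<Longrightarrow> y \<in> set cs \<Longrightarrow> R x y"
    "sorted_wrt R bs" "sorted_wrt R cs"
  shows "sorted_wrt R (as @ bs @ cs)"
  using assms by (auto simp: sorted_wrt_append)

text \<open>Neither sortedness nor arcs between listed vertices are assumed: the lists come from any
  word of the right format, and these properties are to be transferred between input and
  output.\<close>

locale encoded_graph =
  fixes vs :: "nat list" and es :: "(nat \<times> nat) list" and k :: nat
  assumes vs_less: "v \<in> set vs \<Longrightarrow> v < 2 ^ k"
    and es_less: "e \<in> set es \<Longrightarrow> fst e < 2 ^ k \<and> snd e < 2 ^ k"
    and k_pos: "0 < k"
begin

abbreviation "lowers \<equiv> concat (map (\<lambda>e. map (lower k e) [0..<k]) es)"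
abbreviation "uppers \<equiv> concat (map (\<lambda>e. map (upper k e) [0..<k]) es)"

lemma sorted_lowers:
  assumes "sorted_wrt (<) es"
  shows "sorted_wrt (<) lowers"
proof (rule sorted_wrt_concat_map[OF assms])
  show "sorted_wrt (<) (map (lower k e) [0..<k])" for e
    unfolding sorted_wrt_map by (rule sorted_wrt_mono_rel[OF _ sorted_wrt_upt]) (simp add: lower_less_index)
  show "x < y" if "d \<in> set es" "d < e" "x \<in> set (map (lower k d) [0..<k])" "y \<in> set (map (lower k e) [0..<k])" for d e x y
    using that es_less[of d] by (auto intro: lower_less)
qed

lemma sorted_uppers:
  assumes "sorted_wrt (<) es"
  shows "sorted_wrt (<) uppers"
proof -
  have "uppers = map (\<lambda>x. x + 2 ^ (3 * k + 2)) lowers"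
    by (simp only: map_concat map_map comp_def upper_def[abs_def])
  then show ?thesis using sorted_lowers[OF assms] by (simp add: sorted_wrt_map)
qed

lemma sorted_new_vertex_list:
  assumes "sorted_wrt (<) vs" "sorted_wrt (<) es"
  shows "sorted_wrt (<) (new_vertex_list k vs es)"
proof -
  have "sorted_wrt (<) (map (node k) vs)" using assms(1) by (simp add: sorted_wrt_map node_def)
  moreover have "x < y" if "x \<in> set (map (node k) vs)" "y \<in> set lowers" for x y
    using that vs_less node_less_lower by auto
  moreover have "x < y" if "x \<in> set lowers" "y \<in> set uppers" for x y
    using that es_less lower_less_upper by auto
  moreover have "x < y" if "x \<in> set (map (node k) vs)" "y \<in> set uppers" for x y
    using that vs_less node_less_upper by auto
  ultimately show ?thesis
    unfolding new_vertex_list_def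
    by (intro sorted_wrt_append3 sorted_lowers sorted_uppers assms(2))
qed

text \<open>First vertices decide: the tail arcs start at nodes, which lie below all lower copies,
  where the other arcs start. Arcs with a common tail are ordered by their upper copies, and a lower
  copy points to its node before its upper copy.\<close>

lemma sorted_new_arc_list:
  assumes "sorted_wrt (<) es"
  shows "sorted_wrt (<) (new_arc_list k es)"
proof -
  let ?f = "\<lambda>e. map (\<lambda>i. (node k (fst e), upper k e i)) [0..<k]"
  let ?h = "\<lambda>e i. [(lower k e i, node k (snd e)), (lower k e i, upper k e i)]"
  let ?g = "\<lambda>e. concat (map (?h e) [0..<k])"
  have 1: "sorted_wrt (<) (concat (map ?f es))"
  proof (rule sorted_wrt_concat_map[OF assms])
    show "sorted_wrt (<) (?f e)" for e
      unfolding sorted_wrt_map by (rule sorted_wrt_mono_rel[OF _ sorted_wrt_upt]) (simp add: lower_less_index upper_def)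
    show "x < y" if de: "d \<in> set es" "d < e" "x \<in> set (?f d)" "y \<in> set (?f e)" for d e x y
    proof -
      obtain i j where "i < k" "x = (node k (fst d), upper k d i)" "y = (node k (fst e), upper k e j)"
        using de(3,4) by auto
      moreover have "node k (fst d) \<le> node k (fst e)" using de(2) by (auto simp: node_def less_prod_def)
      ultimately show ?thesis using lower_less[OF de(2), of k i j] es_less[OF de(1)] by (simp add: upper_def)
    qed
  qed
  have 2: "sorted_wrt (<) (concat (map ?g es))"
  proof (rule sorted_wrt_concat_map[OF assms])
    show "sorted_wrt (<) (?g e)" if "e \<in> set es" for e
    proof (rule sorted_wrt_concat_map[OF sorted_wrt_upt])
      show "sorted_wrt (<) (?h e i)" for i
        using node_less_lower[of "snd e" k e i] es_less[OF that] by (simp add: upper_def)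
      show "x < y" if "i < j" "x \<in> set (?h e i)" "y \<in> set (?h e j)" for i j x y
        using that lower_less_index[of i j k e] by auto
    qed
    show "x < y" if de: "d \<in> set es" "d < e" "x \<in> set (?g d)" "y \<in> set (?g e)" for d e x y
    proof -
      obtain i j where ij: "i < k" "fst x = lower k d i" "fst y = lower k e j" using de(3,4) by auto
      then have "fst x < fst y" using lower_less[OF de(2), of k i j] es_less[OF de(1)] by simp
      then show ?thesis by (simp add: less_prod_def)
    qed
  qed
  have "x < y" if xy: "x \<in> set (concat (map ?f es))" "y \<in> set (concat (map ?g es))" for x y
  proof -
    obtain d e j where "d \<in> set es" "fst x = node k (fst d)" "fst y = lower k e j" using xy by auto
    then have "fst x < fst y" using es_less[of d] node_less_lower by simp
    then show ?thesis by (simp add: less_prod_def)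
  qed
  then show ?thesis unfolding new_arc_list_def sorted_wrt_append using 1 2 by blast
qed

text \<open>The lower copies with index 0 represent the arcs in their order, so the vertex list
  alone determines the order of both input lists.\<close>

lemma sorted_if_new_vertex_list:
  assumes "sorted_wrt (<) (new_vertex_list k vs es)"
  shows "sorted_wrt (<) vs" "sorted_wrt (<) es"
proof -
  show "sorted_wrt (<) vs" using assms by (simp add: new_vertex_list_def sorted_wrt_append sorted_wrt_map node_def)
  have "sorted_wrt (<) lowers" using assms by (simp add: new_vertex_list_def sorted_wrt_append)
  then show "sorted_wrt (<) es"
  proof (rule sorted_wrt_from_concat_map[where g = "\<lambda>e. lower k e 0"])
    show "lower k e 0 \<in> set (map (lower k e) [0..<k])" for e using k_pos by simp
    fix d e assume de: "d \<in> set es" "e \<in> set es" "lower k d 0 < lower k e 0"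
    then have "\<not> e < d" using lower_less[of e d k 0 0] es_less[of e] k_pos by auto
    moreover have "d \<noteq> e" using de(3) by auto
    ultimately show "d < e" by (meson linorder_less_linear)
  qed
qed

lemma set_new_arc_list:
  "set (new_arc_list k es) = {(node k (fst e), upper k e i) | e i. e \<in> set es \<and> i < k} \<union>
    {(lower k e i, node k (snd e)) | e i. e \<in> set es \<and> i < k} \<union>
    {(lower k e i, upper k e i) | e i. e \<in> set es \<and> i < k}"
proof -
  have 1: "set (concat (map (\<lambda>e. map (f e) [0..<k]) es)) = {f e i | e i. e \<in> set es \<and> i < k}"
    for f :: "nat \<times> nat \<Rightarrow> nat \<Rightarrow> nat \<times> nat" by fastforce
  have 2: "set (concat (map (\<lambda>e. concat (map (\<lambda>i. [f e i, g e i]) [0..<k])) es)) =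
      {f e i | e i. e \<in> set es \<and> i < k} \<union> {g e i | e i. e \<in> set es \<and> i < k}"
    for f g :: "nat \<times> nat \<Rightarrow> nat \<Rightarrow> nat \<times> nat" by fastforce
  show ?thesis unfolding new_arc_list_def set_append 1 2 by (simp only: Un_assoc)
qed

text \<open>Each input arc yields new arcs at the nodes of both its ends. A node lies below all
  copies, so as a listed vertex it can only stem from \<open>vs\<close>. Copy number 0 exists
  because \<open>k\<close> is positive.\<close>

lemma ends_if_new_arcs:
  assumes "set (new_arc_list k es) \<subseteq> set (new_vertex_list k vs es) \<times> set (new_vertex_list k vs es)"
  shows "set es \<subseteq> set vs \<times> set vs"
proof -
  have node: "v \<in> set vs" if "node k v \<in> set (new_vertex_list k vs es)" "v < 2 ^ k" for v
  proof -
    have ne: "node k v \<noteq> lower k e i" "node k v \<noteq> upper k e i" for e i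
      using node_less_lower[OF that(2), of e i] by (simp_all add: upper_def)
    then have "node k v \<in> node k ` set vs"
      using that(1) by (auto simp: new_vertex_list_def ne ne[symmetric])
    then show ?thesis by (auto simp: node_def)
  qed
  have "fst e \<in> set vs \<and> snd e \<in> set vs" if e: "e \<in> set es" for e
  proof -
    have 1: "(node k (fst e), upper k e 0) \<in> set (new_arc_list k es)"
      unfolding set_new_arc_list using e k_pos by blast
    have 2: "(lower k e 0, node k (snd e)) \<in> set (new_arc_list k es)"
      unfolding set_new_arc_list using e k_pos by blast
    have "node k (fst e) \<in> set (new_vertex_list k vs es)" "node k (snd e) \<in> set (new_vertex_list k vs es)"
      using subsetD[OF assms 1] subsetD[OF assms 2] by simp_all
    then show ?thesis using node es_less[OF e] by simp
  qed
  then show ?thesis by auto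
qed

lemma arc_gadget:
  assumes "set es \<subseteq> set vs \<times> set vs"
  shows "arc_gadget (set vs) (set es) k (node k) (lower k) (upper k)"
proof
  show "d = e \<and> i = j" if "d \<in> set es" "e \<in> set es" "i < k" "j < k" "lower k d i = lower k e j" for d e i j
    using that es_less by (intro lower_inject) auto
  then show "d = e \<and> i = j" if "d \<in> set es" "e \<in> set es" "i < k" "j < k" "upper k d i = upper k e j" for d e i j
    using that by (simp add: upper_def)
  show "node k v \<noteq> lower k e i" if "v \<in> set vs" for v e i
    using node_less_lower[OF vs_less[OF that], of e i] by simp
  show "node k v \<noteq> upper k e i" if "v \<in> set vs" for v e i
    using node_less_lower[OF vs_less[OF that], of e i] by (simp add: upper_def)
  show "lower k d i \<noteq> upper k e j" if "d \<in> set es" "i < k" for d e i j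
    using lower_less_upper[of d k i e j] es_less[OF that(1)] that(2) by simp
qed (use assms in \<open>auto simp: node_def\<close>)

lemma new_graph_sets:
  assumes "set es \<subseteq> set vs \<times> set vs"
  shows "set (new_vertex_list k vs es) = arc_gadget.new_vertices (set vs) (set es) k (node k) (lower k) (upper k)"
    "set (new_arc_list k es) = arc_gadget.new_arcs (set es) k (node k) (lower k) (upper k)"
proof -
  interpret g: arc_gadget "set vs" "set es" k "node k" "lower k" "upper k" by (rule arc_gadget[OF assms])
  show "set (new_vertex_list k vs es) = g.new_vertices"
    unfolding g.new_vertices_def g.VN_def g.VA_def g.VB_def new_vertex_list_def by force
  show "set (new_arc_list k es) = g.new_arcs"
    unfolding g.new_arcs_def set_new_arc_list ..
qed

lemma FAS_yes_iff_AHP_yes: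
  assumes sub: "set es \<subseteq> set vs \<times> set vs" and dist: "distinct vs" "distinct es"
    and k: "2 * length vs < k" and K: "0 < K" "K \<le> length vs"
  shows "FAS_yes (set vs) (set es) K \<longleftrightarrow>
    AHP_yes (set (new_vertex_list k vs es)) (set (new_arc_list k es)) (new_bound k (length vs) (length es) K)"
proof -
  interpret g: arc_gadget "set vs" "set es" k "node k" "lower k" "upper k" by (rule arc_gadget[OF sub])
  have c: "card (set vs) = length vs" "card (set es) = length es" using dist by (simp_all add: distinct_card)
  have "FAS_yes (set vs) (set es) K \<longleftrightarrow> (\<exists>F. feedback_arc_set (set es) F \<and> card F \<le> K)"
    using sub K c by (simp add: FAS_yes_def digraph_def)
  also have "\<dots> \<longleftrightarrow> (\<exists>\<pi>. H_star_partition g.new_vertices g.new_arcs \<pi> \<and>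
      card \<pi> \<le> new_bound k (length vs) (length es) K)"
    using g.feedback_arc_set_iff_partition[of K] k c by (simp add: new_bound_def)
  also have "\<dots> \<longleftrightarrow> AHP_yes g.new_vertices g.new_arcs (new_bound k (length vs) (length es) K)"
  proof -
    \<comment> \<open>Here the cap on \<open>K\<close> keeps the new bound within the
      \<open>n + 2 k m\<close> vertices.\<close>
    have "k * (length es + min K (length es)) \<le> 2 * (length es * k)"
      using mult_le_mono2[of "length es + min K (length es)" "2 * length es" k] by (simp add: mult.commute)
    then have "new_bound k (length vs) (length es) K \<le> card g.new_vertices"
      using g.card_new_vertices c by (simp add: new_bound_def)
    moreover have "0 < length vs" using K by linarith
    then have "0 < new_bound k (length vs) (length es) K" by (simp add: new_bound_def)
    ultimately show ?thesis using g.new_dag by (simp add: AHP_yes_def)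
  qed
  finally show ?thesis by (simp only: new_graph_sets[OF sub])
qed

end

section \<open>Membership of parsed words in the two languages\<close>

lemma enc_eq_list_code_iff:
  assumes "finite V" "finite E"
  shows "enc V E K = list_code vs es K' \<longleftrightarrow>
    V = set vs \<and> E = set es \<and> K = K' \<and> sorted_wrt (<) vs \<and> sorted_wrt (<) es"
proof
  assume "enc V E K = list_code vs es K'"
  then have "sorted_list_of_set V = vs \<and> sorted_list_of_set E = es \<and> K = K'"
    unfolding enc_eq by (rule list_code_inject)
  then show "V = set vs \<and> E = set es \<and> K = K' \<and> sorted_wrt (<) vs \<and> sorted_wrt (<) es"
    using assms strict_sorted_list_of_set by auto
next
  assume "V = set vs \<and> E = set es \<and> K = K' \<and> sorted_wrt (<) vs \<and> sorted_wrt (<) es"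
  then show "enc V E K = list_code vs es K'"
    unfolding enc_eq using sorted_list_of_set_eq_iff[of vs] sorted_list_of_set_eq_iff[of es] by simp
qed

lemma list_code_in_FAS_lang:
  "list_code vs es K \<in> FAS_lang \<longleftrightarrow> sorted_wrt (<) vs \<and> sorted_wrt (<) es \<and> FAS_yes (set vs) (set es) K"
proof -
  \<comment> \<open>On an infinite set \<open>sorted_list_of_set\<close> returns the empty list, so
    \<open>enc\<close> determines only finite sets.\<close>
  have fin: "finite V \<and> finite E" if "FAS_yes V E K" for V E K
    using that finite_subset by (auto simp: FAS_yes_def digraph_def)
  show ?thesis
  proof
    assume "list_code vs es K \<in> FAS_lang"
    then obtain V E L where e: "enc V E L = list_code vs es K" and yes: "FAS_yes V E L"
      by (auto simp: FAS_lang_def)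
    then show "sorted_wrt (<) vs \<and> sorted_wrt (<) es \<and> FAS_yes (set vs) (set es) K"
      using enc_eq_list_code_iff fin[OF yes] by simp
  next
    assume s: "sorted_wrt (<) vs \<and> sorted_wrt (<) es \<and> FAS_yes (set vs) (set es) K"
    then have e: "enc (set vs) (set es) K = list_code vs es K" by (simp add: enc_eq_list_code_iff)
    then show "list_code vs es K \<in> FAS_lang" using s unfolding FAS_lang_def e[symmetric] by blast
  qed
qed

lemma list_code_in_AHP_lang:
  "list_code vs es K \<in> AHP_lang \<longleftrightarrow> sorted_wrt (<) vs \<and> sorted_wrt (<) es \<and> AHP_yes (set vs) (set es) K"
proof -
  have fin: "finite V \<and> finite E" if "AHP_yes V E K" for V E K
    using that finite_subset by (auto simp: AHP_yes_def is_dag_def digraph_def)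
  show ?thesis
  proof
    assume "list_code vs es K \<in> AHP_lang"
    then obtain V E L where e: "enc V E L = list_code vs es K" and yes: "AHP_yes V E L"
      by (auto simp: AHP_lang_def)
    then show "sorted_wrt (<) vs \<and> sorted_wrt (<) es \<and> AHP_yes (set vs) (set es) K"
      using enc_eq_list_code_iff fin[OF yes] by simp
  next
    assume s: "sorted_wrt (<) vs \<and> sorted_wrt (<) es \<and> AHP_yes (set vs) (set es) K"
    then have e: "enc (set vs) (set es) K = list_code vs es K" by (simp add: enc_eq_list_code_iff)
    then show "list_code vs es K \<in> AHP_lang" using s unfolding AHP_lang_def e[symmetric] by blast
  qed
qed

theorem FAS_iff_reduction_AHP: "w \<in> FAS_lang \<longleftrightarrow> reduction w \<in> AHP_lang"
proof (cases "\<exists>p. is_instance w p")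
  case False
  have "w \<notin> FAS_lang"
  proof
    assume "w \<in> FAS_lang"
    then obtain V E K where w: "w = enc V E K" "FAS_yes V E K" by (auto simp: FAS_lang_def)
    then have "is_instance w (sorted_list_of_set V, sorted_list_of_set E, K)"
      by (simp add: is_instance_def enc_eq FAS_yes_def)
    then show False using False by blast
  qed
  moreover have "[] \<notin> AHP_lang" by (auto simp: AHP_lang_def enc_def)
  ultimately show ?thesis using False by (simp add: reduction_def)
next
  case True
  obtain vs es K where p: "(SOME p. is_instance w p) = (vs, es, K)" by (metis prod_cases3)
  define k where "k = 2 * length w"
  from True p have "is_instance w (vs, es, K)" by (metis someI_ex)
  then have w: "w = list_code vs es K" and K: "0 < K" "K \<le> length vs" by (auto simp: is_instance_def)
  have l: "length (arc_code es) + length (vertex_code vs) + 2 \<le> length w" by (simp add: w list_code_def)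
  have lv: "length (bin v) \<le> k" if "v \<in> set vs" for v
    using length_bin_word[OF that] l by (simp add: k_def)
  have le: "length (bin u) \<le> k \<and> length (bin v) \<le> k" if "(u, v) \<in> set es" for u v
    using length_bin_arc[OF that] l by (simp add: k_def)
  have r: "reduction w = list_code (new_vertex_list k vs es) (new_arc_list k es) (new_bound k (length vs) (length es) K)"
    using True p code_output_eq[OF lv le] by (simp add: reduction_def k_def)
  \<comment> \<open>The two symbols 4 and the \<open>n\<close> vertex separators give the word at
    least \<open>n + 2\<close> symbols.\<close>
  have k2: "2 * length vs < k" using l length_vertex_code[of vs] by (simp add: k_def)
  interpret encoded_graph vs es k
    using lv le less_power_length_bin k2 by unfold_locales auto
  show ?thesis
  proof
    assume "w \<in> FAS_lang"
    then have s: "sorted_wrt (<) vs" "sorted_wrt (<) es" and F: "FAS_yes (set vs) (set es) K"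
      unfolding w list_code_in_FAS_lang by auto
    then have "set es \<subseteq> set vs \<times> set vs" "distinct vs" "distinct es"
      by (auto simp: FAS_yes_def digraph_def strict_sorted_iff)
    from FAS_yes_iff_AHP_yes[OF this k2 K] F sorted_new_vertex_list[OF s] sorted_new_arc_list[OF s(2)]
    show "reduction w \<in> AHP_lang" unfolding r list_code_in_AHP_lang by simp
  next
    assume "reduction w \<in> AHP_lang"
    then have n: "sorted_wrt (<) (new_vertex_list k vs es)"
      and A: "AHP_yes (set (new_vertex_list k vs es)) (set (new_arc_list k es)) (new_bound k (length vs) (length es) K)"
      unfolding r list_code_in_AHP_lang by auto
    note s = sorted_if_new_vertex_list[OF n]
    have "set es \<subseteq> set vs \<times> set vs"
      using A by (intro ends_if_new_arcs) (simp add: AHP_yes_def is_dag_def digraph_def)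
    moreover have "distinct vs" "distinct es" using s by (simp_all add: strict_sorted_iff)
    ultimately show "w \<in> FAS_lang" unfolding w list_code_in_FAS_lang
      using FAS_yes_iff_AHP_yes[OF _ _ _ k2 K] A s by simp
  qed
qed

theorem theorem5p10:
  shows "poly_reducible FAS_lang AHP_lang"
proof -
  obtain M c where "wf_tm M" "\<forall>w \<in> lists {1, 2, 3, 4}. \<exists>k \<le> c * length w ^ c + c.
     fst ((tm_step M ^^ k) (tm_init w)) = 1 \<and> tm_output ((tm_step M ^^ k) (tm_init w)) = reduction w"
    using reduction_poly_time by blast
  then show ?thesis unfolding poly_reducible_def using FAS_iff_reduction_AHP by blast
qed

end
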